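(* Let $X$ be the simplicial complex on vertex set $\{0,1,\dots,9\}$ with the $14$ facets $$1249,\ 1269,\ 1569,\ 1589,\ 1489,\ 1458,\ 1457,\ 4578,\ 1256,\ 0125,\ 0256,\ 0123,\ 1234,\ 1347,$$ let $A$ be its subcomplex with facets $026,\ 023,\ 234,\ 347,\ 478$, and let $C_3$ be the simplicial complex (on $n=16$ vertices) obtained by gluing together three copies of $X$ along $A$. Let $\Bbbk$ be a field, $S=\Bbbk[x_1,\dots,x_n]$, and let $I\subseteq S$ be the Stanley--Reisner ideal of $C_3$. Then $$\operatorname{sdepth} S/I < \operatorname{depth} S/I .$$ In particular, the assertion that $\operatorname{sdepth} M\geq\operatorname{depth} M$ for all $\mathbb{Z}^n$-graded $S$-modules $M$ (the Depth Conjecture) is false.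
   Context: The notation $v_1\cdots v_k$ abbreviates the set $\{v_1,\dots,v_k\}$. A simplicial complex is a finite collection of subsets (faces) of a finite set closed under taking subsets; facets are maximal faces, and the complex with given facets consists of all subsets of those facets. The subcomplex $A$ is the induced subcomplex of $X$ on $\{0,2,3,4,6,7,8\}$. Gluing: take the stated number of copies of $X$ on disjoint vertex sets and, for each vertex $v$ of $A$, identify all copies of $v$ to a single vertex. Since $A$ is induced, the result is a simplicial complex whose faces are the images of the faces of the copies of $X$, and any two copies of $X$ intersect exactly in $A$. The Stanley--Reisner ideal of a simplicial complex $\Delta$ with vertices labeled $1,\dots,n$ is the ideal of $S=\Bbbk[x_1,\dots,x_n]$ generated by the squarefree monomials $\prod_{i\in\sigma}x_i$ with $\sigma\subseteq\{1,\dots,n\}$, $\sigma\notin\Delta$. The ring $S$ has its standard $\mathbb{Z}^n$-grading, and depth is taken with respect to the ideal $(x_1,\dots,x_n)$. Stanley depth: for a $\mathbb{Z}^n$-graded $S$-module $M$, a Stanley decomposition $\mathcal{D}$ of $M$ is a vector space decomposition $M=\bigoplus_{i=1}^r\Bbbk[X_i]\cdot m_i$, where each $X_i\subseteq\{x_1,\dots,x_n\}$, each $m_i$ is a homogeneous element of $M$, and each $\Bbbk[X_i]\cdot m_i$ is a free $\Bbbk[X_i]$-module (of rank one). The Stanley depth is $\operatorname{sdepth}M=\max_{\mathcal{D}}\min(|X_1|,\dots,|X_r|)$, where $\mathcal{D}$ ranges over all Stanley decompositions of $M$. *)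

theory Defs
  imports "HOL-Algebra.Module" "HOL-Algebra.Ideal" "HOL-Library.Poly_Mapping" "HOL-Library.Extended_Nat"
begin

section \<open>Simplicial complexes and gluing\<close>

definition complex_of :: "'v set set \<Rightarrow> 'v set set" where
  "complex_of F = (\<Union>\<sigma>\<in>F. Pow \<sigma>)"

definition vertices :: "'v set set \<Rightarrow> 'v set" where
  "vertices \<Delta> = \<Union>\<Delta>"

text \<open>
  Vertices of the glued complex: \<open>Inl v\<close> is the common image of all copies of a vertex
  \<open>v\<close> of \<open>A\<close>, and \<open>Inr (j, v)\<close> is the \<open>j\<close>-th copy of a vertex \<open>v\<close> outside \<open>A\<close>.
\<close>

definition copy_vertex :: "'v set set \<Rightarrow> nat \<Rightarrow> 'v \<Rightarrow> 'v + nat \<times> 'v" where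
  "copy_vertex A j v = (if v \<in> vertices A then Inl v else Inr (j, v))"

definition glue :: "nat \<Rightarrow> 'v set set \<Rightarrow> 'v set set \<Rightarrow> ('v + nat \<times> 'v) set set" where
  "glue N X A = (\<Union>j\<in>{..<N}. (\<lambda>\<sigma>. copy_vertex A j ` \<sigma>) ` X)"

definition X_complex :: "nat set set" where
  "X_complex = complex_of
    {{1,2,4,9}, {1,2,6,9}, {1,5,6,9}, {1,5,8,9}, {1,4,8,9}, {1,4,5,8}, {1,4,5,7},
     {4,5,7,8}, {1,2,5,6}, {0,1,2,5}, {0,2,5,6}, {0,1,2,3}, {1,2,3,4}, {1,3,4,7}}"

definition A_complex :: "nat set set" where
  "A_complex = complex_of {{0,2,6}, {0,2,3}, {2,3,4}, {3,4,7}, {4,7,8}}"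

definition C3 :: "(nat + nat \<times> nat) set set" where
  "C3 = glue 3 X_complex A_complex"

section \<open>Polynomial rings\<close>

text \<open>
  A polynomial is a finitely supported map from exponent vectors to coefficients;
  \<open>mpoly_ring n\<close> is the ring of polynomials in the variables with indices \<open>1, \<dots>, n\<close>.
\<close>

type_synonym 'k mpoly = "(nat \<Rightarrow>\<^sub>0 nat) \<Rightarrow>\<^sub>0 'k"

definition polys_in :: "nat set \<Rightarrow> 'k::field mpoly set" where
  "polys_in V = {p. \<forall>t\<in>Poly_Mapping.keys p. Poly_Mapping.keys t \<subseteq> V}"

definition mpoly_ring :: "nat \<Rightarrow> 'k::field mpoly ring" where
  "mpoly_ring n = \<lparr>carrier = polys_in {1..n}, mult = (*), one = 1, zero = 0, add = (+)\<rparr>"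

text \<open>The ring \<open>S\<close> as a module over itself.\<close>

definition mpoly_module :: "nat \<Rightarrow> ('k::field mpoly, 'k mpoly) module" where
  "mpoly_module n = \<lparr>carrier = polys_in {1..n}, mult = (*), one = 1, zero = 0, add = (+),
     smult = (*)\<rparr>"

definition mvar :: "nat \<Rightarrow> 'k::field mpoly" where
  "mvar i = Poly_Mapping.single (Poly_Mapping.single i 1) 1"

definition max_homog_ideal :: "nat \<Rightarrow> 'k::field mpoly set" where
  "max_homog_ideal n = Idl\<^bsub>mpoly_ring n\<^esub> (mvar ` {1..n})"

definition stanley_reisner_ideal :: "nat \<Rightarrow> nat set set \<Rightarrow> 'k::field mpoly set" where
  "stanley_reisner_ideal n \<Delta> =
     Idl\<^bsub>mpoly_ring n\<^esub> {(\<Prod>i\<in>\<sigma>. mvar i) | \<sigma>. \<sigma> \<subseteq> {1..n} \<and> \<sigma> \<notin> \<Delta>}"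

section \<open>Quotient modules and depth\<close>

text \<open>
  Quotient of a module by a submodule \<open>N\<close>: the scalar \<open>a\<close> sends the coset \<open>Y\<close> to
  \<open>N + aY\<close>.  The fields \<open>mult\<close> and \<open>one\<close> of a module record play no role.
\<close>

definition quot_module :: "('a, 'm) module \<Rightarrow> 'm set \<Rightarrow> ('a, 'm set) module" where
  "quot_module M N = \<lparr>carrier = a_rcosets\<^bsub>M\<^esub> N, mult = undefined, one = undefined,
     zero = N, add = set_add M,
     smult = (\<lambda>a Y. N <+>\<^bsub>M\<^esub> ((\<lambda>x. a \<odot>\<^bsub>M\<^esub> x) ` Y))\<rparr>"

text \<open>The submodule \<open>(f\<^sub>1, \<dots>, f\<^sub>r)M\<close>.\<close>

definition list_mult_module :: "('a, 'm) module \<Rightarrow> 'a list \<Rightarrow> 'm set" where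
  "list_mult_module M fs =
     {(\<Oplus>\<^bsub>M\<^esub>j\<in>{..<length fs}. fs ! j \<odot>\<^bsub>M\<^esub> g j) | g. g \<in> {..<length fs} \<rightarrow> carrier M}"

definition nonzerodivisor_on :: "('a, 'm) module \<Rightarrow> 'a \<Rightarrow> bool" where
  "nonzerodivisor_on M f \<longleftrightarrow> (\<forall>x\<in>carrier M. f \<odot>\<^bsub>M\<^esub> x = \<zero>\<^bsub>M\<^esub> \<longrightarrow> x = \<zero>\<^bsub>M\<^esub>)"

definition regular_sequence :: "('a, 'm) module \<Rightarrow> 'a list \<Rightarrow> bool" where
  "regular_sequence M fs \<longleftrightarrow>
     (\<forall>i<length fs. nonzerodivisor_on (quot_module M (list_mult_module M (take i fs))) (fs ! i))
     \<and> list_mult_module M fs \<noteq> carrier M"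

text \<open>Depth with respect to the ideal generated by all variables.\<close>

definition depth :: "nat \<Rightarrow> ('k::field mpoly, 'm) module \<Rightarrow> enat" where
  "depth n M = (SUP fs\<in>{fs. set fs \<subseteq> max_homog_ideal n \<and> regular_sequence M fs}. enat (length fs))"

section \<open>Multigraded modules and Stanley depth\<close>

text \<open>
  \<open>M\<close> is the internal direct sum of the family \<open>N\<close> of additive subgroups: every element is
  a finite sum of components in exactly one way.
\<close>

definition internal_direct_sum :: "('a, 'm) module \<Rightarrow> 'i set \<Rightarrow> ('i \<Rightarrow> 'm set) \<Rightarrow> bool" where
  "internal_direct_sum M I N \<longleftrightarrow>
     (\<forall>i\<in>I. subgroup (N i) (add_monoid M)) \<and>
     (\<forall>x\<in>carrier M. \<exists>!f. f \<in> (\<Pi>\<^sub>E i\<in>I. N i) \<and> finite {i\<in>I. f i \<noteq> \<zero>\<^bsub>M\<^esub>} \<and>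
        x = (\<Oplus>\<^bsub>M\<^esub>i\<in>{i\<in>I. f i \<noteq> \<zero>\<^bsub>M\<^esub>}. f i))"

text \<open>The group \<open>\<int>\<^sup>n\<close> of multidegrees.\<close>

definition multidegrees :: "nat \<Rightarrow> (nat \<Rightarrow>\<^sub>0 int) set" where
  "multidegrees n = {a. Poly_Mapping.keys a \<subseteq> {1..n}}"

definition multidegree :: "(nat \<Rightarrow>\<^sub>0 nat) \<Rightarrow> (nat \<Rightarrow>\<^sub>0 int)" where
  "multidegree t = Poly_Mapping.map int t"

text \<open>The standard grading of \<open>S\<close>; the component is zero in degrees with a negative entry.\<close>

definition mpoly_grading :: "nat \<Rightarrow> (nat \<Rightarrow>\<^sub>0 int) \<Rightarrow> 'k::field mpoly set" where
  "mpoly_grading n a = {p \<in> polys_in {1..n}. \<forall>t\<in>Poly_Mapping.keys p. multidegree t = a}"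

definition graded_module ::
    "nat \<Rightarrow> ('k::field mpoly, 'm) module \<Rightarrow> ((nat \<Rightarrow>\<^sub>0 int) \<Rightarrow> 'm set) \<Rightarrow> bool" where
  "graded_module n M gr \<longleftrightarrow>
     Module.module (mpoly_ring n) M \<and>
     internal_direct_sum M (multidegrees n) gr \<and>
     (\<forall>a\<in>multidegrees n. \<forall>b\<in>multidegrees n. \<forall>p\<in>mpoly_grading n a. \<forall>x\<in>gr b.
        p \<odot>\<^bsub>M\<^esub> x \<in> gr (a + b))"

definition quot_grading ::
    "('a, 'm) module \<Rightarrow> ('d \<Rightarrow> 'm set) \<Rightarrow> 'm set \<Rightarrow> ('d \<Rightarrow> 'm set set)" where
  "quot_grading M gr N a = (\<lambda>x. N +>\<^bsub>M\<^esub> x) ` gr a"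

definition finitely_generated :: "nat \<Rightarrow> ('k::field mpoly, 'm) module \<Rightarrow> bool" where
  "finitely_generated n M \<longleftrightarrow>
     (\<exists>B. finite B \<and> B \<subseteq> carrier M \<and>
        (\<forall>x\<in>carrier M. \<exists>c\<in>B \<rightarrow> carrier (mpoly_ring n). x = (\<Oplus>\<^bsub>M\<^esub>b\<in>B. c b \<odot>\<^bsub>M\<^esub> b)))"

text \<open>
  A Stanley decomposition with \<open>r\<close> summands \<open>\<bbbk>[X\<^sub>i]\<cdot>z\<^sub>i\<close>, where \<open>X\<^sub>i\<close> is given by the indices
  of its variables.  Injectivity of \<open>p \<mapsto> p z\<^sub>i\<close> is freeness of the summand.  Summands are
  closed under scalars from \<open>\<bbbk>\<close>, so a decomposition into additive subgroups is one into subspaces.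
\<close>

definition stanley_decomposition ::
    "nat \<Rightarrow> ('k::field mpoly, 'm) module \<Rightarrow> ((nat \<Rightarrow>\<^sub>0 int) \<Rightarrow> 'm set) \<Rightarrow>
     nat \<Rightarrow> (nat \<Rightarrow> nat set) \<Rightarrow> (nat \<Rightarrow> 'm) \<Rightarrow> bool" where
  "stanley_decomposition n M gr r X z \<longleftrightarrow>
     (\<forall>i<r. X i \<subseteq> {1..n} \<and> (\<exists>a\<in>multidegrees n. z i \<in> gr a) \<and>
        inj_on (\<lambda>p. p \<odot>\<^bsub>M\<^esub> z i) (polys_in (X i))) \<and>
     internal_direct_sum M {..<r} (\<lambda>i. (\<lambda>p. p \<odot>\<^bsub>M\<^esub> z i) ` polys_in (X i))"

text \<open>
  The value for the zero module (empty decomposition) is \<open>\<infinity>\<close>.  For a nonzero module all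
  minima are at most \<open>n\<close>, so the supremum is a maximum whenever a decomposition exists.
\<close>

definition sdepth ::
    "nat \<Rightarrow> ('k::field mpoly, 'm) module \<Rightarrow> ((nat \<Rightarrow>\<^sub>0 int) \<Rightarrow> 'm set) \<Rightarrow> enat" where
  "sdepth n M gr =
     (SUP (r, X, z)\<in>{(r, X, z). stanley_decomposition n M gr r X z}.
        INF i\<in>{..<r}. enat (card (X i)))"

text \<open>
  The Depth Conjecture for the modules over one polynomial ring whose elements form a subset
  of the type \<open>'m\<close>.  A module with a Stanley decomposition is generated by the finitely many
  \<open>z\<^sub>i\<close>, so Stanley depth is only meaningful for finitely generated modules.
\<close>

definition depth_conjecture :: "'k::field itself \<Rightarrow> 'm itself \<Rightarrow> nat \<Rightarrow> bool" where
  "depth_conjecture _ _ n \<longleftrightarrow>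
     (\<forall>(M :: ('k mpoly, 'm) module) gr.
        graded_module n M gr \<and> finitely_generated n M \<longrightarrow> sdepth n M gr \<ge> depth n M)"

section \<open>Stanley--Reisner rings\<close>

definition face_ring :: "nat \<Rightarrow> nat set set \<Rightarrow> ('k::field mpoly, 'k mpoly set) module" where
  "face_ring n \<Delta> = quot_module (mpoly_module n) (stanley_reisner_ideal n \<Delta>)"

definition face_ring_grading ::
    "nat \<Rightarrow> nat set set \<Rightarrow> (nat \<Rightarrow>\<^sub>0 int) \<Rightarrow> 'k::field mpoly set set" where
  "face_ring_grading n \<Delta> =
     quot_grading (mpoly_module n) (mpoly_grading n) (stanley_reisner_ideal n \<Delta>)"

text \<open>Images of the faces under a labeling of the vertices.\<close>

definition relabel :: "('v \<Rightarrow> 'w) \<Rightarrow> 'v set set \<Rightarrow> 'w set set" where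
  "relabel lab \<Delta> = (\<lambda>\<sigma>. lab ` \<sigma>) ` \<Delta>"

end

theory Submission
  imports Defs
begin

text \<open>
  Depth at least 4: three linear forms \<open>\<theta>\<^sub>1, \<theta>\<^sub>2, \<theta>\<^sub>3\<close> and a fourth one \<open>\<theta>\<^sub>4\<close> with
  coefficients 0 and 1 restrict to a basis of the linear forms on every facet of \<open>X\<close>, and the first
  three do so on every facet of \<open>A\<close>.  The given facet orders are shellings, and a shelling
  filters the face ring with polynomial rings as subquotients, so the four forms are a regular
  sequence on \<open>\<bbbk>[X]\<close> and the first three are one on \<open>\<bbbk>[A]\<close>.  Hence all four are regular on the
  kernel of \<open>\<bbbk>[X] \<rightarrow> \<bbbk>[A]\<close>, which is also the kernel of the map that forgets one glued copy.

  Stanley depth at most 3: if all \<open>X\<^sub>i\<close> in a Stanley decomposition have at least 4 elements,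
  they are facets, and the squarefree degrees show that the complex is partitioned into intervals,
  one below each facet.  In each copy of \<open>X\<close>, the intervals below its facets then cover the
  vertex 6 or the vertex 8; these lie in \<open>A\<close>, so two of the three copies cover the same vertex.
\<close>

section \<open>Regular sequences on subquotients\<close>

text \<open>The field is arbitrary, possibly finite, so generic linear forms may not exist; hence
  explicit forms whose coefficients work in every characteristic. Only a lower bound for the depth
  is needed, so nothing is shown about longer regular sequences. \<open>A\<close> has dimension 2
  and \<open>X\<close> has dimension 3. Three forms are therefore all that the face ring of
  \<open>A\<close> can admit, and they suffice because the kernel of a surjection can be one step
  deeper than its target. The obstruction to a partition is relative: a face of a copy that is not
  in \<open>A\<close> can only be covered from that copy, while a face of \<open>A\<close> can be
  covered from any copy. With very many copies, some copy would cover nothing of \<open>A\<close> at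
  all. Three are enough because every copy must cover one of two particular vertices of
  \<open>A\<close>, and three exceeds two.\<close>

definition stable_subgroup :: "'a::comm_ring_1 list \<Rightarrow> 'a set \<Rightarrow> bool" where
  "stable_subgroup as K \<longleftrightarrow> 0 \<in> K \<and> (\<forall>x\<in>K. \<forall>y\<in>K. x - y \<in> K) \<and> (\<forall>a\<in>set as. \<forall>x\<in>K. a * x \<in> K)"

text \<open>Dividing L / K by \<open>a\<close> gives L / (K + a L). The subgroups are only required
  to be closed under the sequence itself, since \<open>polys_in V\<close> is not an ideal among the
  polynomials in all variables.\<close>

definition plus_mult :: "'a::comm_ring_1 \<Rightarrow> 'a set \<Rightarrow> 'a set \<Rightarrow> 'a set" where
  "plus_mult a K L = {k + a * x | k x. k \<in> K \<and> x \<in> L}"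

text \<open>
  The sequence is regular on \<open>L / K\<close>, except that the quotient by it may vanish; dividing by the
  first element is expressed by enlarging \<open>K\<close>.
\<close>

fun wreg :: "'a::comm_ring_1 list \<Rightarrow> 'a set \<Rightarrow> 'a set \<Rightarrow> bool" where
  "wreg [] L K = True"
| "wreg (a # as) L K = ((\<forall>x\<in>L. a * x \<in> K \<longrightarrow> x \<in> K) \<and> wreg as L (plus_mult a K L))"

lemma stable_subgroupD:
  assumes "stable_subgroup as K"
  shows "0 \<in> K" "x \<in> K \<Longrightarrow> y \<in> K \<Longrightarrow> x - y \<in> K" "x \<in> K \<Longrightarrow> - x \<in> K"
    "x \<in> K \<Longrightarrow> y \<in> K \<Longrightarrow> x + y \<in> K" "a \<in> set as \<Longrightarrow> x \<in> K \<Longrightarrow> a * x \<in> K"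
proof -
  have z: "0 \<in> K" and d: "\<And>x y. x \<in> K \<Longrightarrow> y \<in> K \<Longrightarrow> x - y \<in> K"
    using assms by (auto simp: stable_subgroup_def)
  have m: "- x \<in> K" if "x \<in> K" for x using d[OF z that] by simp
  show "0 \<in> K" "x \<in> K \<Longrightarrow> y \<in> K \<Longrightarrow> x - y \<in> K" "x \<in> K \<Longrightarrow> - x \<in> K"
    using z d m by auto
  show "x \<in> K \<Longrightarrow> y \<in> K \<Longrightarrow> x + y \<in> K" using d[of x "- y"] m[of y] by simp
  show "a \<in> set as \<Longrightarrow> x \<in> K \<Longrightarrow> a * x \<in> K"
    using assms by (auto simp: stable_subgroup_def)
qed

lemma plus_multI: "k \<in> K \<Longrightarrow> x \<in> L \<Longrightarrow> k + a * x \<in> plus_mult a K L"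
  by (auto simp: plus_mult_def)

lemma stable_subgroup_subset:
  "stable_subgroup bs K \<Longrightarrow> set as \<subseteq> set bs \<Longrightarrow> stable_subgroup as K"
  by (auto simp: stable_subgroup_def)

lemma stable_plus_mult:
  assumes "stable_subgroup as K" "stable_subgroup as L"
  shows "stable_subgroup as (plus_mult a K L)"
proof -
  have "0 \<in> plus_mult a K L"
    using stable_subgroupD(1)[OF assms(1)] stable_subgroupD(1)[OF assms(2)]
    by (auto simp: plus_mult_def intro!: exI[of _ 0])
  moreover have "u - w \<in> plus_mult a K L" if "u \<in> plus_mult a K L" "w \<in> plus_mult a K L" for u w
  proof -
    from that obtain k x k' x' where "u = k + a * x" "w = k' + a * x'" "k \<in> K" "k' \<in> K" "x \<in> L" "x' \<in> L"
      by (auto simp: plus_mult_def)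
    then have "u - w = (k - k') + a * (x - x')" "k - k' \<in> K" "x - x' \<in> L"
      using stable_subgroupD(2)[OF assms(1)] stable_subgroupD(2)[OF assms(2)]
      by (auto simp: algebra_simps)
    then show ?thesis by (auto simp: plus_mult_def)
  qed
  moreover have "b * u \<in> plus_mult a K L" if "u \<in> plus_mult a K L" "b \<in> set as" for u b
  proof -
    from that obtain k x where "u = k + a * x" "k \<in> K" "x \<in> L"
      by (auto simp: plus_mult_def)
    then have "b * u = b * k + a * (b * x)" "b * k \<in> K" "b * x \<in> L"
      using stable_subgroupD(5)[OF assms(1)] stable_subgroupD(5)[OF assms(2)] that(2)
      by (auto simp: algebra_simps)
    then show ?thesis by (auto simp: plus_mult_def)
  qed
  ultimately show ?thesis by (auto simp: stable_subgroup_def)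
qed

lemma subset_plus_mult: "stable_subgroup as L \<Longrightarrow> K \<subseteq> plus_mult a K L"
  using plus_multI[OF _ stable_subgroupD(1), of _ K as L a] by auto

lemma plus_mult_subset:
  "stable_subgroup (a # as) L \<Longrightarrow> K \<subseteq> L \<Longrightarrow> plus_mult a K L \<subseteq> L"
  by (auto simp: plus_mult_def intro!: stable_subgroupD(4)[of "a # as" L] stable_subgroupD(5)[of "a # as" L])

text \<open>Invariance under the isomorphism of \<open>M / K\<close> with \<open>M' / K'\<close> induced by \<open>f\<close>.\<close>

lemma wreg_iso:
  assumes "length as = length bs"
    and add: "\<And>x y. f (x + y) = f x + f y"
    and comm: "\<And>i x. i < length as \<Longrightarrow> f (as ! i * x) = bs ! i * f x"
    and "stable_subgroup as M" "stable_subgroup as K" "K \<subseteq> M"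
    and "stable_subgroup bs M'" "stable_subgroup bs K'" "K' \<subseteq> M'"
    and into: "\<And>x. x \<in> M \<Longrightarrow> f x \<in> M'"
    and onto: "\<And>y. y \<in> M' \<Longrightarrow> \<exists>x\<in>M. y - f x \<in> K'"
    and ker: "\<And>x. x \<in> M \<Longrightarrow> f x \<in> K' \<longleftrightarrow> x \<in> K"
  shows "wreg as M K \<longleftrightarrow> wreg bs M' K'"
  using assms(1,3-)
proof (induction as arbitrary: bs K K')
  case Nil
  then show ?case by simp
next
  case (Cons a as)
  from Cons.prems(1) obtain b bs' where bs: "bs = b # bs'" "length as = length bs'"
    by (cases bs) auto
  have fa: "f (a * x) = b * f x" for x using Cons.prems(2)[of 0] bs by simp
  note M = Cons.prems(3) and K = Cons.prems(4) and M' = Cons.prems(6) and K' = Cons.prems(7)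
  note into = Cons.prems(9) and onto = Cons.prems(10) and ker = Cons.prems(11)
  have minus: "f (x - y) = f x - f y" for x y
    using add[of "x - y" y] by (simp add: algebra_simps)
  have hd: "(\<forall>x\<in>M. a * x \<in> K \<longrightarrow> x \<in> K) \<longleftrightarrow> (\<forall>y\<in>M'. b * y \<in> K' \<longrightarrow> y \<in> K')"
  proof (intro iffI ballI impI)
    fix y assume H: "\<forall>x\<in>M. a * x \<in> K \<longrightarrow> x \<in> K" and y: "y \<in> M'" "b * y \<in> K'"
    from onto[OF y(1)] obtain x where x: "x \<in> M" "y - f x \<in> K'" by blast
    have "b * y - b * (y - f x) \<in> K'"
      using stable_subgroupD(2)[OF K' y(2)] stable_subgroupD(5)[OF K' _ x(2), of b] bs by simp
    then have "f (a * x) \<in> K'" by (simp add: fa algebra_simps)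
    then have "x \<in> K" using H x(1) ker stable_subgroupD(5)[OF M _ x(1), of a] by simp
    then have "f x \<in> K'" using ker x by simp
    then show "y \<in> K'" using stable_subgroupD(4)[OF K' x(2)] by force
  next
    fix x assume H: "\<forall>y\<in>M'. b * y \<in> K' \<longrightarrow> y \<in> K'" and x: "x \<in> M" "a * x \<in> K"
    then show "x \<in> K" using ker into fa by (metis Cons.prems(5) subsetD)
  qed
  \<comment> \<open>\<open>f\<close> still induces an isomorphism after both sides are divided by
    their first elements; surjectivity is inherited because \<open>K'\<close> only grows, and the
    work lies in the kernel.\<close>
  have tl: "wreg as M (plus_mult a K M) \<longleftrightarrow> wreg bs' M' (plus_mult b K' M')"
  proof (rule Cons.IH)
    show "f (as ! i * x) = bs' ! i * f x" if "i < length as" for i x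
      using Cons.prems(2)[of "Suc i"] that bs by simp
    show "stable_subgroup as M" "stable_subgroup bs' M'"
      using stable_subgroup_subset[OF M] stable_subgroup_subset[OF M'] bs by auto
    then show "stable_subgroup as (plus_mult a K M)" "stable_subgroup bs' (plus_mult b K' M')"
      using stable_subgroup_subset[OF K] stable_subgroup_subset[OF K'] bs
      by (auto intro!: stable_plus_mult)
    show "plus_mult a K M \<subseteq> M" "plus_mult b K' M' \<subseteq> M'"
      using plus_mult_subset[OF M Cons.prems(5)] plus_mult_subset[OF M'[unfolded bs] Cons.prems(8)] by auto
    show "\<exists>x\<in>M. y - f x \<in> plus_mult b K' M'" if "y \<in> M'" for y
      using onto[OF that] subset_plus_mult[OF M', of K' b] by blast
    show "f x \<in> plus_mult b K' M' \<longleftrightarrow> x \<in> plus_mult a K M" if x: "x \<in> M" for x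
    proof
      assume "f x \<in> plus_mult b K' M'"
      then obtain k y where ky: "f x = k + b * y" "k \<in> K'" "y \<in> M'" by (auto simp: plus_mult_def)
      from onto[OF ky(3)] obtain z where z: "z \<in> M" "y - f z \<in> K'" by blast
      \<comment> \<open>\<open>y\<close> lifts to \<open>z\<close> only modulo \<open>K'\<close>;
        the resulting error is again in \<open>K'\<close>.\<close>
      have "f (x - a * z) = k + b * (y - f z)" by (simp add: minus fa ky algebra_simps)
      also have "\<dots> \<in> K'" using stable_subgroupD(4)[OF K' ky(2)] stable_subgroupD(5)[OF K' _ z(2), of b] bs
        by simp
      finally have "x - a * z \<in> K"
        using ker stable_subgroupD(2)[OF M x] stable_subgroupD(5)[OF M _ z(1), of a] by simp
      moreover have "x = (x - a * z) + a * z" by simp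
      ultimately show "x \<in> plus_mult a K M" using z(1) unfolding plus_mult_def by blast
    next
      assume "x \<in> plus_mult a K M"
      then obtain k y where "x = k + a * y" "k \<in> K" "y \<in> M" by (auto simp: plus_mult_def)
      then show "f x \<in> plus_mult b K' M'"
        using ker[of k] into[of y] Cons.prems(5) by (auto simp: add fa intro: plus_multI)
    qed
  qed (use bs into in auto)
  show ?case by (simp add: bs hd tl)
qed

text \<open>A nonzerodivisor \<open>a\<close> on L / M keeps the sequence of M / K, L / K and L / M
  exact after division by \<open>a\<close>: the intersection of M with K + a L is K + a M. The
  reduced M / K is thus the submodule (M + a L) / (K + a L) of the reduced L / K.\<close>

lemma wreg_plus_mult:
  assumes M: "stable_subgroup (a # as) M" and K: "stable_subgroup (a # as) K"
    and L: "stable_subgroup (a # as) L"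
    and "K \<subseteq> M" "M \<subseteq> L" and nzd: "\<And>x. x \<in> L \<Longrightarrow> a * x \<in> M \<Longrightarrow> x \<in> M"
  shows "wreg as M (plus_mult a K M) \<longleftrightarrow> wreg as (plus_mult a M L) (plus_mult a K L)"
proof (rule wreg_iso[where f = "\<lambda>x. x"])
  note sub = stable_subgroup_subset[of "a # as", OF _ set_subset_Cons]
  show "stable_subgroup as M" "stable_subgroup as (plus_mult a K M)"
    "stable_subgroup as (plus_mult a M L)" "stable_subgroup as (plus_mult a K L)"
    using sub[OF M] sub[OF K] sub[OF L] by (auto intro!: stable_plus_mult)
  show "plus_mult a K M \<subseteq> M" using plus_mult_subset[OF M \<open>K \<subseteq> M\<close>] .
  show "plus_mult a K L \<subseteq> plus_mult a M L" using \<open>K \<subseteq> M\<close> by (auto simp: plus_mult_def)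
  show "x \<in> plus_mult a M L" if "x \<in> M" for x using that subset_plus_mult[OF L] by auto
  show "\<exists>x\<in>M. y - x \<in> plus_mult a K L" if "y \<in> plus_mult a M L" for y
  proof -
    from that obtain m l where "y = m + a * l" "m \<in> M" "l \<in> L" by (auto simp: plus_mult_def)
    then show ?thesis using plus_multI[OF stable_subgroupD(1)[OF K], of l L a]
      by (intro bexI[of _ m]) auto
  qed
  show "x \<in> plus_mult a K L \<longleftrightarrow> x \<in> plus_mult a K M" if "x \<in> M" for x
  proof
    assume "x \<in> plus_mult a K L"
    then obtain k l where x: "x = k + a * l" "k \<in> K" "l \<in> L" by (auto simp: plus_mult_def)
    then have "a * l \<in> M" using stable_subgroupD(2)[OF M \<open>x \<in> M\<close>, of k] \<open>K \<subseteq> M\<close> by auto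
    then show "x \<in> plus_mult a K M" using nzd x by (auto simp: plus_mult_def)
  qed (use \<open>M \<subseteq> L\<close> in \<open>auto simp: plus_mult_def\<close>)
qed auto

text \<open>An element that is a nonzerodivisor on the submodule M / K and on the quotient L / M is
  one on L / K, and by \<open>wreg_plus_mult\<close> the three reduced modules are again in the same
  position.\<close>

lemma wreg_extension:
  assumes "wreg as M K" "wreg as L M" "K \<subseteq> M" "M \<subseteq> L"
    "stable_subgroup as M" "stable_subgroup as K" "stable_subgroup as L"
  shows "wreg as L K"
  using assms
proof (induction as arbitrary: M K)
  case (Cons a as)
  note sub = stable_subgroup_subset[of "a # as", OF _ set_subset_Cons]
  have "wreg as (plus_mult a M L) (plus_mult a K L)"
    using wreg_plus_mult[OF Cons.prems(5,6,7,3,4)] Cons.prems(1,2) by auto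
  then have "wreg as L (plus_mult a K L)"
    using Cons.prems
    by (intro Cons.IH[of "plus_mult a M L" "plus_mult a K L"] stable_plus_mult sub plus_mult_subset)
       (auto simp: plus_mult_def)
  then show ?case using Cons.prems by auto
qed auto

text \<open>This is the depth lemma for the kernel M / K of L / K onto L / M. Each element of
  \<open>as\<close> is used on L / M to keep the sequence exact; for the last element
  \<open>b\<close> it is enough that M / K sits inside a module on which \<open>b\<close> is a
  nonzerodivisor.\<close>

lemma wreg_kernel:
  assumes "wreg (as @ [b]) L K" "wreg as L M" "K \<subseteq> M" "M \<subseteq> L"
    "stable_subgroup (as @ [b]) M" "stable_subgroup (as @ [b]) K" "stable_subgroup (as @ [b]) L"
  shows "wreg (as @ [b]) M K"
  using assms
proof (induction as arbitrary: M K)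
  case (Cons a as)
  note sub = stable_subgroup_subset[of "a # as @ [b]", OF _ set_subset_Cons]
  have "wreg (as @ [b]) (plus_mult a M L) (plus_mult a K L)"
    using Cons.prems
    by (intro Cons.IH[of "plus_mult a K L" "plus_mult a M L"] stable_plus_mult sub plus_mult_subset)
       (auto simp: plus_mult_def)
  then have "wreg (as @ [b]) M (plus_mult a K M)"
    using wreg_plus_mult[of a "as @ [b]" M K L] Cons.prems by auto
  then show ?case using Cons.prems by auto
qed auto

text \<open>Unfolding the recursion collects the enlargements of \<open>K\<close> into explicit
  combinations of the earlier elements, the form that \<open>regular_sequence\<close> speaks
  about.\<close>

lemma wreg_nth:
  assumes "wreg as L K" "stable_subgroup as L" "stable_subgroup as K"
    "i < length as" "x \<in> L" "\<forall>j<i. p j \<in> L"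
    "as ! i * x - (\<Sum>j<i. as ! j * p j) \<in> K"
  shows "\<exists>q. (\<forall>j<i. q j \<in> L) \<and> x - (\<Sum>j<i. as ! j * q j) \<in> K"
  using assms
proof (induction as arbitrary: K i p)
  case (Cons a as)
  note sub = stable_subgroup_subset[of "a # as", OF _ set_subset_Cons]
  show ?case
  proof (cases i)
    case 0
    then show ?thesis using Cons.prems by auto
  next
    case (Suc i')
    have "\<exists>q. (\<forall>j<i'. q j \<in> L) \<and> x - (\<Sum>j<i'. as ! j * q j) \<in> plus_mult a K L"
    proof (rule Cons.IH)
      \<comment> \<open>The summand with index 0 is \<open>a\<close> times an element of
        \<open>L\<close>, so it is absorbed by the enlarged \<open>K\<close>.\<close>
      show "as ! i' * x - (\<Sum>j<i'. as ! j * p (Suc j)) \<in> plus_mult a K L"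
      proof -
        have "as ! i' * x - (\<Sum>j<i'. as ! j * p (Suc j))
          = ((a # as) ! i * x - (\<Sum>j<i. (a # as) ! j * p j)) + a * p 0"
          unfolding Suc sum.lessThan_Suc_shift by simp
        then show ?thesis using Cons.prems(6,7) Suc unfolding plus_mult_def by blast
      qed
    qed (use Cons.prems Suc sub in \<open>auto intro!: stable_plus_mult\<close>)
    then obtain q k l where q: "\<forall>j<i'. q j \<in> L" "x - (\<Sum>j<i'. as ! j * q j) = k + a * l" "k \<in> K" "l \<in> L"
      by (auto simp: plus_mult_def)
    \<comment> \<open>The multiple \<open>a * l\<close> that came with the enlarged \<open>K\<close>
      supplies the coefficient of index 0; all others shift by one.\<close>
    define q' where "q' = (\<lambda>j. case j of 0 \<Rightarrow> l | Suc j \<Rightarrow> q j)"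
    have "x - (\<Sum>j<i. (a # as) ! j * q' j) = k"
      unfolding Suc sum.lessThan_Suc_shift using q(2) by (simp add: q'_def algebra_simps)
    moreover have "\<forall>j<i. q' j \<in> L" using q Suc by (auto simp: q'_def split: nat.split)
    ultimately show ?thesis using q(3) by auto
  qed
qed auto

section \<open>Monomials\<close>

lemma keys_plus_nat: "Poly_Mapping.keys (s + t) = Poly_Mapping.keys s \<union> Poly_Mapping.keys (t :: nat \<Rightarrow>\<^sub>0 nat)"
  by (auto simp: in_keys_iff lookup_add)

lemma sum_monomials: "(\<Sum>t\<in>Poly_Mapping.keys p. Poly_Mapping.single t (Poly_Mapping.lookup p t)) = p"
  by (rule poly_mapping_eqI)
     (auto simp: lookup_sum lookup_single when_def in_keys_iff sum.delta[OF finite_keys])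

lemma monomial_induct [case_names zero single add]:
  assumes "P 0" "\<And>t c. P (Poly_Mapping.single t c)" "\<And>p q. P p \<Longrightarrow> P q \<Longrightarrow> P (p + q)"
  shows "P (p :: 'a \<Rightarrow>\<^sub>0 'b::comm_monoid_add)"
proof -
  have "P (\<Sum>t\<in>A. Poly_Mapping.single t (Poly_Mapping.lookup p t))" if "finite A" for A
    using that by induction (auto intro: assms)
  from this[OF finite_keys, of p] show ?thesis by (simp add: sum_monomials)
qed

definition monomial_span :: "('a \<Rightarrow> bool) \<Rightarrow> ('a \<Rightarrow>\<^sub>0 'b::zero) set" where
  "monomial_span P = {p. \<forall>t\<in>Poly_Mapping.keys p. P t}"

lemma monomial_span_mono: "p \<in> monomial_span P \<Longrightarrow> (\<And>t. P t \<Longrightarrow> Q t) \<Longrightarrow> p \<in> monomial_span Q"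
  by (auto simp: monomial_span_def)

lemma monomial_span_zero [simp]: "0 \<in> monomial_span P"
  by (simp add: monomial_span_def)

lemma monomial_span_diff:
  "p \<in> monomial_span P \<Longrightarrow> q \<in> monomial_span P \<Longrightarrow> p - q \<in> monomial_span P" for p :: "'a \<Rightarrow>\<^sub>0 'b::ab_group_add"
  by (auto simp: monomial_span_def in_keys_iff lookup_minus)

lemma monomial_span_add:
  "p \<in> monomial_span P \<Longrightarrow> q \<in> monomial_span P \<Longrightarrow> p + q \<in> monomial_span P" for p :: "'a \<Rightarrow>\<^sub>0 'b::monoid_add"
  by (auto simp: monomial_span_def in_keys_iff lookup_add)

lemma monomial_span_sum:
  "(\<And>i. i \<in> A \<Longrightarrow> f i \<in> monomial_span P) \<Longrightarrow> sum f A \<in> monomial_span P" for f :: "'i \<Rightarrow> 'a \<Rightarrow>\<^sub>0 'b::comm_monoid_add"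
  by (induction A rule: infinite_finite_induct) (auto intro: monomial_span_add)

lemma monomial_span_single [simp]: "P t \<Longrightarrow> Poly_Mapping.single t c \<in> monomial_span P"
  by (simp add: monomial_span_def)

definition proj :: "('a \<Rightarrow> bool) \<Rightarrow> ('a \<Rightarrow>\<^sub>0 'b::zero) \<Rightarrow> ('a \<Rightarrow>\<^sub>0 'b)" where
  "proj P p = Poly_Mapping.mapp (\<lambda>t c. if P t then c else 0) p"

lemma lookup_proj: "Poly_Mapping.lookup (proj P p) t = (if P t then Poly_Mapping.lookup p t else 0)"
  by (auto simp: proj_def lookup_mapp when_def in_keys_iff)

lemma proj_in_span: "p \<in> monomial_span Q \<Longrightarrow> proj P p \<in> monomial_span (\<lambda>t. P t \<and> Q t)"
  by (auto simp: monomial_span_def in_keys_iff lookup_proj split: if_splits)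

lemma diff_proj_in_span: "p \<in> monomial_span Q \<Longrightarrow> p - proj P p \<in> monomial_span (\<lambda>t. \<not> P t \<and> Q t)"
  for p :: "'a \<Rightarrow>\<^sub>0 'b::ab_group_add"
  by (auto simp: monomial_span_def in_keys_iff lookup_proj lookup_minus split: if_splits)

text \<open>The Stanley-Reisner ideal in the polynomial ring on \<open>V\<close>, described by its
  monomial basis. An empty \<F> gives the whole ring, so that a shelling can start from the zero
  quotient.\<close>

definition nonfaces :: "nat set \<Rightarrow> nat set set \<Rightarrow> 'k::field mpoly set" where
  "nonfaces V \<F> = monomial_span (\<lambda>t. Poly_Mapping.keys t \<subseteq> V \<and> (\<forall>F\<in>\<F>. \<not> Poly_Mapping.keys t \<subseteq> F))"

lemma polys_in_conv_span: "polys_in V = monomial_span (\<lambda>t. Poly_Mapping.keys t \<subseteq> V)"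
  by (simp add: polys_in_def monomial_span_def)

lemma nonfaces_empty: "nonfaces V {} = polys_in V"
  by (simp add: nonfaces_def polys_in_conv_span)

lemma nonfaces_antimono: "\<F> \<subseteq> \<G> \<Longrightarrow> nonfaces V \<G> \<subseteq> nonfaces V \<F>"
  by (auto simp: nonfaces_def monomial_span_def)

lemma nonfaces_subset: "nonfaces V \<F> \<subseteq> polys_in V"
  by (auto simp: nonfaces_def polys_in_conv_span monomial_span_def)

lemma polys_in_mono: "U \<subseteq> V \<Longrightarrow> polys_in U \<subseteq> polys_in V"
  by (auto simp: polys_in_def)

lemma nonfaces_mult:
  assumes "p \<in> polys_in V" "q \<in> nonfaces V \<F>"
  shows "p * q \<in> nonfaces V \<F>"
  unfolding nonfaces_def monomial_span_def
proof (intro CollectI ballI)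
  fix t assume "t \<in> Poly_Mapping.keys (p * q)"
  then obtain a b where "t = a + b" "a \<in> Poly_Mapping.keys p" "b \<in> Poly_Mapping.keys q"
    using keys_mult[of p q] by blast
  then show "Poly_Mapping.keys t \<subseteq> V \<and> (\<forall>F\<in>\<F>. \<not> Poly_Mapping.keys t \<subseteq> F)"
    using assms by (auto simp: polys_in_def nonfaces_def monomial_span_def keys_plus_nat)
qed

lemma polys_in_mult: "p \<in> polys_in V \<Longrightarrow> q \<in> polys_in V \<Longrightarrow> p * q \<in> polys_in V"
  using nonfaces_mult[of p V q "{}"] by (simp add: nonfaces_empty)

lemma polys_in_single [simp]: "Poly_Mapping.keys t \<subseteq> V \<Longrightarrow> Poly_Mapping.single t c \<in> polys_in V"
  by (simp add: polys_in_conv_span)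

lemma polys_in_one [simp]: "1 \<in> polys_in V"
  by (simp add: polys_in_def)

lemma polys_in_power: "p \<in> polys_in V \<Longrightarrow> p ^ n \<in> polys_in V"
  by (induction n) (auto intro: polys_in_mult)

lemma polys_in_add: "p \<in> polys_in V \<Longrightarrow> q \<in> polys_in V \<Longrightarrow> p + q \<in> polys_in V"
  unfolding polys_in_conv_span by (rule monomial_span_add)

lemma polys_in_diff: "p \<in> polys_in V \<Longrightarrow> q \<in> polys_in V \<Longrightarrow> p - q \<in> polys_in V"
  unfolding polys_in_conv_span by (rule monomial_span_diff)

lemma polys_in_sum: "(\<And>i. i \<in> A \<Longrightarrow> f i \<in> polys_in V) \<Longrightarrow> sum f A \<in> polys_in V"
  unfolding polys_in_conv_span by (rule monomial_span_sum)

lemma nonfaces_diff: "p \<in> nonfaces V \<F> \<Longrightarrow> q \<in> nonfaces V \<F> \<Longrightarrow> p - q \<in> nonfaces V \<F>"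
  unfolding nonfaces_def by (rule monomial_span_diff)

lemma stable_nonfaces: "set as \<subseteq> polys_in V \<Longrightarrow> stable_subgroup as (nonfaces V \<F>)"
  unfolding stable_subgroup_def by (auto intro: nonfaces_mult nonfaces_diff) (simp add: nonfaces_def)

lemma stable_polys_in: "set as \<subseteq> polys_in V \<Longrightarrow> stable_subgroup as (polys_in V)"
  using stable_nonfaces[of as V "{}"] by (simp add: nonfaces_empty)


section \<open>Linear forms\<close>

definition linear_form :: "nat set \<Rightarrow> (nat \<Rightarrow> 'k::field) \<Rightarrow> 'k mpoly" where
  "linear_form V c = (\<Sum>u\<in>V. Poly_Mapping.single (Poly_Mapping.single u 1) (c u))"

lemma linear_form_in_polys [simp]: "U \<subseteq> V \<Longrightarrow> linear_form U c \<in> polys_in V"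
  unfolding linear_form_def by (intro polys_in_sum) auto

lemma lookup_linear_form:
  "finite V \<Longrightarrow> u \<in> V \<Longrightarrow> Poly_Mapping.lookup (linear_form V c) (Poly_Mapping.single u 1) = c u"
proof -
  have inj: "Poly_Mapping.single w 1 = (Poly_Mapping.single u 1 :: nat \<Rightarrow>\<^sub>0 nat) \<longleftrightarrow> w = u" for w
    by (metis lookup_single_eq lookup_single_not_eq zero_neq_one)
  show "finite V \<Longrightarrow> u \<in> V \<Longrightarrow> ?thesis"
    by (simp add: linear_form_def lookup_sum lookup_single when_def inj sum.delta del: One_nat_def)
qed

lemma linear_form_split:
  "finite V \<Longrightarrow> U \<subseteq> V \<Longrightarrow> linear_form V c = linear_form U c + linear_form (V - U) c"
  unfolding linear_form_def by (subst sum.subset_diff[of U V]) (auto simp: add.commute)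

text \<open>Modulo \<open>nonfaces V {W}\<close> only monomials supported in \<open>W\<close>
  survive. They form a polynomial ring, hence a domain, and the restriction of the form to
  \<open>W\<close> is nonzero because of \<open>v\<close>.\<close>

lemma linear_form_nonzerodivisor:
  assumes V: "finite V" "W \<subseteq> V" and v: "v \<in> W" "c v \<noteq> 0"
    and p: "p \<in> polys_in V" "linear_form V c * p \<in> nonfaces V {W}"
  shows "p \<in> nonfaces V {W}"
proof -
  define q where "q = proj (\<lambda>t. Poly_Mapping.keys t \<subseteq> W) p"
  have q: "q \<in> polys_in W" and pq: "p - q \<in> nonfaces V {W}"
    using p(1) unfolding polys_in_conv_span nonfaces_def q_def
    by (auto intro: monomial_span_mono[OF proj_in_span] monomial_span_mono[OF diff_proj_in_span])
  have rest: "linear_form (V - W) c \<in> nonfaces V {W}"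
    unfolding linear_form_def nonfaces_def by (intro monomial_span_sum) auto
  have "linear_form W c * q = linear_form V c * p - linear_form V c * (p - q) - q * linear_form (V - W) c"
    using linear_form_split[OF V, of c] by (simp add: algebra_simps)
  also have "\<dots> \<in> nonfaces V {W}"
    using q polys_in_mono[OF V(2)]
    by (intro nonfaces_diff p(2) nonfaces_mult pq rest) auto
  finally have "linear_form W c * q \<in> nonfaces V {W}" .
  moreover have "linear_form W c * q \<in> polys_in W"
    using q by (auto intro!: polys_in_mult)
  \<comment> \<open>All its monomials are supported in \<open>W\<close>, and none of them
    is.\<close>
  ultimately have "Poly_Mapping.keys (linear_form W c * q) = {}"
    by (auto simp: nonfaces_def monomial_span_def polys_in_def)
  then have "linear_form W c * q = 0" by simp
  moreover have "linear_form W c \<noteq> 0"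
    using lookup_linear_form[of W v c] V v finite_subset by fastforce
  ultimately show ?thesis using pq by auto
qed

section \<open>Substituting a polynomial for one variable\<close>

definition monomial_extend :: "((nat \<Rightarrow>\<^sub>0 nat) \<Rightarrow> 'k mpoly) \<Rightarrow> 'k::field mpoly \<Rightarrow> 'k mpoly" where
  "monomial_extend h p = (\<Sum>t\<in>Poly_Mapping.keys p. Poly_Mapping.single 0 (Poly_Mapping.lookup p t) * h t)"

lemma monomial_extend_superset:
  "finite A \<Longrightarrow> Poly_Mapping.keys p \<subseteq> A \<Longrightarrow>
    monomial_extend h p = (\<Sum>t\<in>A. Poly_Mapping.single 0 (Poly_Mapping.lookup p t) * h t)"
  unfolding monomial_extend_def by (rule sum.mono_neutral_left) (auto simp: in_keys_iff)

lemma monomial_extend_single: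
  "monomial_extend h (Poly_Mapping.single t c) = Poly_Mapping.single 0 c * h t"
  by (subst monomial_extend_superset[of "{t}"]) auto

lemma monomial_extend_zero [simp]: "monomial_extend h 0 = 0"
  by (simp add: monomial_extend_def)

lemma monomial_extend_add: "monomial_extend h (p + q) = monomial_extend h p + monomial_extend h q"
proof -
  let ?A = "Poly_Mapping.keys p \<union> Poly_Mapping.keys q"
  show ?thesis
    using keys_add[of p q]
    by (simp add: monomial_extend_superset[of ?A] lookup_add single_add algebra_simps sum.distrib)
qed

lemma monomial_extend_mult:
  assumes "\<And>s t. h (s + t) = h s * h t"
  shows "monomial_extend h (p * q) = monomial_extend h p * monomial_extend h q"
proof (induction p rule: monomial_induct)
  case (single t c)
  show ?case
  proof (induction q rule: monomial_induct)
    case (single s d)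
    show ?case
      using mult_single[of 0 c 0 d, symmetric]
      by (simp add: mult_single monomial_extend_single assms algebra_simps)
  qed (auto simp: monomial_extend_add algebra_simps)
qed (auto simp: monomial_extend_add algebra_simps)

text \<open>Evaluation of the variable \<open>v\<close> at \<open>l\<close>: updating the exponent
  to 0 deletes the variable from the monomial, and the power of \<open>l\<close> takes its
  place.\<close>

definition subst_var :: "nat \<Rightarrow> 'k::field mpoly \<Rightarrow> 'k mpoly \<Rightarrow> 'k mpoly" where
  "subst_var v l = monomial_extend
     (\<lambda>t. Poly_Mapping.single (Poly_Mapping.update v 0 t) 1 * l ^ Poly_Mapping.lookup t v)"

lemma keys_update_zero: "Poly_Mapping.keys (Poly_Mapping.update v 0 t) = Poly_Mapping.keys t - {v}"
  by (auto simp: in_keys_iff lookup_update split: if_splits)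

lemma subst_var_add: "subst_var v l (p + q) = subst_var v l p + subst_var v l q"
  by (simp add: subst_var_def monomial_extend_add)

lemma subst_var_mult: "subst_var v l (p * q) = subst_var v l p * subst_var v l q"
proof -
  have *: "Poly_Mapping.update v 0 (s + t) = Poly_Mapping.update v 0 s + Poly_Mapping.update v 0 t"
    for s t :: "nat \<Rightarrow>\<^sub>0 nat"
    by (rule poly_mapping_eqI) (auto simp: lookup_update lookup_add)
  show ?thesis
    unfolding subst_var_def
    by (rule monomial_extend_mult)
       (simp add: * lookup_add power_add mult_single[of _ "1::'a", simplified, symmetric] algebra_simps)
qed

lemma subst_var_in_polys:
  assumes l: "l \<in> polys_in (V - {v})" and p: "p \<in> polys_in V"
  shows "subst_var v l p \<in> polys_in (V - {v})"
  unfolding subst_var_def monomial_extend_def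
  using p by (intro polys_in_sum polys_in_mult polys_in_power l polys_in_single)
     (auto simp: polys_in_def keys_update_zero)

lemma update_zero_id: "v \<notin> Poly_Mapping.keys t \<Longrightarrow> Poly_Mapping.update v 0 t = t"
  by (rule poly_mapping_eqI) (auto simp: lookup_update in_keys_iff)

lemma update_zero_single: "Poly_Mapping.update v 0 (Poly_Mapping.single v c) = 0"
  by (rule poly_mapping_eqI) (auto simp: lookup_update lookup_single when_def)

lemma subst_var_id:
  assumes "p \<in> polys_in (V - {v})"
  shows "subst_var v l p = p"
proof -
  have "subst_var v l p = (\<Sum>t\<in>Poly_Mapping.keys p. Poly_Mapping.single t (Poly_Mapping.lookup p t))"
    unfolding subst_var_def monomial_extend_def
  proof (rule sum.cong[OF refl])
    fix t assume "t \<in> Poly_Mapping.keys p"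
    then have "v \<notin> Poly_Mapping.keys t" using assms by (auto simp: polys_in_def)
    then show "Poly_Mapping.single 0 (Poly_Mapping.lookup p t) *
         (Poly_Mapping.single (Poly_Mapping.update v 0 t) 1 * l ^ Poly_Mapping.lookup t v) =
         Poly_Mapping.single t (Poly_Mapping.lookup p t)"
      by (simp add: update_zero_id in_keys_iff mult_single)
  qed
  then show ?thesis by (simp add: sum_monomials)
qed

text \<open>A monomial not supported in \<open>W\<close> involves a variable outside
  \<open>W\<close>. This variable is different from \<open>v\<close>, so it survives the
  substitution and divides the image.\<close>

lemma subst_var_nonfaces:
  assumes v: "v \<in> W" and l: "l \<in> polys_in V" and p: "p \<in> nonfaces V {W}"
  shows "subst_var v l p \<in> nonfaces V {W - {v}}"
proof -
  have "Poly_Mapping.single 0 (Poly_Mapping.lookup p t) *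
       (Poly_Mapping.single (Poly_Mapping.update v 0 t) 1 * l ^ Poly_Mapping.lookup t v)
     \<in> nonfaces V {W - {v}}" if "t \<in> Poly_Mapping.keys p" for t
  proof -
    have "Poly_Mapping.single (Poly_Mapping.update v 0 t) 1 \<in> nonfaces V {W - {v}}"
      using that p v by (auto simp: nonfaces_def monomial_span_def keys_update_zero)
    then have "l ^ Poly_Mapping.lookup t v * Poly_Mapping.single (Poly_Mapping.update v 0 t) 1 \<in> nonfaces V {W - {v}}"
      using polys_in_power[OF l] by (intro nonfaces_mult)
    then have "Poly_Mapping.single 0 (Poly_Mapping.lookup p t) *
        (l ^ Poly_Mapping.lookup t v * Poly_Mapping.single (Poly_Mapping.update v 0 t) 1) \<in> nonfaces V {W - {v}}"
      by (rule nonfaces_mult[rotated]) simp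
    then show ?thesis by (simp add: mult.commute)
  qed
  then show ?thesis
    unfolding subst_var_def monomial_extend_def nonfaces_def by (intro monomial_span_sum) auto
qed

text \<open>The remainder theorem, monomial by monomial: a difference of equal powers of
  \<open>mvar v\<close> and \<open>l\<close> is divisible by \<open>mvar v - l\<close>.\<close>

lemma subst_var_congruent:
  assumes v: "v \<in> V" and l: "l \<in> polys_in V" and p: "p \<in> polys_in V"
  shows "\<exists>q\<in>polys_in V. p - subst_var v l p = (mvar v - l) * q"
  using p
proof -
  have x: "mvar v \<in> polys_in V" using v by (simp add: mvar_def)
  have vpow: "mvar v ^ n = Poly_Mapping.single (Poly_Mapping.single v n) 1" for n
    by (induction n) (auto simp: mvar_def mult_single single_add[symmetric] simp flip: single_one)
  have step: "\<exists>q\<in>polys_in V. Poly_Mapping.single t c - Poly_Mapping.single 0 c *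
     (Poly_Mapping.single (Poly_Mapping.update v 0 t) 1 * l ^ Poly_Mapping.lookup t v) = (mvar v - l) * q"
    if "Poly_Mapping.keys t \<subseteq> V" for t and c :: 'a
  proof -
    let ?n = "Poly_Mapping.lookup t v"
    let ?m = "Poly_Mapping.single (Poly_Mapping.update v 0 t) c"
    have t: "t = Poly_Mapping.update v 0 t + Poly_Mapping.single v ?n"
      by (rule poly_mapping_eqI) (auto simp: lookup_update lookup_add lookup_single when_def)
    have "Poly_Mapping.single t c = ?m * mvar v ^ ?n"
      by (subst t) (simp add: vpow mult_single)
    moreover have "Poly_Mapping.single 0 c * (Poly_Mapping.single (Poly_Mapping.update v 0 t) 1 * l ^ ?n) = ?m * l ^ ?n"
      by (subst mult.assoc[symmetric], subst mult_single) simp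
    ultimately have "Poly_Mapping.single t c - Poly_Mapping.single 0 c *
     (Poly_Mapping.single (Poly_Mapping.update v 0 t) 1 * l ^ Poly_Mapping.lookup t v) =
      ?m * (mvar v ^ ?n - l ^ ?n)" by (simp only: right_diff_distrib)
    also have "\<dots> = (mvar v - l) * (?m * (\<Sum>i<?n. l ^ (?n - Suc i) * mvar v ^ i))"
      by (simp add: power_diff_sumr2 algebra_simps)
    finally show ?thesis
      using that x l by (intro bexI[of _ "?m * (\<Sum>i<?n. l ^ (?n - Suc i) * mvar v ^ i)"])
         (auto intro!: polys_in_mult polys_in_sum polys_in_power polys_in_single simp: keys_update_zero)
  qed
  have "\<exists>q. \<forall>t\<in>Poly_Mapping.keys p. q t \<in> polys_in V \<and>
      Poly_Mapping.single t (Poly_Mapping.lookup p t) - Poly_Mapping.single 0 (Poly_Mapping.lookup p t) *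
     (Poly_Mapping.single (Poly_Mapping.update v 0 t) 1 * l ^ Poly_Mapping.lookup t v) = (mvar v - l) * q t"
    using step p by (intro bchoice ballI) (auto simp: polys_in_def Bex_def)
  then obtain q where q: "\<forall>t\<in>Poly_Mapping.keys p. q t \<in> polys_in V \<and>
      Poly_Mapping.single t (Poly_Mapping.lookup p t) - Poly_Mapping.single 0 (Poly_Mapping.lookup p t) *
     (Poly_Mapping.single (Poly_Mapping.update v 0 t) 1 * l ^ Poly_Mapping.lookup t v) = (mvar v - l) * q t" ..
  have "p - subst_var v l p = (\<Sum>t\<in>Poly_Mapping.keys p. Poly_Mapping.single t (Poly_Mapping.lookup p t)) - subst_var v l p"
    by (simp add: sum_monomials)
  also have "\<dots> = (mvar v - l) * (\<Sum>t\<in>Poly_Mapping.keys p. q t)"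
    unfolding subst_var_def monomial_extend_def using q
    by (simp add: sum_subtractf[symmetric] sum_distrib_left)
  finally show ?thesis using q by (intro bexI[of _ "\<Sum>t\<in>Poly_Mapping.keys p. q t"]) (auto intro: polys_in_sum)
qed

section \<open>Regularity of independent linear forms on a simplex\<close>

definition lin_indep_on :: "nat set \<Rightarrow> (nat \<Rightarrow> 'k::field) list \<Rightarrow> bool" where
  "lin_indep_on W cs \<longleftrightarrow> (\<forall>d. (\<forall>u\<in>W. (\<Sum>i<length cs. d i * (cs ! i) u) = 0) \<longrightarrow> (\<forall>i<length cs. d i = 0))"

text \<open>One step of Gaussian elimination with pivot \<open>c v\<close>: a relation among the
  reduced forms on \<open>W - {v}\<close> extends to a relation among the original forms on all of
  \<open>W\<close>.\<close>

lemma lin_indep_elim: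
  assumes ind: "lin_indep_on W (c # cs)" and v: "c v \<noteq> 0"
  shows "lin_indep_on (W - {v}) (map (\<lambda>e u. e u - e v * c u / c v) cs)"
  unfolding lin_indep_on_def
proof (intro allI impI)
  fix d i assume d: "\<forall>u\<in>W - {v}. (\<Sum>i<length (map (\<lambda>e u. e u - e v * c u / c v) cs).
    d i * (map (\<lambda>e u. e u - e v * c u / c v) cs ! i) u) = 0"
    and i: "i < length (map (\<lambda>e u. e u - e v * c u / c v) cs)"
  \<comment> \<open>The coefficient of \<open>c\<close> is the one that makes the combination vanish
    at \<open>v\<close>.\<close>
  define d' where "d' = (\<lambda>i. case i of 0 \<Rightarrow> - (\<Sum>i<length cs. d i * (cs ! i) v) / c v | Suc i \<Rightarrow> d i)"
  have eq: "(\<Sum>i<length (c # cs). d' i * ((c # cs) ! i) u)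
      = (\<Sum>i<length cs. d i * ((cs ! i) u - (cs ! i) v * c u / c v))" for u
    unfolding length_Cons sum.lessThan_Suc_shift
    by (simp add: d'_def right_diff_distrib sum_subtractf sum_distrib_right sum_divide_distrib mult.assoc)
  have "(\<Sum>i<length (c # cs). d' i * ((c # cs) ! i) u) = 0" if "u \<in> W" for u
    using d that v unfolding eq by (cases "u = v") auto
  then have "\<forall>i<length (c # cs). d' i = 0"
    using ind unfolding lin_indep_on_def by blast
  then show "d i = 0" using i by (auto simp: d'_def dest!: spec[of _ "Suc i"])
qed

text \<open>Solving \<open>linear_form V c\<close> = 0 for the variable \<open>v\<close> and
  substituting is the same Gaussian elimination, now on forms. The reduced coefficient at
  \<open>v\<close> is 0, so the result may be written over all of \<open>V\<close>.\<close>

lemma linear_form_subst: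
  assumes "finite V" "v \<in> V" "c v \<noteq> 0"
  shows "subst_var v (linear_form (V - {v}) (\<lambda>u. - c u / c v)) (linear_form V e)
    = linear_form V (\<lambda>u. e u - e v * c u / c v)"
proof -
  let ?l = "linear_form (V - {v}) (\<lambda>u. - c u / c v)"
  have 1: "subst_var v ?l (linear_form {v} e) = linear_form (V - {v}) (\<lambda>u. - e v * c u / c v)"
    by (simp add: linear_form_def subst_var_def monomial_extend_single sum_distrib_left mult_single)
       (simp add: update_zero_single)
  have "subst_var v ?l (linear_form V e) = subst_var v ?l (linear_form (V - {v}) e) + subst_var v ?l (linear_form {v} e)"
    using assms linear_form_split[of V "{v}" e] by (simp add: subst_var_add)
  also have "\<dots> = linear_form (V - {v}) e + linear_form (V - {v}) (\<lambda>u. - e v * c u / c v)"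
    using 1 subst_var_id[of "linear_form (V - {v}) e" V v] by simp
  also have "\<dots> = linear_form (V - {v}) (\<lambda>u. e u - e v * c u / c v)"
    by (simp add: linear_form_def sum.distrib[symmetric] single_add[symmetric])
  also have "\<dots> = linear_form V (\<lambda>u. e u - e v * c u / c v)"
    using assms linear_form_split[of V "{v}" "\<lambda>u. e u - e v * c u / c v"] by (simp add: linear_form_def)
  finally show ?thesis .
qed

text \<open>Dividing the polynomial ring on \<open>W\<close> by the first form eliminates a variable
  \<open>v\<close> of \<open>W\<close> and leaves the polynomial ring on \<open>W - {v}\<close> with
  the reduced forms. The ambient \<open>V\<close> stays fixed, so the eliminated variable is simply
  killed by the enlarged ideal.\<close>

lemma wreg_linear_forms:
  assumes "finite V" "W \<subseteq> V" "lin_indep_on W cs"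
  shows "wreg (map (linear_form V) cs) (polys_in V) (nonfaces V {W})"
  using assms(2,3)
proof (induction cs arbitrary: W rule: length_induct)
  case (1 cs)
  show ?case
  proof (cases cs)
    case (Cons c cs')
    have "\<exists>v\<in>W. c v \<noteq> 0"
    proof (rule ccontr)
      assume "\<not> (\<exists>v\<in>W. c v \<noteq> 0)"
      \<comment> \<open>If the first form vanished on \<open>W\<close>, then taking it once and all
        others zero times would be a nontrivial relation.\<close>
      then have "\<forall>u\<in>W. (\<Sum>i<length cs. (if i = 0 then 1 else 0) * (cs ! i) u) = 0"
        unfolding Cons length_Cons sum.lessThan_Suc_shift by simp
      then have "\<forall>i<length cs. (if i = 0 then 1 else 0 :: 'a) = 0"
        using "1.prems"(2) unfolding lin_indep_on_def by (drule_tac spec) (erule (1) mp)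
      then show False using Cons by auto
    qed
    then obtain v where v: "v \<in> W" "c v \<noteq> 0" by blast
    define l where "l = linear_form (V - {v}) (\<lambda>u. - c u / c v)"
    define cs'' where "cs'' = map (\<lambda>e u. e u - e v * c u / c v) cs'"
    have vV: "v \<in> V" using v "1.prems" by auto
    have l: "l \<in> polys_in (V - {v})" "l \<in> polys_in V" by (auto simp: l_def)
    have lf: "linear_form V c = Poly_Mapping.single 0 (c v) * (mvar v - l)"
      using linear_form_split[of V "{v}" c] assms(1) vV v(2)
      by (simp add: right_diff_distrib distrib_left l_def mvar_def mult_single linear_form_def sum_distrib_left
          single_uminus sum_negf)
    have sc: "subst_var v l (linear_form V c) = 0"
      using linear_form_subst[where c = c, OF assms(1) vV v(2), of c] v(2) by (simp add: l_def linear_form_def)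
    have "wreg (map (linear_form V) cs'') (polys_in V) (nonfaces V {W - {v}})"
    proof -
      have "length cs'' < length cs" "W - {v} \<subseteq> V" "lin_indep_on (W - {v}) cs''"
        using "1.prems" lin_indep_elim[of W c cs' v] v by (auto simp: Cons cs''_def)
      then show ?thesis using "1.IH" by blast
    qed
    moreover have "wreg (map (linear_form V) cs') (polys_in V) (plus_mult (linear_form V c) (nonfaces V {W}) (polys_in V))
      \<longleftrightarrow> wreg (map (linear_form V) cs'') (polys_in V) (nonfaces V {W - {v}})"
    proof (rule wreg_iso[where f = "subst_var v l"])
      show "subst_var v l (map (linear_form V) cs' ! i * x) = map (linear_form V) cs'' ! i * subst_var v l x"
        if "i < length (map (linear_form V) cs')" for i x
        using that linear_form_subst[where c = c, OF assms(1) vV v(2), of "cs' ! i"]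
        by (simp add: subst_var_mult cs''_def l_def)
      show "plus_mult (linear_form V c) (nonfaces V {W}) (polys_in V) \<subseteq> polys_in V"
        using plus_mult_subset[OF stable_polys_in[of "[linear_form V c]" V] nonfaces_subset] by simp
      show "subst_var v l x \<in> polys_in V" if "x \<in> polys_in V" for x
        using subst_var_in_polys[OF l(1) that] polys_in_mono[of "V - {v}" V] by auto
      show "\<exists>x\<in>polys_in V. y - subst_var v l x \<in> nonfaces V {W - {v}}" if "y \<in> polys_in V" for y
      proof -
        \<comment> \<open>Monomials involving \<open>v\<close> are zero in the target because
          \<open>v\<close> is not in \<open>W - {v}\<close>; the remaining part is fixed by the
          substitution.\<close>
        let ?x = "proj (\<lambda>t. v \<notin> Poly_Mapping.keys t) y"
        have "?x \<in> polys_in (V - {v})" "y - ?x \<in> nonfaces V {W - {v}}"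
          using that unfolding polys_in_conv_span nonfaces_def
          by (auto intro: monomial_span_mono[OF proj_in_span] monomial_span_mono[OF diff_proj_in_span])
        then show ?thesis using subst_var_id[of ?x V v l] polys_in_mono[of "V - {v}" V]
          by (intro bexI[of _ ?x]) auto
      qed
      show "subst_var v l x \<in> nonfaces V {W - {v}} \<longleftrightarrow> x \<in> plus_mult (linear_form V c) (nonfaces V {W}) (polys_in V)"
        if x: "x \<in> polys_in V" for x
      proof
        assume s: "subst_var v l x \<in> nonfaces V {W - {v}}"
        obtain q where q: "q \<in> polys_in V" "x - subst_var v l x = (mvar v - l) * q"
          using subst_var_congruent[OF vV l(2) x] by blast
        have "subst_var v l x \<in> nonfaces V {W}"
          using s subst_var_in_polys[OF l(1) x] unfolding nonfaces_def monomial_span_def polys_in_def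
          by blast
        \<comment> \<open>\<open>mvar v - l\<close> and the form differ only by the invertible
          constant \<open>c v\<close>.\<close>
        moreover have "(mvar v - l) * q = linear_form V c * (Poly_Mapping.single 0 (1 / c v) * q)"
        proof -
          have "linear_form V c * (Poly_Mapping.single 0 (1 / c v) * q)
            = (Poly_Mapping.single 0 (c v) * Poly_Mapping.single 0 (1 / c v)) * ((mvar v - l) * q)"
            by (simp only: lf mult_ac)
          also have "\<dots> = (mvar v - l) * q"
            using v(2) by (subst mult_single) simp
          finally show ?thesis ..
        qed
        then have "x = subst_var v l x + linear_form V c * (Poly_Mapping.single 0 (1 / c v) * q)"
          using q(2) by (simp add: algebra_simps)
        ultimately show "x \<in> plus_mult (linear_form V c) (nonfaces V {W}) (polys_in V)"
          using q(1) by (subst \<open>x = _\<close>) (intro plus_multI polys_in_mult polys_in_single; simp)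
      next
        assume "x \<in> plus_mult (linear_form V c) (nonfaces V {W}) (polys_in V)"
        then obtain k y where "x = k + linear_form V c * y" "k \<in> nonfaces V {W}"
          by (auto simp: plus_mult_def)
        then show "subst_var v l x \<in> nonfaces V {W - {v}}"
          using subst_var_nonfaces[OF v(1) l(2)] by (simp add: subst_var_add subst_var_mult sc)
      qed
      have lin: "set (map (linear_form V) ds) \<subseteq> polys_in V" for ds :: "(nat \<Rightarrow> 'a) list" by auto
      show "stable_subgroup (map (linear_form V) cs') (polys_in V)"
        "stable_subgroup (map (linear_form V) cs') (plus_mult (linear_form V c) (nonfaces V {W}) (polys_in V))"
        "stable_subgroup (map (linear_form V) cs'') (polys_in V)"
        "stable_subgroup (map (linear_form V) cs'') (nonfaces V {W - {v}})"
        by (intro stable_plus_mult stable_nonfaces stable_polys_in lin)+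
    qed (simp_all add: cs''_def subst_var_add nonfaces_subset)
    ultimately show ?thesis
      using linear_form_nonzerodivisor[where c = c, OF assms(1) "1.prems"(1) v] by (auto simp: Cons)
  qed simp
qed

section \<open>Shellings and gluing\<close>

text \<open>This is where it matters that \<open>wreg\<close> does not ask for a nonvanishing
  quotient: it gives the empty end of a shelling.\<close>

lemma wreg_zero_quotient: "0 \<in> L \<Longrightarrow> L \<subseteq> K \<Longrightarrow> wreg as L K"
proof (induction as arbitrary: K)
  case (Cons a as)
  have "L \<subseteq> plus_mult a K L" using plus_multI[of _ K 0 L a] Cons.prems by auto
  then show ?case using Cons by auto
qed simp

lemma nonfaces_Un: "nonfaces V (\<F> \<union> \<G>) = nonfaces V \<F> \<inter> nonfaces V \<G>"
  by (auto simp: nonfaces_def monomial_span_def)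

lemma nonfaces_refine:
  assumes "\<And>\<sigma>. \<exists>G\<in>\<G>. \<sigma> \<subseteq> G \<Longrightarrow> \<exists>F\<in>\<F>. \<sigma> \<subseteq> F"
  shows "nonfaces V \<F> \<subseteq> nonfaces V \<G>"
proof
  fix p :: "'a mpoly" assume "p \<in> nonfaces V \<F>"
  then show "p \<in> nonfaces V \<G>"
    unfolding nonfaces_def by (rule monomial_span_mono) (use assms in blast)
qed

text \<open>\<open>R\<close> is the restriction of \<open>F\<close>, its unique minimal new face: it
  lies in no earlier facet, while removing any vertex of \<open>R\<close> from \<open>F\<close>
  lands in one. The new faces are exactly the interval from \<open>R\<close> to \<open>F\<close>.
  Carrying \<open>R\<close> as data turns a shelling into a finite check.\<close>

fun shelling :: "'v set set \<Rightarrow> ('v set \<times> 'v set) list \<Rightarrow> bool" where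
  "shelling \<F> [] = True"
| "shelling \<F> ((R, F) # l) =
    (R \<subseteq> F \<and> (\<forall>G\<in>\<F>. \<not> R \<subseteq> G) \<and> (\<forall>v\<in>R. \<exists>G\<in>\<F>. F \<subseteq> insert v G) \<and> shelling (insert F \<F>) l)"

lemma inj_on_image_subset_iff:
  assumes "inj_on g U" "A \<subseteq> U" "B \<subseteq> U"
  shows "g ` A \<subseteq> g ` B \<longleftrightarrow> A \<subseteq> B"
proof
  assume im: "g ` A \<subseteq> g ` B"
  show "A \<subseteq> B"
  proof
    fix x assume x: "x \<in> A"
    then obtain y where "y \<in> B" "g x = g y" using im by blast
    then show "x \<in> B" using inj_onD[OF assms(1), of x y] x assms by blast
  qed
qed blast

lemma shelling_image:
  assumes "inj_on g U" "\<Union>\<F> \<subseteq> U" "\<Union>(snd ` set l) \<subseteq> U" "shelling \<F> l"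
  shows "shelling ((`) g ` \<F>) (map (map_prod ((`) g) ((`) g)) l)"
  using assms(2-)
proof (induction l arbitrary: \<F>)
  case (Cons p l)
  obtain R F where p: "p = (R, F)" by (cases p)
  have sub: "R \<subseteq> U" "F \<subseteq> U" using Cons.prems p by auto
  have "\<not> g ` R \<subseteq> g ` G" if "G \<in> \<F>" for G
    using that Cons.prems p sub inj_on_image_subset_iff[OF assms(1) sub(1), of G] by auto
  moreover have "\<exists>G\<in>(`) g ` \<F>. g ` F \<subseteq> insert w G" if "w \<in> g ` R" for w
  proof -
    from that obtain v where v: "v \<in> R" "w = g v" by blast
    with Cons.prems p obtain G where G: "G \<in> \<F>" "F \<subseteq> insert v G" by auto
    then have "g ` F \<subseteq> insert w (g ` G)" using v by auto
    then show ?thesis using G(1) by blast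
  qed
  moreover have "shelling ((`) g ` insert F \<F>) (map (map_prod ((`) g) ((`) g)) l)"
    using Cons.prems p by (intro Cons.IH) auto
  ultimately show ?case using Cons.prems p by (auto simp del: image_insert simp: image_insert[symmetric])
qed simp

definition indicator_monomial :: "nat set \<Rightarrow> nat \<Rightarrow>\<^sub>0 nat" where
  "indicator_monomial R = (\<Sum>v\<in>R. Poly_Mapping.single v 1)"

lemma lookup_indicator_monomial:
  "finite R \<Longrightarrow> Poly_Mapping.lookup (indicator_monomial R) v = (if v \<in> R then 1 else 0)"
  by (simp add: indicator_monomial_def lookup_sum lookup_single when_def sum.delta del: One_nat_def)

lemma keys_indicator_monomial: "finite R \<Longrightarrow> Poly_Mapping.keys (indicator_monomial R) = R"
  by (auto simp: in_keys_iff lookup_indicator_monomial split: if_splits)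

lemma indicator_monomial_decomp:
  assumes "finite R" "R \<subseteq> Poly_Mapping.keys t"
  obtains s where "t = indicator_monomial R + s"
proof
  show "t = indicator_monomial R + (t - indicator_monomial R)"
    using assms by (intro poly_mapping_eqI)
      (auto simp: lookup_add lookup_minus lookup_indicator_monomial in_keys_iff subset_iff)
qed

text \<open>
  For a shelling step that adds the interval from \<open>R\<close> to \<open>F\<close>, multiplication by the monomial
  of \<open>R\<close> identifies the new subquotient with the polynomial ring on \<open>F\<close>.
\<close>

lemma wreg_shelling_step:
  assumes fin: "finite V" and as: "set as \<subseteq> polys_in V" and FV: "F \<subseteq> V"
    and sh: "shelling \<F> [(R, F)]" and reg: "wreg as (polys_in V) (nonfaces V {F})"
  shows "wreg as (nonfaces V \<F>) (nonfaces V (insert F \<F>))"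
proof -
  define x where "x = Poly_Mapping.single (indicator_monomial R) (1 :: 'a)"
  have R: "R \<subseteq> F" "finite R" and RG: "\<And>G. G \<in> \<F> \<Longrightarrow> \<not> R \<subseteq> G"
    and Rv: "\<And>v. v \<in> R \<Longrightarrow> \<exists>G\<in>\<F>. F \<subseteq> insert v G"
    using sh FV fin finite_subset by (auto dest: finite_subset)
  have kR: "Poly_Mapping.keys (indicator_monomial R) = R" using R by (simp add: keys_indicator_monomial)
  \<comment> \<open>A face of \<open>F\<close> that misses some \<open>v\<close> of \<open>R\<close>
    lies in \<open>F - {v}\<close>, hence in an earlier facet.\<close>
  have interval: "R \<subseteq> \<sigma>" if "\<sigma> \<subseteq> F" "\<And>G. G \<in> \<F> \<Longrightarrow> \<not> \<sigma> \<subseteq> G" for \<sigma>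
  proof (rule ccontr)
    assume "\<not> R \<subseteq> \<sigma>"
    then obtain v where v: "v \<in> R" "v \<notin> \<sigma>" by auto
    then show False using Rv[OF v(1)] that by blast
  qed
  have lookup_x: "Poly_Mapping.lookup (x * p) (indicator_monomial R + t) = Poly_Mapping.lookup p t" for p t
  proof (induction p rule: monomial_induct)
    case (single s c)
    then show ?case by (simp add: x_def mult_single lookup_single when_def)
  qed (auto simp: lookup_add algebra_simps)
  have keys_x: "\<exists>s\<in>Poly_Mapping.keys p. t = indicator_monomial R + s" if "t \<in> Poly_Mapping.keys (x * p)" for p t
    using that keys_mult[of x p] by (auto simp: x_def)
  have "wreg as (polys_in V) (nonfaces V {F}) \<longleftrightarrow> wreg as (nonfaces V \<F>) (nonfaces V (insert F \<F>))"
  proof (rule wreg_iso[where f = "(*) x"])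
    show "x * p \<in> nonfaces V \<F>" if "p \<in> polys_in V" for p
    proof -
      have "x \<in> nonfaces V \<F>"
        using R FV RG by (auto simp: x_def nonfaces_def kR intro!: monomial_span_single)
      from nonfaces_mult[OF that this] show ?thesis by (simp add: mult.commute)
    qed
    show "\<exists>p\<in>polys_in V. q - x * p \<in> nonfaces V (insert F \<F>)" if q: "q \<in> nonfaces V \<F>" for q :: "'a mpoly"
    proof -
      have "\<exists>p\<in>polys_in V. \<forall>t. Poly_Mapping.keys t \<subseteq> F \<longrightarrow> Poly_Mapping.lookup (x * p) t = Poly_Mapping.lookup q t"
        using q
      proof -
        \<comment> \<open>The part of \<open>q\<close> supported in \<open>F\<close> is divided by
          the monomial of \<open>R\<close>; by \<open>interval\<close> this is possible. The rest of
          \<open>q\<close> vanishes modulo the enlarged complex.\<close>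
        define p where "p = (\<Sum>t\<in>{t\<in>Poly_Mapping.keys q. Poly_Mapping.keys t \<subseteq> F}.
          Poly_Mapping.single (t - indicator_monomial R) (Poly_Mapping.lookup q t))"
        have sub: "indicator_monomial R + (t - indicator_monomial R) = t"
          if "t \<in> Poly_Mapping.keys q" "Poly_Mapping.keys t \<subseteq> F" for t
        proof -
          have "R \<subseteq> Poly_Mapping.keys t"
            using that q interval by (auto simp: nonfaces_def monomial_span_def)
          then obtain s where "t = indicator_monomial R + s"
            using indicator_monomial_decomp[OF R(2)] by metis
          then show ?thesis by simp
        qed
        have "x * p = (\<Sum>t\<in>{t\<in>Poly_Mapping.keys q. Poly_Mapping.keys t \<subseteq> F}.
            Poly_Mapping.single t (Poly_Mapping.lookup q t))"
          unfolding p_def sum_distrib_left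
          by (rule sum.cong) (auto simp: x_def mult_single sub)
        then have "Poly_Mapping.lookup (x * p) t = Poly_Mapping.lookup q t" if "Poly_Mapping.keys t \<subseteq> F" for t
          using that by (auto simp: lookup_sum lookup_single when_def in_keys_iff)
        moreover have "p \<in> polys_in V"
          unfolding p_def
        proof (intro polys_in_sum polys_in_single)
          fix t assume "t \<in> {t \<in> Poly_Mapping.keys q. Poly_Mapping.keys t \<subseteq> F}"
          moreover have "Poly_Mapping.keys (t - indicator_monomial R) \<subseteq> Poly_Mapping.keys t"
            by (auto simp: in_keys_iff lookup_minus)
          ultimately show "Poly_Mapping.keys (t - indicator_monomial R) \<subseteq> V" using FV by auto
        qed
        ultimately show ?thesis by blast
      qed
      then obtain p where p: "p \<in> polys_in V"
        "\<And>t. Poly_Mapping.keys t \<subseteq> F \<Longrightarrow> Poly_Mapping.lookup (x * p) t = Poly_Mapping.lookup q t" by blast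
      have "x * p \<in> nonfaces V \<F>"
      proof -
        have "x \<in> nonfaces V \<F>"
          using R FV RG by (auto simp: x_def nonfaces_def kR intro!: monomial_span_single)
        from nonfaces_mult[OF p(1) this] show ?thesis by (simp add: mult.commute)
      qed
      then have "q - x * p \<in> nonfaces V \<F>" using q by (rule nonfaces_diff[rotated])
      moreover have "\<not> Poly_Mapping.keys t \<subseteq> F" if "t \<in> Poly_Mapping.keys (q - x * p)" for t
        using that p(2)[of t] by (auto simp: in_keys_iff lookup_minus)
      ultimately have "q - x * p \<in> nonfaces V (insert F \<F>)"
        by (auto simp: nonfaces_def monomial_span_def)
      then show ?thesis using p(1) by blast
    qed
    show "x * p \<in> nonfaces V (insert F \<F>) \<longleftrightarrow> p \<in> nonfaces V {F}" if p: "p \<in> polys_in V" for p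
    proof
      assume xp: "x * p \<in> nonfaces V (insert F \<F>)"
      show "p \<in> nonfaces V {F}"
        unfolding nonfaces_def monomial_span_def
      proof (clarsimp, intro conjI notI)
        fix t assume t: "t \<in> Poly_Mapping.keys p"
        then show "Poly_Mapping.keys t \<subseteq> V" using p by (auto simp: polys_in_def)
        assume "Poly_Mapping.keys t \<subseteq> F"
        moreover have "indicator_monomial R + t \<in> Poly_Mapping.keys (x * p)"
          using t lookup_x by (simp add: in_keys_iff)
        moreover from this have "\<not> Poly_Mapping.keys (indicator_monomial R + t) \<subseteq> F"
          using xp by (auto simp: nonfaces_def monomial_span_def)
        ultimately show False using R(1) by (simp add: keys_plus_nat kR)
      qed
    next
      assume pF: "p \<in> nonfaces V {F}"
      show "x * p \<in> nonfaces V (insert F \<F>)"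
        unfolding nonfaces_def monomial_span_def
      proof (intro CollectI ballI)
        fix t assume "t \<in> Poly_Mapping.keys (x * p)"
        then obtain s where s: "s \<in> Poly_Mapping.keys p" "t = indicator_monomial R + s" using keys_x by blast
        then have "Poly_Mapping.keys t = R \<union> Poly_Mapping.keys s" by (simp add: keys_plus_nat kR)
        then show "Poly_Mapping.keys t \<subseteq> V \<and> (\<forall>G\<in>insert F \<F>. \<not> Poly_Mapping.keys t \<subseteq> G)"
          using s pF R FV RG by (auto simp: nonfaces_def monomial_span_def)
      qed
    qed
    show "x * (p + q) = x * p + x * q" for p q by (simp add: algebra_simps)
    show "x * (as ! i * p) = as ! i * (x * p)" for i p by (simp add: algebra_simps)
  qed (use as in \<open>auto intro!: stable_nonfaces stable_polys_in nonfaces_subset nonfaces_antimono\<close>)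
  then show ?thesis using reg by simp
qed

text \<open>The ideals shrink by one facet at a time, and \<open>wreg_extension\<close> joins the
  subquotients. An empty \<F> gives regularity on the whole face ring; the induction needs an
  arbitrary start.\<close>

lemma wreg_shelling:
  assumes "finite V" "set as \<subseteq> polys_in V" "shelling \<F> l"
    and "\<And>F. F \<in> snd ` set l \<Longrightarrow> F \<subseteq> V \<and> wreg as (polys_in V) (nonfaces V {F})"
  shows "wreg as (nonfaces V \<F>) (nonfaces V (snd ` set l \<union> \<F>))"
  using assms(3,4)
proof (induction l arbitrary: \<F>)
  case Nil
  show ?case
    using stable_subgroupD(1)[OF stable_nonfaces[OF assms(2)]] by (simp add: wreg_zero_quotient)
next
  case (Cons p l)
  obtain R F where p: "p = (R, F)" by (cases p)
  note st = stable_nonfaces[OF assms(2)]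
  have "wreg as (nonfaces V \<F>) (nonfaces V (insert F \<F>))"
    using Cons.prems p assms(1,2) by (intro wreg_shelling_step[where R = R]) auto
  then have "wreg as (nonfaces V \<F>) (nonfaces V (snd ` set l \<union> insert F \<F>))"
  proof (rule wreg_extension[rotated])
    show "wreg as (nonfaces V (insert F \<F>)) (nonfaces V (snd ` set l \<union> insert F \<F>))"
      using Cons.prems p by (intro Cons.IH) auto
  qed (auto intro!: st nonfaces_antimono)
  then show ?case using p by simp
qed

text \<open>For the ideals of nonfaces, the ideal of \<A> is the sum of those of \<X> and \<Y>, and
  the ideal of the union is their intersection. The second isomorphism theorem identifies the two
  kernels, with the identity as the inducing map.\<close>

lemma wreg_glue:
  assumes as: "set as \<subseteq> polys_in V" "b \<in> polys_in V"
    and regX: "wreg (as @ [b]) (polys_in V) (nonfaces V \<X>)"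
    and regY: "wreg (as @ [b]) (polys_in V) (nonfaces V \<Y>)"
    and regA: "wreg as (polys_in V) (nonfaces V \<A>)"
    and int: "\<And>\<sigma>. (\<exists>F\<in>\<A>. \<sigma> \<subseteq> F) \<longleftrightarrow> (\<exists>F\<in>\<X>. \<sigma> \<subseteq> F) \<and> (\<exists>F\<in>\<Y>. \<sigma> \<subseteq> F)"
  shows "wreg (as @ [b]) (polys_in V) (nonfaces V (\<X> \<union> \<Y>))"
proof -
  have abV: "set (as @ [b]) \<subseteq> polys_in V" using as by auto
  note st = stable_nonfaces[OF abV] stable_polys_in[OF abV]
  have XA: "nonfaces V \<X> \<subseteq> nonfaces V \<A>" and YA: "nonfaces V \<Y> \<subseteq> nonfaces V \<A>"
    using int by (auto intro!: nonfaces_refine)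
  have "wreg (as @ [b]) (nonfaces V \<A>) (nonfaces V \<Y>)"
    using wreg_kernel[OF regY regA YA nonfaces_subset] st by blast
  moreover have "wreg (as @ [b]) (nonfaces V \<X>) (nonfaces V (\<X> \<union> \<Y>)) \<longleftrightarrow>
      wreg (as @ [b]) (nonfaces V \<A>) (nonfaces V \<Y>)"
  proof (rule wreg_iso[where f = "\<lambda>p. p"])
    show "\<exists>p\<in>nonfaces V \<X>. q - p \<in> nonfaces V \<Y>" if "q \<in> nonfaces V \<A>" for q :: "'a mpoly"
    proof
      \<comment> \<open>Monomials of \<open>q\<close> that are nonfaces of \<X> go into the
        representative. Every other one is a face of \<X> but not of \<A>, hence not a face of
        \<Y>.\<close>
      let ?P = "\<lambda>t. \<forall>F\<in>\<X>. \<not> Poly_Mapping.keys t \<subseteq> F"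
      show "proj ?P q \<in> nonfaces V \<X>"
        using that unfolding nonfaces_def by (rule monomial_span_mono[OF proj_in_span]) auto
      show "q - proj ?P q \<in> nonfaces V \<Y>"
        using that unfolding nonfaces_def
      proof (rule monomial_span_mono[OF diff_proj_in_span])
        fix t
        assume "\<not> ?P t \<and> Poly_Mapping.keys t \<subseteq> V \<and> (\<forall>F\<in>\<A>. \<not> Poly_Mapping.keys t \<subseteq> F)"
        then show "Poly_Mapping.keys t \<subseteq> V \<and> (\<forall>F\<in>\<Y>. \<not> Poly_Mapping.keys t \<subseteq> F)"
          using int[of "Poly_Mapping.keys t"] by auto
      qed
    qed
    show "nonfaces V (\<X> \<union> \<Y>) \<subseteq> nonfaces V \<X>" by (simp add: nonfaces_Un)
    show "p \<in> nonfaces V \<A>" if "p \<in> nonfaces V \<X>" for p :: "'a mpoly" using that XA by blast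
    show "p \<in> nonfaces V \<Y> \<longleftrightarrow> p \<in> nonfaces V (\<X> \<union> \<Y>)" if "p \<in> nonfaces V \<X>" for p :: "'a mpoly"
      using that by (simp add: nonfaces_Un)
  qed (simp_all add: st YA)
  ultimately have "wreg (as @ [b]) (nonfaces V \<X>) (nonfaces V (\<X> \<union> \<Y>))" by simp
  from wreg_extension[OF this regX] show ?thesis
    using st nonfaces_subset[of V \<X>] nonfaces_antimono[of \<X> "\<X> \<union> \<Y>" V] by simp
qed


section \<open>The complexes X and A\<close>

text \<open>The first components are the restrictions of the facets in the given order. Their sizes
  0, 1, 2 occur 1, 6, 7 times, the h-vector of \<open>X\<close>.\<close>

definition X_shelling :: "(nat set \<times> nat set) list" where
  "X_shelling = [({}, {1,2,4,9}), ({6}, {1,2,6,9}), ({5}, {1,5,6,9}), ({8}, {1,5,8,9}),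
     ({4,8}, {1,4,8,9}), ({4,5}, {1,4,5,8}), ({7}, {1,4,5,7}), ({7,8}, {4,5,7,8}), ({2,5}, {1,2,5,6}),
     ({0}, {0,1,2,5}), ({0,6}, {0,2,5,6}), ({3}, {0,1,2,3}), ({3,4}, {1,2,3,4}), ({3,7}, {1,3,4,7})]"

definition A_shelling :: "(nat set \<times> nat set) list" where
  "A_shelling = [({}, {0,2,6}), ({3}, {0,2,3}), ({4}, {2,3,4}), ({7}, {3,4,7}), ({8}, {4,7,8})]"

definition X_facets :: "nat set set" where
  "X_facets = snd ` set X_shelling"

definition A_facets :: "nat set set" where
  "A_facets = snd ` set A_shelling"

lemma X_complex_facets: "X_complex = complex_of X_facets"
  unfolding X_complex_def X_facets_def X_shelling_def by simp

lemma A_complex_facets: "A_complex = complex_of A_facets"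
  unfolding A_complex_def A_facets_def A_shelling_def by simp

lemma shelling_X: "shelling {} X_shelling"
  unfolding X_shelling_def by simp

lemma shelling_A: "shelling {} A_shelling"
  unfolding A_shelling_def by simp

text \<open>
  The coefficient matrix of the linear forms has determinant \<open>1\<close> or \<open>-1\<close> on every facet of \<open>X\<close>,
  and so do its first three rows on every facet of \<open>A\<close>, so that it works over every field.
\<close>

definition lsop_supports :: "nat set list" where
  "lsop_supports = [{0,4,6,8}, {0,3,5,7,9}, {2,3,5,8}, {0,1,7}]"

lemmas X_facets_list = X_facets_def[unfolded X_shelling_def, simplified]
lemmas A_facets_list = A_facets_def[unfolded A_shelling_def, simplified]

lemma lin_indep_X:
  assumes "F \<in> X_facets"
  shows "lin_indep_on F (map (\<lambda>C v. of_bool (v \<in> C) :: 'k::field) lsop_supports)"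
proof -
  have "d 0 = 0 \<and> d 1 = 0 \<and> d 2 = 0 \<and> d 3 = 0"
    if "\<forall>v\<in>F. (\<Sum>i<4. d i * of_bool (v \<in> lsop_supports ! i)) = 0" for d :: "nat \<Rightarrow> 'k"
    using that assms unfolding X_facets_list
    \<comment> \<open>On each facet the four equations can be solved one unknown at a time, over any
      field.\<close>
    by (elim insertE emptyE; simp add: lsop_supports_def numeral_eq_Suc; elim conjE; simp)
  then show ?thesis
    by (simp add: lin_indep_on_def lsop_supports_def numeral_eq_Suc less_Suc_eq)
qed

lemma lin_indep_A:
  assumes "F \<in> A_facets"
  shows "lin_indep_on F (map (\<lambda>C v. of_bool (v \<in> C) :: 'k::field) (butlast lsop_supports))"
proof -
  have "d 0 = 0 \<and> d 1 = 0 \<and> d 2 = 0"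
    if "\<forall>v\<in>F. (\<Sum>i<3. d i * of_bool (v \<in> lsop_supports ! i)) = 0" for d :: "nat \<Rightarrow> 'k"
    using that assms unfolding A_facets_list
    by (elim insertE emptyE; simp add: lsop_supports_def numeral_eq_Suc; elim conjE; simp)
  then show ?thesis
    by (simp add: lin_indep_on_def lsop_supports_def numeral_eq_Suc less_Suc_eq)
qed

definition A_vertices :: "nat set" where
  "A_vertices = {0,2,3,4,6,7,8}"

lemma X_facets_bound: "F \<in> X_facets \<Longrightarrow> F \<subseteq> {..9}"
proof -
  have "\<forall>F\<in>X_facets. F \<subseteq> {..9}" by (simp add: X_facets_list)
  then show "F \<in> X_facets \<Longrightarrow> F \<subseteq> {..9}" by blast
qed

lemma A_facets_vertices: "G \<in> A_facets \<Longrightarrow> G \<subseteq> A_vertices"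
proof -
  have "\<forall>G\<in>A_facets. G \<subseteq> A_vertices" by (simp add: A_facets_list A_vertices_def)
  then show "G \<in> A_facets \<Longrightarrow> G \<subseteq> A_vertices" by blast
qed

lemma A_vertices_bound: "A_vertices \<subseteq> {..9}"
  by (simp add: A_vertices_def)

lemma A_subcomplex: "G \<in> A_facets \<Longrightarrow> \<exists>F\<in>X_facets. G \<subseteq> F"
proof -
  have "\<forall>G\<in>A_facets. \<exists>F\<in>X_facets. G \<subseteq> F" by (simp add: A_facets_list X_facets_list)
  then show "G \<in> A_facets \<Longrightarrow> \<exists>F\<in>X_facets. G \<subseteq> F" by blast
qed

text \<open>Together with \<open>A_subcomplex\<close> this says that \<open>A\<close> is the induced
  subcomplex, which is what keeps distinct copies from meeting in more than
  \<open>A\<close>.\<close>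

lemma A_induced: "F \<in> X_facets \<Longrightarrow> \<exists>G\<in>A_facets. F \<inter> A_vertices \<subseteq> G"
proof -
  have "\<forall>F\<in>X_facets. \<exists>G\<in>A_facets. F \<inter> A_vertices \<subseteq> G"
    by (simp add: A_facets_list X_facets_list A_vertices_def Int_insert_left)
  then show "F \<in> X_facets \<Longrightarrow> \<exists>G\<in>A_facets. F \<inter> A_vertices \<subseteq> G" by blast
qed

text \<open>The glued and labeled complex without the sum type: \<open>g j v\<close> is the label of
  the vertex \<open>v\<close> in copy \<open>j\<close>, and the last assumption records exactly
  which labels coincide.\<close>

locale three_copies =
  fixes g :: "nat \<Rightarrow> nat \<Rightarrow> nat" and V :: "nat set"
  assumes finite_V: "finite V"
    and g_in: "j < 3 \<Longrightarrow> v \<le> 9 \<Longrightarrow> g j v \<in> V"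
    and g_eq_iff: "i < 3 \<Longrightarrow> j < 3 \<Longrightarrow> v \<le> 9 \<Longrightarrow> w \<le> 9 \<Longrightarrow>
      g i v = g j w \<longleftrightarrow> v = w \<and> (i = j \<or> v \<in> A_vertices)"
begin

definition facets :: "nat \<Rightarrow> nat set set" where
  "facets j = (`) (g j) ` X_facets"

lemma inj_g: "j < 3 \<Longrightarrow> inj_on (g j) {..9}"
  by (auto simp: inj_on_def g_eq_iff)

lemma facets_subset: "j < 3 \<Longrightarrow> F \<in> facets j \<Longrightarrow> F \<subseteq> V"
  using X_facets_bound g_in by (fastforce simp: facets_def)

lemma g_A: "i < 3 \<Longrightarrow> j < 3 \<Longrightarrow> G \<subseteq> A_vertices \<Longrightarrow> g i ` G = g j ` G"
  using A_vertices_bound g_eq_iff[of i j] by (intro image_cong) auto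

lemma inter_copies:
  assumes "i < 3" "j < 3" "i \<noteq> j" "F \<in> X_facets" "F' \<in> X_facets" "\<sigma> \<subseteq> g i ` F" "\<sigma> \<subseteq> g j ` F'"
  shows "\<exists>\<tau>. \<sigma> = g i ` \<tau> \<and> \<tau> \<subseteq> F \<inter> F' \<inter> A_vertices"
proof -
  obtain \<tau> where \<tau>: "\<tau> \<subseteq> F" "\<sigma> = g i ` \<tau>" using assms(6) by (meson subset_imageE)
  have "v \<in> F' \<inter> A_vertices" if v: "v \<in> \<tau>" for v
  proof -
    obtain w where w: "w \<in> F'" "g i v = g j w" using v \<tau> assms(7) by blast
    have "v \<le> 9" "w \<le> 9" using v w \<tau> X_facets_bound[OF assms(4)] X_facets_bound[OF assms(5)] by auto
    then show ?thesis using g_eq_iff[of i j v w] w assms(1-3) by auto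
  qed
  then show ?thesis using \<tau> by auto
qed

text \<open>Two copies meet in \<open>A\<close>: one inclusion holds because \<open>A\<close> is a
  subcomplex, the other because it is induced. Copy 0 of \<open>A\<close> stands for all three,
  which agree by \<open>g_A\<close>.\<close>

lemma inter_copies_face:
  assumes "i < 3" "j < 3" "i \<noteq> j"
  shows "(\<exists>G\<in>(`) (g 0) ` A_facets. \<sigma> \<subseteq> G) \<longleftrightarrow> (\<exists>F\<in>facets i. \<sigma> \<subseteq> F) \<and> (\<exists>F\<in>facets j. \<sigma> \<subseteq> F)"
proof
  assume "\<exists>G\<in>(`) (g 0) ` A_facets. \<sigma> \<subseteq> G"
  then obtain G where G: "G \<in> A_facets" "\<sigma> \<subseteq> g 0 ` G" by auto
  obtain F where F: "F \<in> X_facets" "G \<subseteq> F" using A_subcomplex[OF G(1)] by blast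
  have "\<sigma> \<subseteq> g k ` F" if "k < 3" for k
    using G(2) F(2) g_A[of 0 k, OF _ that A_facets_vertices[OF G(1)]] by auto
  then show "(\<exists>F\<in>facets i. \<sigma> \<subseteq> F) \<and> (\<exists>F\<in>facets j. \<sigma> \<subseteq> F)"
    using F(1) assms unfolding facets_def by blast
next
  assume "(\<exists>F\<in>facets i. \<sigma> \<subseteq> F) \<and> (\<exists>F\<in>facets j. \<sigma> \<subseteq> F)"
  then obtain F F' where F: "F \<in> X_facets" "F' \<in> X_facets" "\<sigma> \<subseteq> g i ` F" "\<sigma> \<subseteq> g j ` F'"
    by (auto simp: facets_def)
  obtain \<tau> where \<tau>: "\<sigma> = g i ` \<tau>" "\<tau> \<subseteq> F \<inter> F' \<inter> A_vertices" using inter_copies[OF assms F] by blast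
  obtain G where "G \<in> A_facets" "F \<inter> A_vertices \<subseteq> G" using A_induced[OF F(1)] by blast
  then show "\<exists>G\<in>(`) (g 0) ` A_facets. \<sigma> \<subseteq> G"
    using \<tau> g_A[of i 0 \<tau>] assms(1) by (intro bexI[of _ "g 0 ` G"]) auto
qed

text \<open>All copies of a vertex receive the same coefficient. Since gluing never merges two
  different vertices of \<open>X\<close>, the restriction to each copy is the original 0/1
  vector.\<close>

definition coeff :: "nat set \<Rightarrow> nat \<Rightarrow> 'k::field" where
  "coeff C u = of_bool (\<exists>j<3. u \<in> g j ` C)"

lemma coeff_g:
  assumes "j < 3" "v \<le> 9" "C \<subseteq> {..9}"
  shows "coeff C (g j v) = of_bool (v \<in> C)"
proof -
  have "(\<exists>i<3. g j v \<in> g i ` C) \<longleftrightarrow> v \<in> C"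
  proof
    assume "\<exists>i<3. g j v \<in> g i ` C"
    then obtain i w where "i < 3" "w \<in> C" "g j v = g i w" by auto
    then show "v \<in> C" using g_eq_iff[of j i v w] assms by auto
  qed (use assms in auto)
  then show ?thesis by (simp add: coeff_def)
qed

lemma lin_indep_copy:
  assumes "j < 3" "F \<subseteq> {..9}" "\<forall>C\<in>set Cs. C \<subseteq> {..9}"
    and ind: "lin_indep_on F (map (\<lambda>C v. of_bool (v \<in> C) :: 'k::field) Cs)"
  shows "lin_indep_on (g j ` F) (map (coeff :: _ \<Rightarrow> _ \<Rightarrow> 'k) Cs)"
proof -
  have "coeff (Cs ! i) (g j v) = (of_bool (v \<in> Cs ! i) :: 'k)" if "v \<in> F" "i < length Cs" for v i
    using that assms(1-3) by (intro coeff_g) auto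
  then have "(\<Sum>i<length Cs. d i * coeff (Cs ! i) (g j v)) = (\<Sum>i<length Cs. d i * (of_bool (v \<in> Cs ! i) :: 'k))"
    if "v \<in> F" for v and d
    using that by (intro sum.cong) auto
  then show ?thesis using ind unfolding lin_indep_on_def by simp
qed

definition lsop :: "'k::field mpoly list" where
  "lsop = map (linear_form V \<circ> coeff) lsop_supports"

lemma lsop_in: "set lsop \<subseteq> polys_in V" "set (butlast lsop) \<subseteq> polys_in V"
  by (auto simp: lsop_def dest!: in_set_butlastD)

lemma lsop_supports_bound: "\<forall>C\<in>set lsop_supports. C \<subseteq> {..9}"
  by (auto simp: lsop_supports_def)

lemma wreg_X_copy:
  assumes "j < 3"
  shows "wreg (lsop :: 'k::field mpoly list) (polys_in V) (nonfaces V (facets j))"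
proof -
  let ?l = "map (map_prod ((`) (g j)) ((`) (g j))) X_shelling"
  have sub: "fst p \<subseteq> {..9} \<and> snd p \<subseteq> {..9}" if "p \<in> set X_shelling" for p
    using that by (auto simp: X_shelling_def)
  have "shelling ((`) (g j) ` {}) ?l"
    using sub shelling_X by (intro shelling_image[OF inj_g[OF assms]]) auto
  moreover have im: "snd ` set ?l = facets j"
    by (auto simp: facets_def X_facets_def image_image)
  moreover have "wreg (lsop :: 'k mpoly list) (polys_in V) (nonfaces V {F})" if "F \<in> facets j" for F
  proof -
    from that obtain F' where F': "F' \<in> X_facets" "F = g j ` F'" by (auto simp: facets_def)
    have "lin_indep_on F (map (coeff :: _ \<Rightarrow> _ \<Rightarrow> 'k) lsop_supports)"
      unfolding F' by (rule lin_indep_copy[OF assms X_facets_bound lsop_supports_bound lin_indep_X]) fact+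
    from wreg_linear_forms[OF finite_V facets_subset[OF assms that] this] show ?thesis
      by (simp add: lsop_def)
  qed
  ultimately have "wreg (lsop :: 'k mpoly list) (nonfaces V {}) (nonfaces V (snd ` set ?l \<union> {}))"
    using facets_subset[OF assms] by (intro wreg_shelling[OF finite_V lsop_in(1)]) auto
  then show ?thesis using im by (simp add: nonfaces_empty)
qed

lemma wreg_A_copy:
  "wreg (butlast lsop :: 'k::field mpoly list) (polys_in V) (nonfaces V ((`) (g 0) ` A_facets))"
proof -
  let ?l = "map (map_prod ((`) (g 0)) ((`) (g 0))) A_shelling"
  have sub: "fst p \<subseteq> {..9} \<and> snd p \<subseteq> {..9}" if "p \<in> set A_shelling" for p
    using that by (auto simp: A_shelling_def)
  have "shelling ((`) (g 0) ` {}) ?l"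
    using sub shelling_A by (intro shelling_image[OF inj_g]) auto
  moreover have im: "snd ` set ?l = (`) (g 0) ` A_facets"
    by (auto simp: A_facets_def image_image)
  moreover have "F \<subseteq> V \<and> wreg (butlast lsop :: 'k mpoly list) (polys_in V) (nonfaces V {F})"
    if "F \<in> (`) (g 0) ` A_facets" for F
  proof -
    from that obtain F' where F': "F' \<in> A_facets" "F = g 0 ` F'" by auto
    have b: "F' \<subseteq> {..9}" using A_facets_vertices[OF F'(1)] A_vertices_bound by auto
    then have FV: "F \<subseteq> V" using g_in F' by auto
    have "lin_indep_on F (map (coeff :: _ \<Rightarrow> _ \<Rightarrow> 'k) (butlast lsop_supports))"
      unfolding F' using lsop_supports_bound
      by (intro lin_indep_copy b lin_indep_A F') (auto dest: in_set_butlastD)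
    from wreg_linear_forms[OF finite_V FV this] show ?thesis
      using FV by (simp add: lsop_def map_butlast)
  qed
  ultimately have "wreg (butlast lsop :: 'k mpoly list) (nonfaces V {}) (nonfaces V (snd ` set ?l \<union> {}))"
    by (intro wreg_shelling[OF finite_V lsop_in(2)]) auto
  then show ?thesis using im by (simp add: nonfaces_empty)
qed

lemma wreg_C3: "wreg (lsop :: 'k::field mpoly list) (polys_in V) (nonfaces V (facets 0 \<union> facets 1 \<union> facets 2))"
proof -
  have "lsop \<noteq> ([] :: 'k mpoly list)" by (simp add: lsop_def lsop_supports_def)
  then obtain b where split: "lsop = butlast lsop @ [b :: 'k mpoly]" "b \<in> polys_in V"
    using lsop_in(1) by (metis append_butlast_last_id last_in_set subsetD)
  have X: "wreg (butlast lsop @ [b]) (polys_in V) (nonfaces V (facets j))" if "j < 3" for j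
    using wreg_X_copy[OF that, where 'k = 'k] split(1) by simp
  note A = wreg_A_copy[where 'k = 'k]
  have X01: "wreg (butlast lsop @ [b]) (polys_in V) (nonfaces V (facets 0 \<union> facets 1))"
    by (rule wreg_glue[OF lsop_in(2) split(2) X X A inter_copies_face]) simp_all
  have "wreg (butlast lsop @ [b]) (polys_in V) (nonfaces V (facets 0 \<union> facets 1 \<union> facets 2))"
  proof (rule wreg_glue[OF lsop_in(2) split(2) X01 X A])
    \<comment> \<open>Copy 2 meets each of the two earlier copies exactly in \<open>A\<close>, so it
      meets their union in \<open>A\<close> as well.\<close>
    show "(\<exists>F\<in>(`) (g 0) ` A_facets. \<sigma> \<subseteq> F) \<longleftrightarrow>
        (\<exists>F\<in>facets 0 \<union> facets 1. \<sigma> \<subseteq> F) \<and> (\<exists>F\<in>facets 2. \<sigma> \<subseteq> F)" for \<sigma>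
      unfolding bex_Un using inter_copies_face[of 0 2 \<sigma>] inter_copies_face[of 1 2 \<sigma>] by linarith
  qed simp
  then show ?thesis using split(1) by simp
qed

end

section \<open>The glued complex is not partitionable\<close>

text \<open>\<open>R F\<close> is the lower end of the interval below \<open>F\<close>. Covering is
  demanded only for faces outside \<open>A\<close>, because a face of \<open>A\<close> may be
  covered from another copy; disjointness holds for all faces.\<close>

lemma X_partition_covers_vertex:
  fixes R :: "nat set \<Rightarrow> nat set"
  assumes cover: "\<And>\<sigma>. \<exists>F\<in>X_facets. \<sigma> \<subseteq> F \<Longrightarrow> \<forall>G\<in>A_facets. \<not> \<sigma> \<subseteq> G \<Longrightarrow> \<exists>F\<in>X_facets. R F \<subseteq> \<sigma> \<and> \<sigma> \<subseteq> F"
    and disj: "\<And>F G \<sigma>. F \<in> X_facets \<Longrightarrow> G \<in> X_facets \<Longrightarrow> R F \<subseteq> \<sigma> \<Longrightarrow> \<sigma> \<subseteq> F \<Longrightarrow> R G \<subseteq> \<sigma> \<Longrightarrow> \<sigma> \<subseteq> G \<Longrightarrow> F = G"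
  shows "\<exists>F\<in>X_facets. (R F \<subseteq> {6} \<and> 6 \<in> F) \<or> (R F \<subseteq> {8} \<and> 8 \<in> F)"
proof (rule ccontr)
  assume neg: "\<not> ?thesis"
  then have n6: "\<And>F. F \<in> X_facets \<Longrightarrow> 6 \<in> F \<Longrightarrow> \<not> R F \<subseteq> {6}"
    and n8: "\<And>F. F \<in> X_facets \<Longrightarrow> 8 \<in> F \<Longrightarrow> \<not> R F \<subseteq> {8}" by auto
  note L = X_facets_list A_facets_list
  \<comment> \<open>Faces in a single facet pin down its interval; the contradiction arises in the link of 5.\<close>
  have n: "\<not> R {1,2,6,9} \<subseteq> {6}" "\<not> R {1,5,6,9} \<subseteq> {6}" "\<not> R {1,2,5,6} \<subseteq> {6}"
    "\<not> R {1,5,8,9} \<subseteq> {8}" "\<not> R {1,4,8,9} \<subseteq> {8}" "\<not> R {1,4,5,8} \<subseteq> {8}"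
    using n6[of "{1,2,6,9}"] n6[of "{1,5,6,9}"] n6[of "{1,2,5,6}"]
      n8[of "{1,5,8,9}"] n8[of "{1,4,8,9}"] n8[of "{1,4,5,8}"] by (simp_all add: L)
  have c269: "R {1,2,6,9} \<subseteq> {2,6,9}" using cover[of "{2,6,9}"] by (simp add: L)
  have c569: "R {1,5,6,9} \<subseteq> {5,6,9}" using cover[of "{5,6,9}"] by (simp add: L)
  have c056: "R {0,2,5,6} \<subseteq> {0,5,6}" using cover[of "{0,5,6}"] by (simp add: L)
  have c015: "R {0,1,2,5} \<subseteq> {0,1,5}" using cover[of "{0,1,5}"] by (simp add: L)
  have c157: "R {1,4,5,7} \<subseteq> {1,5,7}" using cover[of "{1,5,7}"] by (simp add: L)
  have c489: "R {1,4,8,9} \<subseteq> {4,8,9}" using cover[of "{4,8,9}"] by (simp add: L)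
  have c589: "R {1,5,8,9} \<subseteq> {5,8,9}" using cover[of "{5,8,9}"] by (simp add: L)
  have "R {1,2,6,9} \<subseteq> {1,6} \<or> R {1,5,6,9} \<subseteq> {1,6} \<or> R {1,2,5,6} \<subseteq> {1,6}"
    using cover[of "{1,6}"] by (simp add: L)
  \<comment> \<open>If the interval of 1269 or of 1569 contained {1,6}, its lower end would lie in
    {6} by \<open>c269\<close> or \<open>c569\<close>, which is excluded. The same argument with 8
    gives \<open>c18\<close>.\<close>
  then have c16: "R {1,2,5,6} \<subseteq> {1,6}" using n c269 c569 by auto
  have "R {1,5,8,9} \<subseteq> {1,8} \<or> R {1,4,8,9} \<subseteq> {1,8} \<or> R {1,4,5,8} \<subseteq> {1,8}"
    using cover[of "{1,8}"] by (simp add: L)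
  then have c18: "R {1,4,5,8} \<subseteq> {1,8}" using n c489 c589 by auto
  have "\<not> R {1,5,8,9} \<subseteq> {1,5,8}"
  proof
    assume "R {1,5,8,9} \<subseteq> {1,5,8}"
    then have "{1,5,8,9} = {1,4,5,8::nat}"
      using c18 by (intro disj[of "{1,5,8,9}" "{1,4,5,8}" "{1,5,8}"]) (auto simp: L)
    then have "4 \<in> {1,5,8,9::nat}" by (rule ssubst) simp
    then show False by simp
  qed
  moreover have "R {1,5,8,9} \<subseteq> {5,8} \<or> R {1,4,5,8} \<subseteq> {5,8} \<or> R {4,5,7,8} \<subseteq> {5,8}"
    using cover[of "{5,8}"] by (simp add: L)
  \<comment> \<open>For 1589 the face {1,5,8} would be covered twice; for 1458 the lower end would
    lie in {8}. Only 4578 remains.\<close>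
  ultimately have c58: "R {4,5,7,8} \<subseteq> {5,8}" using n c18 by auto
  have "R {1,2,5,6} \<subseteq> {2,5} \<or> R {0,1,2,5} \<subseteq> {2,5} \<or> R {0,2,5,6} \<subseteq> {2,5}"
    using cover[of "{2,5}"] by (simp add: L)
  \<comment> \<open>By \<open>c16\<close>, covering {2,5} from 1256 would force an empty lower end.
    In the two other cases \<open>c015\<close> and \<open>c056\<close> shrink the lower end to {5},
    so the vertex 5 is covered by a facet without 4.\<close>
  then have "R {0,1,2,5} \<subseteq> {5} \<or> R {0,2,5,6} \<subseteq> {5}" using n c16 c015 c056 by auto
  then have "\<exists>F\<in>X_facets. 5 \<in> F \<and> 4 \<notin> F \<and> R F \<subseteq> {5}" by (simp add: L)
  then obtain F where F: "F \<in> X_facets" "5 \<in> F" "4 \<notin> F" "R F \<subseteq> {5}" by blast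
  then have "\<not> R {1,4,5,7} \<subseteq> {5}" "\<not> R {4,5,7,8} \<subseteq> {5}"
    using disj[of F "{1,4,5,7}" "{5}"] disj[of F "{4,5,7,8}" "{5}"] by (simp_all add: L) blast+
  moreover have "R {1,4,5,8} \<subseteq> {4,5} \<or> R {1,4,5,7} \<subseteq> {4,5} \<or> R {4,5,7,8} \<subseteq> {4,5}"
    using cover[of "{4,5}"] by (simp add: L)
  \<comment> \<open>Covering {4,5} from 1457 or 4578 would cover the vertex 5 a second time, and
    from 1458 it would force an empty lower end.\<close>
  ultimately show False using n c18 c157 c58 by auto
qed

context three_copies
begin

definition C3_facets :: "nat set set" where
  "C3_facets = (\<Union>j<3. facets j)"

lemma C3_facets_eq: "C3_facets = facets 0 \<union> facets 1 \<union> facets 2"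
proof -
  have "{..<3} = {0, 1, 2::nat}" by auto
  then show ?thesis by (simp add: C3_facets_def Un_assoc)
qed

lemma card_C3_facet:
  assumes "F \<in> C3_facets"
  shows "finite F" "card F = 4"
proof -
  obtain i F' where F: "i < 3" "F = g i ` F'" "F' \<in> X_facets"
    using assms unfolding C3_facets_def facets_def by blast
  have sub: "F' \<subseteq> {..9}" using X_facets_bound[OF F(3)] .
  have "\<forall>F\<in>X_facets. card F = 4" by (simp add: X_facets_list)
  then show "card F = 4"
    using F(2,3) card_image[OF inj_on_subset[OF inj_g[OF F(1)] sub]] by simp
  show "finite F" using F(2) finite_subset[OF sub] by simp
qed

lemma C3_facet_subset: "F \<in> C3_facets \<Longrightarrow> F \<subseteq> V"
  using facets_subset by (auto simp: C3_facets_def)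

text \<open>Every facet of \<open>X\<close> has a vertex outside \<open>A\<close>, and such a vertex
  determines the copy.\<close>

lemma facets_disjoint:
  assumes "i < 3" "j < 3" "F \<in> X_facets" "F' \<in> X_facets" "g i ` F = g j ` F'"
  shows "i = j \<and> F = F'"
proof -
  have "\<not> F \<subseteq> A_vertices"
  proof -
    have "\<forall>F\<in>X_facets. \<not> F \<subseteq> A_vertices" by (simp add: X_facets_list A_vertices_def)
    then show ?thesis using assms by blast
  qed
  then obtain v where v: "v \<in> F" "v \<notin> A_vertices" by blast
  then obtain w where w: "w \<in> F'" "g i v = g j w" using assms(5) by blast
  have "v \<le> 9" "w \<le> 9" using v w X_facets_bound assms(3,4) by auto
  then have "i = j" using g_eq_iff[of i j v w] w v assms by auto
  then show ?thesis
    using assms inj_on_image_eq_iff[OF inj_g[OF assms(1)], of F F'] X_facets_bound by auto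
qed

text \<open>
  Every vertex of \<open>A\<close> is covered in only one of the three copies, while each copy
  has to cover the vertex \<open>6\<close> or the vertex \<open>8\<close>.
\<close>

lemma not_partitionable:
  assumes part: "\<And>\<sigma>. \<exists>F\<in>C3_facets. \<sigma> \<subseteq> F \<Longrightarrow> \<exists>!F. F \<in> C3_facets \<and> \<rho> F \<subseteq> \<sigma> \<and> \<sigma> \<subseteq> F"
  shows False
proof -
  have covered: "\<exists>G\<in>C3_facets. \<rho> G \<subseteq> \<sigma> \<and> \<sigma> \<subseteq> G" if "F \<in> C3_facets" "\<sigma> \<subseteq> F" for \<sigma> F
    using ex1_implies_ex[OF part, of \<sigma>] that by blast
  have unique: "F = G"
    if "F \<in> C3_facets" "\<rho> F \<subseteq> \<sigma>" "\<sigma> \<subseteq> F" "G \<in> C3_facets" "\<rho> G \<subseteq> \<sigma>" "\<sigma> \<subseteq> G" for \<sigma> F G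
  proof -
    have "\<exists>!F. F \<in> C3_facets \<and> \<rho> F \<subseteq> \<sigma> \<and> \<sigma> \<subseteq> F"
      by (rule part) (use that in blast)
    then show ?thesis by (rule ex1E) (use that in blast)
  qed
  have in_C3: "g j ` F \<in> C3_facets" if "j < 3" "F \<in> X_facets" for j F
    using that unfolding C3_facets_def facets_def by blast
  \<comment> \<open>The lower ends are pulled back from labels to the vertices of
    \<open>X\<close>.\<close>
  define R where "R j F = {v\<in>{..9}. g j v \<in> \<rho> (g j ` F)}" for j F
  \<comment> \<open>The face \<open>F\<close> itself must be covered, and since all facets have the
    same size, only its own interval can do so.\<close>
  have rho_sub: "\<rho> F \<subseteq> F" if F: "F \<in> C3_facets" for F
  proof -
    obtain G where G: "G \<in> C3_facets" "\<rho> G \<subseteq> F" "F \<subseteq> G" using covered[OF F subset_refl] by blast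
    then have "F = G" using card_C3_facet[OF F] card_C3_facet[OF G(1)] by (simp add: card_subset_eq)
    then show ?thesis using G by simp
  qed
  have R_iff: "\<rho> (g j ` F) \<subseteq> g j ` \<sigma> \<longleftrightarrow> R j F \<subseteq> \<sigma>"
    if "j < 3" "F \<in> X_facets" "\<sigma> \<subseteq> F" for j F \<sigma>
  proof -
    have b: "F \<subseteq> {..9}" "\<sigma> \<subseteq> {..9}" using X_facets_bound that by auto
    have "\<rho> (g j ` F) = g j ` R j F"
      using rho_sub[OF in_C3[OF that(1,2)]] b(1) by (auto simp: R_def)
    moreover have "R j F \<subseteq> {..9}" by (auto simp: R_def)
    ultimately show ?thesis using inj_on_image_subset_iff[OF inj_g[OF that(1)]] b by simp
  qed
  have inj_sub: "g j ` \<sigma> \<subseteq> g j ` F \<longleftrightarrow> \<sigma> \<subseteq> F" if "j < 3" "\<sigma> \<subseteq> {..9}" "F \<in> X_facets" for j \<sigma> F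
    using inj_on_image_subset_iff[OF inj_g[OF that(1)] that(2) X_facets_bound[OF that(3)]] .
  have copy: "\<exists>F\<in>X_facets. (R j F \<subseteq> {6} \<and> 6 \<in> F) \<or> (R j F \<subseteq> {8} \<and> 8 \<in> F)" if j: "j < 3" for j
  proof (rule X_partition_covers_vertex)
    fix \<sigma> assume F: "\<exists>F\<in>X_facets. \<sigma> \<subseteq> F" and A: "\<forall>G\<in>A_facets. \<not> \<sigma> \<subseteq> G"
    then obtain F where F: "F \<in> X_facets" "\<sigma> \<subseteq> F" by blast
    then have b: "\<sigma> \<subseteq> {..9}" using X_facets_bound by blast
    obtain G where G: "G \<in> C3_facets" "\<rho> G \<subseteq> g j ` \<sigma>" "g j ` \<sigma> \<subseteq> G"
      using covered[OF in_C3[OF j F(1)] image_mono[OF F(2)]] by blast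
    then obtain i G' where G': "i < 3" "G = g i ` G'" "G' \<in> X_facets"
      unfolding C3_facets_def facets_def by blast
    \<comment> \<open>A face common to two copies lies in \<open>A\<close>, but this one does
      not.\<close>
    have "i = j"
    proof (rule ccontr)
      assume "i \<noteq> j"
      then obtain \<tau> where \<tau>: "g j ` \<sigma> = g j ` \<tau>" "\<tau> \<subseteq> F \<inter> G' \<inter> A_vertices"
        using inter_copies[OF j G'(1) _ F(1) G'(3), of "g j ` \<sigma>"] F G G' by blast
      have "\<sigma> = \<tau>"
        using inj_on_image_eq_iff[OF inj_g[OF j] b, of \<tau>] \<tau> A_vertices_bound by blast
      then show False using A A_induced[OF F(1)] \<tau>(2) by blast
    qed
    moreover from this have "\<sigma> \<subseteq> G'" using G(3) G' inj_sub[OF j b] by simp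
    ultimately show "\<exists>F\<in>X_facets. R j F \<subseteq> \<sigma> \<and> \<sigma> \<subseteq> F" using G(2) G' R_iff[OF j] by blast
  next
    fix F G \<sigma> assume FG: "F \<in> X_facets" "G \<in> X_facets" "R j F \<subseteq> \<sigma>" "\<sigma> \<subseteq> F" "R j G \<subseteq> \<sigma>" "\<sigma> \<subseteq> G"
    then have "g j ` F = g j ` G"
      by (intro unique[of _ "g j ` \<sigma>"]) (simp_all add: in_C3 j R_iff image_mono)
    then show "F = G" using facets_disjoint[OF j j FG(1,2)] by blast
  qed
  have "\<exists>v F. v \<in> {6,8} \<and> F \<in> X_facets \<and> v \<in> F \<and> \<rho> (g j ` F) \<subseteq> {g j v}" if j: "j < 3" for j
  proof -
    from copy[OF j] obtain F where F: "F \<in> X_facets"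
      "(R j F \<subseteq> {6} \<and> 6 \<in> F) \<or> (R j F \<subseteq> {8} \<and> 8 \<in> F)" by blast
    then obtain v where v: "v \<in> {6,8}" "v \<in> F" "R j F \<subseteq> {v}" by auto
    then have "\<rho> (g j ` F) \<subseteq> {g j v}" using R_iff[OF j F(1), of "{v}"] by simp
    then show ?thesis using v F by blast
  qed
  then have "\<forall>j. \<exists>v F. j < 3 \<longrightarrow> v \<in> {6,8} \<and> F \<in> X_facets \<and> v \<in> F \<and> \<rho> (g j ` F) \<subseteq> {g j v}"
    by blast
  then obtain v F where vF: "\<And>j. j < 3 \<Longrightarrow> v j \<in> {6,8} \<and> F j \<in> X_facets \<and> v j \<in> F j \<and> \<rho> (g j ` F j) \<subseteq> {g j (v j)}"
    by metis
  have distinct: "v i \<noteq> v j" if "i < 3" "j < 3" "i \<noteq> j" for i j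
  proof
    assume eq: "v i = v j"
    then have "g i (v i) = g j (v j)" using vF[OF that(1)] that by (auto simp: g_eq_iff A_vertices_def)
    moreover from this have "g j (v j) \<in> g i ` F i" using vF[OF that(1)] by (intro image_eqI) auto
    ultimately have "g i ` F i = g j ` F j"
      using vF[OF that(1)] vF[OF that(2)] that
      by (intro unique[of _ "{g i (v i)}"]) (simp_all add: in_C3)
    then show False using facets_disjoint[OF that(1,2)] that(3) vF[OF that(1)] vF[OF that(2)] by blast
  qed
  \<comment> \<open>Three pairwise different values cannot all lie in {6,8}.\<close>
  show False using distinct[of 0 1] distinct[of 0 2] distinct[of 1 2] vF[of 0] vF[of 1] vF[of 2] by auto
qed

end

section \<open>Quotients of modules\<close>

locale quotient_module = Module.module R M for R :: "('a, 'r) ring_scheme" (structure) and M :: "('a, 'm) module" (structure) +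
  fixes N
  assumes submodule_N: "submodule N R M"
begin

abbreviation Q where "Q \<equiv> quot_module M N"
abbreviation cl where "cl x \<equiv> N +>\<^bsub>M\<^esub> x"

lemma N_subgroup: "subgroup N (add_monoid M)"
  using submodule_N by (rule submodule.axioms(1))

lemma N_abelian_subgroup: "abelian_subgroup N M"
  by (rule abelian_subgroupI3[OF additive_subgroup.intro[OF N_subgroup]]) (rule abelian_group_axioms)

lemma N_subset: "N \<subseteq> carrier M"
  using submoduleE(1)[OF submodule_N] .

lemma carrier_Q: "carrier Q = cl ` carrier M"
  by (auto simp: quot_module_def A_RCOSETS_def')

lemma zero_Q: "\<zero>\<^bsub>Q\<^esub> = N"
  by (simp add: quot_module_def)

lemma cl_in_Q: "x \<in> carrier M \<Longrightarrow> cl x \<in> carrier Q"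
  by (simp add: carrier_Q)

lemma add_Q: "x \<in> carrier M \<Longrightarrow> y \<in> carrier M \<Longrightarrow> cl x \<oplus>\<^bsub>Q\<^esub> cl y = cl (x \<oplus>\<^bsub>M\<^esub> y)"
  using abelian_subgroup.a_rcos_sum[OF N_abelian_subgroup] by (simp add: quot_module_def)

text \<open>The image of a coset under \<open>a\<close> may be smaller than a coset of
  \<open>N\<close>; adding \<open>N\<close> in the definition of the scalar multiplication completes
  it.\<close>

lemma smult_Q:
  assumes a: "a \<in> carrier R" and x: "x \<in> carrier M"
  shows "a \<odot>\<^bsub>Q\<^esub> cl x = cl (a \<odot>\<^bsub>M\<^esub> x)"
proof -
  note N = submoduleE[OF submodule_N] and sub = subsetD[OF N_subset]
  have zero: "\<zero>\<^bsub>M\<^esub> \<in> N" using subgroup.one_closed[OF N_subgroup] by simp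
  have "a \<odot>\<^bsub>Q\<^esub> cl x = (\<Union>n\<in>N. \<Union>m\<in>N. {n \<oplus>\<^bsub>M\<^esub> a \<odot>\<^bsub>M\<^esub> (m \<oplus>\<^bsub>M\<^esub> x)})"
    by (auto simp: quot_module_def set_add_def' a_r_coset_def')
  also have "\<dots> = (\<Union>n\<in>N. {n \<oplus>\<^bsub>M\<^esub> a \<odot>\<^bsub>M\<^esub> x})"
  proof (intro equalityI subsetI)
    fix z assume "z \<in> (\<Union>n\<in>N. \<Union>m\<in>N. {n \<oplus>\<^bsub>M\<^esub> a \<odot>\<^bsub>M\<^esub> (m \<oplus>\<^bsub>M\<^esub> x)})"
    then obtain n m where nm: "n \<in> N" "m \<in> N" "z = n \<oplus>\<^bsub>M\<^esub> a \<odot>\<^bsub>M\<^esub> (m \<oplus>\<^bsub>M\<^esub> x)" by blast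
    have "z = (n \<oplus>\<^bsub>M\<^esub> a \<odot>\<^bsub>M\<^esub> m) \<oplus>\<^bsub>M\<^esub> a \<odot>\<^bsub>M\<^esub> x"
      unfolding nm(3) by (subst smult_r_distr) (use a x sub nm in \<open>auto simp: M.add.m_assoc\<close>)
    moreover have "n \<oplus>\<^bsub>M\<^esub> a \<odot>\<^bsub>M\<^esub> m \<in> N" using N a nm by auto
    ultimately show "z \<in> (\<Union>n\<in>N. {n \<oplus>\<^bsub>M\<^esub> a \<odot>\<^bsub>M\<^esub> x})" by blast
  next
    fix z assume "z \<in> (\<Union>n\<in>N. {n \<oplus>\<^bsub>M\<^esub> a \<odot>\<^bsub>M\<^esub> x})"
    then obtain n where n: "n \<in> N" "z = n \<oplus>\<^bsub>M\<^esub> a \<odot>\<^bsub>M\<^esub> x" by blast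
    then have "z = n \<oplus>\<^bsub>M\<^esub> a \<odot>\<^bsub>M\<^esub> (\<zero>\<^bsub>M\<^esub> \<oplus>\<^bsub>M\<^esub> x)" using x by simp
    then show "z \<in> (\<Union>n\<in>N. \<Union>m\<in>N. {n \<oplus>\<^bsub>M\<^esub> a \<odot>\<^bsub>M\<^esub> (m \<oplus>\<^bsub>M\<^esub> x)})" using n zero by blast
  qed
  finally show ?thesis by (simp add: a_r_coset_def')
qed

lemma cl_eq_N_iff: "x \<in> carrier M \<Longrightarrow> cl x = N \<longleftrightarrow> x \<in> N"
  using a_coset_join1[OF _ _ N_subgroup] a_coset_join2[OF _ N_subgroup] by blast

lemma cl_zero: "cl \<zero>\<^bsub>M\<^esub> = N"
  using N_subset by simp

lemma cl_eq_iff: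
  assumes "x \<in> carrier M" "y \<in> carrier M"
  shows "cl x = cl y \<longleftrightarrow> x \<oplus>\<^bsub>M\<^esub> \<ominus>\<^bsub>M\<^esub> y \<in> N"
  using a_coset_add_inv1[OF _ assms N_subset] a_coset_add_inv2[OF _ assms N_subset] assms
    cl_eq_N_iff[of "x \<oplus>\<^bsub>M\<^esub> \<ominus>\<^bsub>M\<^esub> y"] by auto

lemma module_Q: "Module.module R Q"
proof (rule Module.moduleI)
  show "cring R" by (rule R.is_cring)
  show "abelian_group Q"
  proof (rule abelian_groupI)
    show "\<zero>\<^bsub>Q\<^esub> \<in> carrier Q" using cl_zero cl_in_Q[of "\<zero>\<^bsub>M\<^esub>"] by (simp add: zero_Q)
    show "x \<oplus>\<^bsub>Q\<^esub> y \<in> carrier Q" if "x \<in> carrier Q" "y \<in> carrier Q" for x y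
      using that by (auto simp: carrier_Q add_Q)
    show "x \<oplus>\<^bsub>Q\<^esub> y \<oplus>\<^bsub>Q\<^esub> z = x \<oplus>\<^bsub>Q\<^esub> (y \<oplus>\<^bsub>Q\<^esub> z)"
      if "x \<in> carrier Q" "y \<in> carrier Q" "z \<in> carrier Q" for x y z
      using that by (auto simp: carrier_Q add_Q M.add.m_assoc)
    show "x \<oplus>\<^bsub>Q\<^esub> y = y \<oplus>\<^bsub>Q\<^esub> x" if "x \<in> carrier Q" "y \<in> carrier Q" for x y
      using that by (auto simp: carrier_Q add_Q M.add.m_comm)
    show "\<zero>\<^bsub>Q\<^esub> \<oplus>\<^bsub>Q\<^esub> x = x" if "x \<in> carrier Q" for x
    proof -
      from that obtain z where z: "z \<in> carrier M" "x = cl z" by (auto simp: carrier_Q)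
      then show ?thesis using add_Q[of "\<zero>\<^bsub>M\<^esub>" z] by (simp add: zero_Q cl_zero)
    qed
    show "\<exists>y\<in>carrier Q. y \<oplus>\<^bsub>Q\<^esub> x = \<zero>\<^bsub>Q\<^esub>" if "x \<in> carrier Q" for x
    proof -
      from that obtain z where z: "z \<in> carrier M" "x = cl z" by (auto simp: carrier_Q)
      then have "cl (\<ominus>\<^bsub>M\<^esub> z) \<oplus>\<^bsub>Q\<^esub> x = \<zero>\<^bsub>Q\<^esub>"
        by (simp add: add_Q zero_Q M.l_neg cl_zero)
      then show ?thesis using z cl_in_Q by blast
    qed
  qed
qed (auto simp: carrier_Q add_Q smult_Q smult_l_distr smult_r_distr smult_assoc1)

lemma finsum_Q:
  assumes "f \<in> A \<rightarrow> carrier M"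
  shows "(\<Oplus>\<^bsub>Q\<^esub>i\<in>A. cl (f i)) = cl (\<Oplus>\<^bsub>M\<^esub>i\<in>A. f i)"
proof -
  interpret Q: Module.module R Q by (rule module_Q)
  show ?thesis
    using assms
  proof (induction A rule: infinite_finite_induct)
    case (insert x F)
    then have "(\<Oplus>\<^bsub>Q\<^esub>i\<in>insert x F. cl (f i)) = cl (f x) \<oplus>\<^bsub>Q\<^esub> (\<Oplus>\<^bsub>Q\<^esub>i\<in>F. cl (f i))"
      by (intro Q.finsum_insert) (auto simp: cl_in_Q Pi_def)
    also have "\<dots> = cl (f x \<oplus>\<^bsub>M\<^esub> (\<Oplus>\<^bsub>M\<^esub>i\<in>F. f i))"
      using insert by (simp add: add_Q Pi_def)
    also have "f x \<oplus>\<^bsub>M\<^esub> (\<Oplus>\<^bsub>M\<^esub>i\<in>F. f i) = (\<Oplus>\<^bsub>M\<^esub>i\<in>insert x F. f i)"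
      using insert by (intro M.finsum_insert[symmetric]) auto
    finally show ?case .
  next
    case empty
    show ?case by (simp only: M.finsum_empty Q.finsum_empty zero_Q cl_zero)
  next
    \<comment> \<open>Sums over infinite sets are zero by convention on both sides.\<close>
    case (infinite A)
    show ?case
      by (simp only: M.add.finprod_infinite[OF infinite(1)] Q.add.finprod_infinite[OF infinite(1)]
          zero_Q cl_zero)
  qed
qed

lemma nonzerodivisor_Q_iff:
  assumes "f \<in> carrier R"
  shows "nonzerodivisor_on Q f \<longleftrightarrow> (\<forall>x\<in>carrier M. f \<odot>\<^bsub>M\<^esub> x \<in> N \<longrightarrow> x \<in> N)"
  using assms by (simp add: nonzerodivisor_on_def carrier_Q smult_Q zero_Q cl_eq_N_iff)

end

lemma submodule_list_mult_module:
  fixes M :: "('a, 'm) module"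
  assumes "Module.module R M" and fs: "set fs \<subseteq> carrier R"
  shows "submodule (list_mult_module M fs) R M"
proof -
  interpret Module.module R M by fact
  let ?L = "list_mult_module M fs"
  have fj: "fs ! j \<in> carrier R" if "j < length fs" for j using that fs by auto
  have sub: "?L \<subseteq> carrier M"
    using fj by (auto simp: list_mult_module_def intro!: M.finsum_closed smult_closed)
  have sm: "a \<odot>\<^bsub>M\<^esub> x \<in> ?L" if a: "a \<in> carrier R" and x: "x \<in> ?L" for a x
  proof -
    obtain g where g: "g \<in> {..<length fs} \<rightarrow> carrier M" "x = (\<Oplus>\<^bsub>M\<^esub>j\<in>{..<length fs}. fs ! j \<odot>\<^bsub>M\<^esub> g j)"
      using x by (auto simp: list_mult_module_def)
    have "a \<odot>\<^bsub>M\<^esub> x = (\<Oplus>\<^bsub>M\<^esub>j\<in>{..<length fs}. a \<odot>\<^bsub>M\<^esub> (fs ! j \<odot>\<^bsub>M\<^esub> g j))"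
      unfolding g(2) using g(1) fj a by (intro finsum_smult_ldistr) auto
    also have "\<dots> = (\<Oplus>\<^bsub>M\<^esub>j\<in>{..<length fs}. fs ! j \<odot>\<^bsub>M\<^esub> (a \<odot>\<^bsub>M\<^esub> g j))"
    proof (rule M.finsum_cong')
      fix j assume "j \<in> {..<length fs}"
      then have "fs ! j \<in> carrier R" "g j \<in> carrier M" using fj g by auto
      then show "a \<odot>\<^bsub>M\<^esub> (fs ! j \<odot>\<^bsub>M\<^esub> g j) = fs ! j \<odot>\<^bsub>M\<^esub> (a \<odot>\<^bsub>M\<^esub> g j)"
        using a by (simp add: smult_assoc1[symmetric] R.m_comm)
    qed (use fj g a in auto)
    finally show ?thesis using g(1) a by (auto simp: list_mult_module_def Pi_def)
  qed
  show ?thesis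
  proof (rule submoduleI[OF sub])
    have "(\<Oplus>\<^bsub>M\<^esub>j\<in>{..<length fs}. fs ! j \<odot>\<^bsub>M\<^esub> \<zero>\<^bsub>M\<^esub>) = (\<Oplus>\<^bsub>M\<^esub>j\<in>{..<length fs}. \<zero>\<^bsub>M\<^esub>)"
      using fj by (intro M.finsum_cong') auto
    then have "(\<Oplus>\<^bsub>M\<^esub>j\<in>{..<length fs}. fs ! j \<odot>\<^bsub>M\<^esub> \<zero>\<^bsub>M\<^esub>) = \<zero>\<^bsub>M\<^esub>" by (simp add: M.finsum_zero)
    then show "\<zero>\<^bsub>M\<^esub> \<in> ?L" unfolding list_mult_module_def
      by (intro CollectI exI[of _ "\<lambda>_. \<zero>\<^bsub>M\<^esub>"]) auto
    show "a \<oplus>\<^bsub>M\<^esub> b \<in> ?L" if ab: "a \<in> ?L" "b \<in> ?L" for a b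
    proof -
      obtain g h where g: "g \<in> {..<length fs} \<rightarrow> carrier M" "a = (\<Oplus>\<^bsub>M\<^esub>j\<in>{..<length fs}. fs ! j \<odot>\<^bsub>M\<^esub> g j)"
        and h: "h \<in> {..<length fs} \<rightarrow> carrier M" "b = (\<Oplus>\<^bsub>M\<^esub>j\<in>{..<length fs}. fs ! j \<odot>\<^bsub>M\<^esub> h j)"
        using ab by (auto simp: list_mult_module_def)
      have gh: "g j \<in> carrier M" "h j \<in> carrier M" if "j < length fs" for j
        using that g(1) h(1) by auto
      have "a \<oplus>\<^bsub>M\<^esub> b = (\<Oplus>\<^bsub>M\<^esub>j\<in>{..<length fs}. fs ! j \<odot>\<^bsub>M\<^esub> g j \<oplus>\<^bsub>M\<^esub> fs ! j \<odot>\<^bsub>M\<^esub> h j)"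
        unfolding g(2) h(2) by (intro M.finsum_addf[symmetric]) (simp_all add: fj gh)
      also have "\<dots> = (\<Oplus>\<^bsub>M\<^esub>j\<in>{..<length fs}. fs ! j \<odot>\<^bsub>M\<^esub> (g j \<oplus>\<^bsub>M\<^esub> h j))"
        by (intro M.finsum_cong') (simp_all add: fj gh smult_r_distr)
      finally show ?thesis unfolding list_mult_module_def
        by (intro CollectI exI[of _ "\<lambda>j. g j \<oplus>\<^bsub>M\<^esub> h j"]) (simp add: gh)
    qed
    show "\<ominus>\<^bsub>M\<^esub> a \<in> ?L" if "a \<in> ?L" for a
      using sm[of "\<ominus>\<^bsub>R\<^esub> \<one>\<^bsub>R\<^esub>" a] that sub by (auto simp: smult_l_minus)
  qed (use sm in auto)
qed


section \<open>The polynomial ring as a module over itself\<close>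

lemma mpoly_ring_simps:
  "carrier (mpoly_ring n) = polys_in {1..n}" "p \<otimes>\<^bsub>mpoly_ring n\<^esub> q = p * q"
  "p \<oplus>\<^bsub>mpoly_ring n\<^esub> q = p + q" "\<zero>\<^bsub>mpoly_ring n\<^esub> = 0" "\<one>\<^bsub>mpoly_ring n\<^esub> = 1"
  by (simp_all add: mpoly_ring_def)

lemma mpoly_module_simps:
  "carrier (mpoly_module n) = polys_in {1..n}" "p \<odot>\<^bsub>mpoly_module n\<^esub> q = p * q"
  "p \<oplus>\<^bsub>mpoly_module n\<^esub> q = p + q" "\<zero>\<^bsub>mpoly_module n\<^esub> = 0"
  by (simp_all add: mpoly_module_def)

lemma polys_in_zero [simp]: "0 \<in> polys_in V"
  by (simp add: polys_in_def)

lemma polys_in_uminus: "p \<in> polys_in V \<Longrightarrow> - p \<in> polys_in V"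
  using polys_in_diff[of 0 V p] by simp

lemma cring_mpoly_ring: "cring (mpoly_ring n)"
proof (rule cringI)
  show "abelian_group (mpoly_ring n)"
    by (rule abelian_groupI)
       (auto simp: mpoly_ring_simps polys_in_add algebra_simps intro!: bexI[of _ "- _"] polys_in_uminus)
  show "comm_monoid (mpoly_ring n)"
    by (rule comm_monoidI) (auto simp: mpoly_ring_simps polys_in_mult algebra_simps)
qed (auto simp: mpoly_ring_simps algebra_simps)

lemma module_mpoly_module: "Module.module (mpoly_ring n) (mpoly_module n)"
proof (rule Module.moduleI)
  show "abelian_group (mpoly_module n)"
    by (rule abelian_groupI)
       (auto simp: mpoly_module_simps polys_in_add algebra_simps intro!: bexI[of _ "- _"] polys_in_uminus)
qed (auto simp: mpoly_ring_simps mpoly_module_simps polys_in_mult algebra_simps cring_mpoly_ring)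

lemma uminus_mpoly_module: "p \<in> polys_in {1..n} \<Longrightarrow> \<ominus>\<^bsub>mpoly_module n\<^esub> p = - p"
proof -
  interpret Module.module "mpoly_ring n" "mpoly_module n" by (rule module_mpoly_module)
  show "p \<in> polys_in {1..n} \<Longrightarrow> \<ominus>\<^bsub>mpoly_module n\<^esub> p = - p"
    using M.minus_equality[of "- p" p] by (simp add: mpoly_module_simps polys_in_uminus)
qed

lemma finsum_mpoly_module:
  assumes "f \<in> A \<rightarrow> polys_in {1..n}"
  shows "(\<Oplus>\<^bsub>mpoly_module n\<^esub>i\<in>A. f i) = sum f A"
proof -
  interpret Module.module "mpoly_ring n" "mpoly_module n" by (rule module_mpoly_module)
  show ?thesis
    using assms
  proof (induction A rule: infinite_finite_induct)
    case (insert x F)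
    then have "(\<Oplus>\<^bsub>mpoly_module n\<^esub>i\<in>insert x F. f i) = f x \<oplus>\<^bsub>mpoly_module n\<^esub> (\<Oplus>\<^bsub>mpoly_module n\<^esub>i\<in>F. f i)"
      by (intro M.finsum_insert) (auto simp: mpoly_module_simps)
    then show ?case using insert by (simp add: mpoly_module_simps Pi_def)
  qed (simp_all add: mpoly_module_simps M.add.finprod_infinite)
qed

lemma ideal_mpoly_sum:
  assumes "ideal J (mpoly_ring n)" "\<And>i. i \<in> A \<Longrightarrow> f i \<in> J"
  shows "sum f A \<in> J"
proof -
  interpret ideal J "mpoly_ring n" by fact
  show ?thesis
    using assms(2)
  proof (induction A rule: infinite_finite_induct)
    case (insert x F)
    then show ?case using additive_subgroup.a_closed[OF ideal.axioms(1)[OF assms(1)], of "f x" "sum f F"] by (simp add: mpoly_ring_simps)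
  qed (use additive_subgroup.zero_closed[OF ideal.axioms(1)[OF assms(1)]] in \<open>simp_all add: mpoly_ring_simps\<close>)
qed

lemma submodule_nonfaces: "submodule (nonfaces {1..n} \<F>) (mpoly_ring n) (mpoly_module n)"
proof -
  interpret Module.module "mpoly_ring n" "mpoly_module n" by (rule module_mpoly_module)
  show ?thesis
  proof (rule submoduleI)
    show "\<zero>\<^bsub>mpoly_module n\<^esub> \<in> nonfaces {1..n} \<F>" by (simp add: mpoly_module_simps nonfaces_def)
    show "nonfaces {1..n} \<F> \<subseteq> carrier (mpoly_module n)" by (simp add: mpoly_module_simps nonfaces_subset)
    show "\<ominus>\<^bsub>mpoly_module n\<^esub> a \<in> nonfaces {1..n} \<F>" if "a \<in> nonfaces {1..n} \<F>" for a
      using that nonfaces_diff[of 0 "{1..n}" \<F> a] nonfaces_subset[of "{1..n}" \<F>]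
      by (auto simp: uminus_mpoly_module nonfaces_def)
  qed (auto simp: mpoly_module_simps mpoly_ring_simps nonfaces_mult, auto simp: nonfaces_def monomial_span_add)
qed

lemma nonfaces_mult_right: "q \<in> nonfaces V \<F> \<Longrightarrow> p \<in> polys_in V \<Longrightarrow> q * p \<in> nonfaces V \<F>"
  using nonfaces_mult[of p V q \<F>] by (simp add: mult.commute)

lemma ideal_nonfaces: "ideal (nonfaces {1..n} \<F> :: 'k::field mpoly set) (mpoly_ring n)"
proof (rule idealI)
  interpret cring "mpoly_ring n :: 'k mpoly ring" by (rule cring_mpoly_ring)
  let ?J = "nonfaces {1..n} \<F> :: 'k mpoly set"
  show "ring (mpoly_ring n :: 'k mpoly ring)" by (rule ring_axioms)
  have "\<ominus>\<^bsub>mpoly_ring n\<^esub> a \<in> ?J" if a: "a \<in> ?J" for a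
  proof -
    have "a \<in> polys_in {1..n}" using a nonfaces_subset by blast
    then have "\<ominus>\<^bsub>mpoly_ring n\<^esub> a = - a"
      using minus_equality[of "- a" a] by (simp add: mpoly_ring_simps polys_in_uminus)
    moreover have "- a \<in> ?J"
      using nonfaces_diff[OF _ a, of 0] by (simp add: nonfaces_def)
    ultimately show ?thesis by simp
  qed
  moreover have "0 \<in> ?J" by (simp add: nonfaces_def)
  moreover have "a + b \<in> ?J" if "a \<in> ?J" "b \<in> ?J" for a b
    using that by (simp add: nonfaces_def monomial_span_add)
  ultimately show "subgroup ?J (add_monoid (mpoly_ring n))"
    by (intro add.subgroupI) (auto simp: mpoly_ring_simps nonfaces_subset[THEN subsetD])
qed (simp_all add: mpoly_ring_simps nonfaces_mult nonfaces_mult_right)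

lemma prod_mvar: "finite \<sigma> \<Longrightarrow> (\<Prod>i\<in>\<sigma>. mvar i) = Poly_Mapping.single (indicator_monomial \<sigma>) 1"
  by (induction \<sigma> rule: finite_induct) (auto simp: indicator_monomial_def mvar_def mult_single)

text \<open>The span of the nonface monomials is an ideal that contains the generators; conversely
  each nonface monomial is a multiple of the squarefree monomial of its support.\<close>

lemma stanley_reisner_ideal_eq_nonfaces:
  "stanley_reisner_ideal n (complex_of \<F>) = (nonfaces {1..n} \<F> :: 'k::field mpoly set)"
proof (rule equalityI)
  interpret cring "mpoly_ring n :: 'k mpoly ring" by (rule cring_mpoly_ring)
  let ?G = "{(\<Prod>i\<in>\<sigma>. mvar i) | \<sigma>. \<sigma> \<subseteq> {1..n} \<and> \<sigma> \<notin> complex_of \<F>} :: 'k mpoly set"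
  have fin: "finite \<sigma>" if "\<sigma> \<subseteq> {1..n}" for \<sigma> using that finite_subset by blast
  have G: "?G \<subseteq> nonfaces {1..n} \<F>"
  proof
    fix p :: "'k mpoly" assume "p \<in> ?G"
    then obtain \<sigma> where \<sigma>: "p = (\<Prod>i\<in>\<sigma>. mvar i)" "\<sigma> \<subseteq> {1..n}" "\<sigma> \<notin> complex_of \<F>" by blast
    then have "\<forall>F\<in>\<F>. \<not> \<sigma> \<subseteq> F" by (simp add: complex_of_def)
    then show "p \<in> nonfaces {1..n} \<F>"
      using \<sigma> fin[OF \<sigma>(2)] by (simp add: prod_mvar nonfaces_def keys_indicator_monomial)
  qed
  show "stanley_reisner_ideal n (complex_of \<F>) \<subseteq> (nonfaces {1..n} \<F> :: 'k mpoly set)"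
    unfolding stanley_reisner_ideal_def by (rule genideal_minimal[OF ideal_nonfaces G])
  have sub: "?G \<subseteq> carrier (mpoly_ring n)"
    unfolding mpoly_ring_simps by (rule order_trans[OF G nonfaces_subset])
  note id = genideal_ideal[OF sub] genideal_self[OF sub]
  show "nonfaces {1..n} \<F> \<subseteq> (stanley_reisner_ideal n (complex_of \<F>) :: 'k mpoly set)"
  proof
    fix p :: "'k mpoly" assume p: "p \<in> nonfaces {1..n} \<F>"
    have "Poly_Mapping.single t (Poly_Mapping.lookup p t) \<in> Idl\<^bsub>mpoly_ring n\<^esub> ?G" if "t \<in> Poly_Mapping.keys p" for t
    proof -
      have t: "Poly_Mapping.keys t \<subseteq> {1..n}" "Poly_Mapping.keys t \<notin> complex_of \<F>"
        using p that by (auto simp: nonfaces_def monomial_span_def complex_of_def)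
      obtain s where s: "t = indicator_monomial (Poly_Mapping.keys t) + s"
        by (rule indicator_monomial_decomp[of "Poly_Mapping.keys t" t]) auto
      then have ts: "s + indicator_monomial (Poly_Mapping.keys t) = t" by (metis add.commute)
      have "Poly_Mapping.keys s \<subseteq> {1..n}" using s t(1) by (metis Un_subset_iff keys_plus_nat)
      moreover have "(\<Prod>i\<in>Poly_Mapping.keys t. mvar i) \<in> Idl\<^bsub>mpoly_ring n\<^esub> ?G"
        by (rule subsetD[OF id(2)]) (use t in blast)
      ultimately have "Poly_Mapping.single s (Poly_Mapping.lookup p t) * (\<Prod>i\<in>Poly_Mapping.keys t. mvar i)
          \<in> Idl\<^bsub>mpoly_ring n\<^esub> ?G"
        using ideal.I_l_closed[OF id(1), of "\<Prod>i\<in>Poly_Mapping.keys t. mvar i" "Poly_Mapping.single s (Poly_Mapping.lookup p t)"]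
        by (simp add: mpoly_ring_simps)
      moreover have "Poly_Mapping.single s (Poly_Mapping.lookup p t) * (\<Prod>i\<in>Poly_Mapping.keys t. mvar i)
          = Poly_Mapping.single t (Poly_Mapping.lookup p t)"
        by (simp add: prod_mvar mult_single ts)
      ultimately show ?thesis by simp
    qed
    then have "(\<Sum>t\<in>Poly_Mapping.keys p. Poly_Mapping.single t (Poly_Mapping.lookup p t)) \<in> Idl\<^bsub>mpoly_ring n\<^esub> ?G"
      by (rule ideal_mpoly_sum[OF id(1)])
    then show "p \<in> stanley_reisner_ideal n (complex_of \<F>)"
      by (simp add: sum_monomials stanley_reisner_ideal_def)
  qed
qed

lemma linear_form_in_max_homog_ideal: "linear_form {1..n} c \<in> max_homog_ideal n"
proof -
  interpret cring "mpoly_ring n" by (rule cring_mpoly_ring)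
  have sub: "mvar ` {1..n} \<subseteq> carrier (mpoly_ring n)" by (auto simp: mpoly_ring_simps mvar_def)
  note id = genideal_ideal[OF sub]
  show ?thesis
    unfolding linear_form_def max_homog_ideal_def
  proof (rule ideal_mpoly_sum[OF id])
    fix u assume u: "u \<in> {1..n}"
    have "Poly_Mapping.single 0 (c u) \<otimes>\<^bsub>mpoly_ring n\<^esub> mvar u \<in> Idl\<^bsub>mpoly_ring n\<^esub> (mvar ` {1..n})"
      using u genideal_self[OF sub] by (intro ideal.I_l_closed[OF id]) (auto simp: mpoly_ring_simps)
    then show "Poly_Mapping.single (Poly_Mapping.single u 1) (c u) \<in> Idl\<^bsub>mpoly_ring n\<^esub> (mvar ` {1..n})"
      by (simp add: mpoly_ring_simps mvar_def mult_single)
  qed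
qed

section \<open>Face rings\<close>

lemma lookup_multidegree: "Poly_Mapping.lookup (multidegree t) v = int (Poly_Mapping.lookup t v)"
  by (simp add: multidegree_def Poly_Mapping.map.rep_eq when_def)

lemma multidegree_inj: "multidegree s = multidegree t \<longleftrightarrow> s = t"
  by (auto simp: poly_mapping_eq_iff fun_eq_iff lookup_multidegree)

lemma multidegree_add: "multidegree (s + t) = multidegree s + multidegree t"
  by (rule poly_mapping_eqI) (simp add: lookup_multidegree lookup_add)

lemma keys_multidegree: "Poly_Mapping.keys (multidegree t) = Poly_Mapping.keys t"
  by (auto simp: in_keys_iff lookup_multidegree)

text \<open>With at least one facet the constant 1 stays outside \<open>I\<close>; the last
  condition of \<open>regular_sequence\<close> depends on this.\<close>

locale face_ring_facets =
  fixes n :: nat and \<F> :: "nat set set" and I :: "'k::field mpoly set"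
  assumes facets_sub: "F \<in> \<F> \<Longrightarrow> F \<subseteq> {1..n}" and facets_nonempty: "\<F> \<noteq> {}"
  defines "I \<equiv> nonfaces {1..n} \<F>"

sublocale face_ring_facets \<subseteq> quotient_module "mpoly_ring n :: 'k mpoly ring" "mpoly_module n" I
  unfolding I_def by (intro quotient_module.intro module_mpoly_module quotient_module_axioms.intro submodule_nonfaces)

context face_ring_facets
begin

lemma face_ring_eq: "face_ring n (complex_of \<F>) = Q"
  by (simp add: face_ring_def stanley_reisner_ideal_eq_nonfaces I_def)

definition is_face :: "(nat \<Rightarrow>\<^sub>0 nat) \<Rightarrow> bool" where
  "is_face t \<longleftrightarrow> (\<exists>F\<in>\<F>. Poly_Mapping.keys t \<subseteq> F)"

lemma is_face_keys: "is_face t \<Longrightarrow> Poly_Mapping.keys t \<subseteq> {1..n}"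
  using facets_sub by (auto simp: is_face_def)

lemma mem_I_iff:
  assumes "p \<in> polys_in {1..n}"
  shows "p \<in> I \<longleftrightarrow> (\<forall>t. is_face t \<longrightarrow> Poly_Mapping.lookup p t = 0)"
proof -
  have "p \<in> I \<longleftrightarrow> (\<forall>t\<in>Poly_Mapping.keys p. Poly_Mapping.keys t \<subseteq> {1..n} \<and> \<not> is_face t)"
    by (simp add: I_def nonfaces_def monomial_span_def is_face_def)
  moreover have "\<forall>t\<in>Poly_Mapping.keys p. Poly_Mapping.keys t \<subseteq> {1..n}"
    using assms by (simp add: polys_in_def)
  ultimately show ?thesis by (auto simp: in_keys_iff)
qed

lemma cl_eq_iff_lookup:
  assumes "p \<in> polys_in {1..n}" "q \<in> polys_in {1..n}"
  shows "cl p = cl q \<longleftrightarrow> (\<forall>t. is_face t \<longrightarrow> Poly_Mapping.lookup p t = Poly_Mapping.lookup q t)"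
  using assms
  by (simp add: cl_eq_iff mpoly_module_simps uminus_mpoly_module mem_I_iff polys_in_diff lookup_minus)

lemma carrier_Q_poly: "carrier Q = cl ` polys_in {1..n}"
  by (simp add: carrier_Q mpoly_module_simps)

text \<open>Only for a face monomial \<open>t\<close> is the value independent of the chosen representative.\<close>

definition face_coeff :: "'k mpoly set \<Rightarrow> (nat \<Rightarrow>\<^sub>0 nat) \<Rightarrow> 'k" where
  "face_coeff Y t = Poly_Mapping.lookup (SOME p. p \<in> polys_in {1..n} \<and> Y = cl p) t"

lemma face_coeff_cl:
  assumes "p \<in> polys_in {1..n}" "is_face t"
  shows "face_coeff (cl p) t = Poly_Mapping.lookup p t"
proof -
  define q where "q = (SOME q. q \<in> polys_in {1..n} \<and> cl p = cl q)"
  have "q \<in> polys_in {1..n} \<and> cl p = cl q"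
    unfolding q_def by (rule someI[of _ p]) (use assms in simp)
  then have "Poly_Mapping.lookup p t = Poly_Mapping.lookup q t"
    using assms cl_eq_iff_lookup[of p q] by blast
  then show ?thesis unfolding face_coeff_def q_def by (rule sym)
qed

text \<open>The face monomials form a basis of the face ring, so comparing coefficients replaces
  reasoning with representatives.\<close>

lemma face_coeff_ext:
  assumes "Y \<in> carrier Q" "Z \<in> carrier Q" "\<And>t. is_face t \<Longrightarrow> face_coeff Y t = face_coeff Z t"
  shows "Y = Z"
proof -
  obtain p q where "p \<in> polys_in {1..n}" "q \<in> polys_in {1..n}" "Y = cl p" "Z = cl q"
    using assms(1,2) by (auto simp: carrier_Q_poly)
  then show ?thesis using assms(3) by (simp add: cl_eq_iff_lookup face_coeff_cl)
qed

lemma face_coeff_zero: "is_face t \<Longrightarrow> face_coeff \<zero>\<^bsub>Q\<^esub> t = 0"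
  using face_coeff_cl[of 0 t] cl_zero by (simp add: zero_Q mpoly_module_simps)

lemma face_coeff_finsum:
  assumes "f \<in> A \<rightarrow> carrier Q" "is_face t"
  shows "face_coeff (\<Oplus>\<^bsub>Q\<^esub>i\<in>A. f i) t = (\<Sum>i\<in>A. face_coeff (f i) t)"
proof -
  have "\<exists>q. \<forall>i\<in>A. q i \<in> polys_in {1..n} \<and> f i = cl (q i)"
    using assms(1) by (intro bchoice) (auto simp: carrier_Q_poly Pi_def)
  then obtain q where q: "\<And>i. i \<in> A \<Longrightarrow> q i \<in> polys_in {1..n}" "\<And>i. i \<in> A \<Longrightarrow> f i = cl (q i)" by blast
  interpret Q: Module.module "mpoly_ring n" Q by (rule module_Q)
  have "(\<Oplus>\<^bsub>Q\<^esub>i\<in>A. f i) = (\<Oplus>\<^bsub>Q\<^esub>i\<in>A. cl (q i))"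
    using q by (intro Q.finsum_cong') (simp_all add: carrier_Q_poly)
  also have "\<dots> = cl (\<Oplus>\<^bsub>mpoly_module n\<^esub>i\<in>A. q i)"
    using q by (intro finsum_Q) (simp add: mpoly_module_simps)
  also have "(\<Oplus>\<^bsub>mpoly_module n\<^esub>i\<in>A. q i) = sum q A"
    using q by (intro finsum_mpoly_module) simp
  finally show ?thesis
    using q assms(2) by (simp add: face_coeff_cl polys_in_sum lookup_sum)
qed

subsection \<open>Depth\<close>

text \<open>This carries the submodule generated by a sequence from cosets back to polynomials,
  where \<open>wreg_nth\<close> applies.\<close>

lemma mem_list_mult_module_iff:
  assumes as: "set as \<subseteq> polys_in {1..n}" and p: "p \<in> polys_in {1..n}"
  shows "cl p \<in> list_mult_module Q as \<longleftrightarrow>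
    (\<exists>q. (\<forall>j<length as. q j \<in> polys_in {1..n}) \<and> p - (\<Sum>j<length as. as ! j * q j) \<in> I)"
proof -
  interpret Q: Module.module "mpoly_ring n" Q by (rule module_Q)
  have asj: "as ! j \<in> polys_in {1..n}" if "j < length as" for j using that as by auto
  have sum: "(\<Oplus>\<^bsub>Q\<^esub>j\<in>{..<length as}. as ! j \<odot>\<^bsub>Q\<^esub> cl (q j)) = cl (\<Sum>j<length as. as ! j * q j)"
    if q: "\<forall>j<length as. q j \<in> polys_in {1..n}" for q
  proof -
    have "(\<Oplus>\<^bsub>Q\<^esub>j\<in>{..<length as}. as ! j \<odot>\<^bsub>Q\<^esub> cl (q j)) = (\<Oplus>\<^bsub>Q\<^esub>j\<in>{..<length as}. cl (as ! j * q j))"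
      using q asj by (intro Q.finsum_cong')
        (simp_all add: carrier_Q_poly polys_in_mult smult_Q mpoly_module_simps mpoly_ring_simps)
    also have "\<dots> = cl (\<Oplus>\<^bsub>mpoly_module n\<^esub>j\<in>{..<length as}. as ! j * q j)"
      using q asj by (intro finsum_Q) (simp add: mpoly_module_simps polys_in_mult)
    also have "(\<Oplus>\<^bsub>mpoly_module n\<^esub>j\<in>{..<length as}. as ! j * q j) = (\<Sum>j<length as. as ! j * q j)"
      using q asj by (intro finsum_mpoly_module) (simp add: polys_in_mult)
    finally show ?thesis .
  qed
  have eq: "cl p = cl (\<Sum>j<length as. as ! j * q j) \<longleftrightarrow> p - (\<Sum>j<length as. as ! j * q j) \<in> I"
    if q: "\<forall>j<length as. q j \<in> polys_in {1..n}" for q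
  proof -
    have "(\<Sum>j<length as. as ! j * q j) \<in> polys_in {1..n}"
      using q asj by (intro polys_in_sum polys_in_mult) auto
    then show ?thesis using p
      by (simp add: cl_eq_iff mpoly_module_simps uminus_mpoly_module)
  qed
  show ?thesis
  proof
    assume "cl p \<in> list_mult_module Q as"
    then obtain g where g: "g \<in> {..<length as} \<rightarrow> carrier Q" "cl p = (\<Oplus>\<^bsub>Q\<^esub>j\<in>{..<length as}. as ! j \<odot>\<^bsub>Q\<^esub> g j)"
      by (auto simp: list_mult_module_def)
    have "\<exists>q. \<forall>j\<in>{..<length as}. q j \<in> polys_in {1..n} \<and> g j = cl (q j)"
      using g(1) by (intro bchoice) (auto simp: carrier_Q_poly Pi_def)
    then obtain q where q: "\<forall>j<length as. q j \<in> polys_in {1..n}" "\<And>j. j < length as \<Longrightarrow> g j = cl (q j)" by auto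
    have "cl p = (\<Oplus>\<^bsub>Q\<^esub>j\<in>{..<length as}. as ! j \<odot>\<^bsub>Q\<^esub> cl (q j))"
      unfolding g(2) using q asj by (intro Q.finsum_cong')
        (simp_all add: carrier_Q_poly polys_in_mult smult_Q mpoly_module_simps mpoly_ring_simps)
    then have "p - (\<Sum>j<length as. as ! j * q j) \<in> I" using sum[OF q(1)] eq[OF q(1)] by simp
    then show "\<exists>q. (\<forall>j<length as. q j \<in> polys_in {1..n}) \<and> p - (\<Sum>j<length as. as ! j * q j) \<in> I"
      using q(1) by blast
  next
    assume "\<exists>q. (\<forall>j<length as. q j \<in> polys_in {1..n}) \<and> p - (\<Sum>j<length as. as ! j * q j) \<in> I"
    then obtain q where q: "\<forall>j<length as. q j \<in> polys_in {1..n}" "p - (\<Sum>j<length as. as ! j * q j) \<in> I" by blast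
    then have "cl p = (\<Oplus>\<^bsub>Q\<^esub>j\<in>{..<length as}. as ! j \<odot>\<^bsub>Q\<^esub> cl (q j))"
      using sum[OF q(1)] eq[OF q(1)] by simp
    then show "cl p \<in> list_mult_module Q as"
      unfolding list_mult_module_def using q(1)
      by (intro CollectI exI[of _ "\<lambda>j. cl (q j)"]) (simp add: carrier_Q_poly)
  qed
qed

text \<open>Linear forms lie in the ideal of the variables and have no constant term; the latter
  keeps the class of 1 out of the submodule that they generate.\<close>

lemma length_le_depth:
  fixes as :: "'k mpoly list"
  assumes reg: "wreg as (polys_in {1..n}) I" and as: "set as \<subseteq> range (linear_form {1..n})"
  shows "enat (length as) \<le> depth n Q"
proof -
  have asS: "set as \<subseteq> polys_in {1..n}" using as by auto
  have "nonzerodivisor_on (quot_module Q (list_mult_module Q (take i as))) (as ! i)" if i: "i < length as" for i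
  proof -
    have asi: "set (take i as) \<subseteq> polys_in {1..n}" "as ! i \<in> polys_in {1..n}"
      using asS i set_take_subset[of i as] by auto
    interpret QL: quotient_module "mpoly_ring n" Q "list_mult_module Q (take i as)"
      by (intro quotient_module.intro quotient_module_axioms.intro module_Q submodule_list_mult_module)
        (use asi(1) in \<open>simp_all add: mpoly_ring_simps\<close>)
    have "Y \<in> list_mult_module Q (take i as)"
      if Y: "Y \<in> carrier Q" "as ! i \<odot>\<^bsub>Q\<^esub> Y \<in> list_mult_module Q (take i as)" for Y
    proof -
      obtain x where x: "x \<in> polys_in {1..n}" "Y = cl x" using Y(1) by (auto simp: carrier_Q_poly)
      have "cl (as ! i * x) \<in> list_mult_module Q (take i as)"
        using Y(2) x asi smult_Q[of "as ! i" x] by (simp add: mpoly_module_simps mpoly_ring_simps)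
      then obtain p where "\<forall>j<i. p j \<in> polys_in {1..n}" "as ! i * x - (\<Sum>j<i. as ! j * p j) \<in> I"
        using mem_list_mult_module_iff[OF asi(1) polys_in_mult[OF asi(2) x(1)]] i by auto
      then have "\<exists>q. (\<forall>j<i. q j \<in> polys_in {1..n}) \<and> x - (\<Sum>j<i. as ! j * q j) \<in> I"
        using i x(1) stable_polys_in[OF asS] stable_nonfaces[OF asS] unfolding I_def
        by (intro wreg_nth[OF reg[unfolded I_def]]) auto
      then show ?thesis using mem_list_mult_module_iff[OF asi(1) x(1)] i x(2) by simp
    qed
    then show ?thesis using QL.nonzerodivisor_Q_iff asi(2) by (simp add: mpoly_ring_simps)
  qed
  moreover have "list_mult_module Q as \<noteq> carrier Q"
  proof
    assume "list_mult_module Q as = carrier Q"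
    then have "cl 1 \<in> list_mult_module Q as" by (simp add: carrier_Q_poly)
    then obtain q where q: "\<forall>j<length as. q j \<in> polys_in {1..n}" "1 - (\<Sum>j<length as. as ! j * q j) \<in> I"
      using mem_list_mult_module_iff[OF asS polys_in_one] by blast
    \<comment> \<open>\<open>nonfaces {1..n} {{}}\<close> consists of the polynomials without
      constant term.\<close>
    have "as ! j * q j \<in> nonfaces {1..n} {{}}" if j: "j < length as" for j
    proof -
      obtain c where "as ! j = linear_form {1..n} c" using as j nth_mem by blast
      moreover have "linear_form {1..n} c \<in> nonfaces {1..n} {{}}"
        unfolding linear_form_def nonfaces_def by (intro monomial_span_sum monomial_span_single) auto
      ultimately show ?thesis using q(1) j by (simp add: nonfaces_mult_right)
    qed
    then have "(\<Sum>j<length as. as ! j * q j) \<in> nonfaces {1..n} {{}}"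
      unfolding nonfaces_def by (intro monomial_span_sum) auto
    moreover have "1 - (\<Sum>j<length as. as ! j * q j) \<in> nonfaces {1..n} {{}}"
    proof -
      have "I \<subseteq> nonfaces {1..n} {{}}"
        unfolding I_def using facets_nonempty by (intro nonfaces_refine) auto
      then show ?thesis using q(2) by blast
    qed
    ultimately have "(1 - (\<Sum>j<length as. as ! j * q j)) + (\<Sum>j<length as. as ! j * q j) \<in> (nonfaces {1..n} {{}} :: 'k mpoly set)"
      unfolding nonfaces_def by (intro monomial_span_add)
    then show False by (simp add: nonfaces_def monomial_span_def)
  qed
  ultimately have "regular_sequence Q as" by (simp add: regular_sequence_def)
  moreover have "set as \<subseteq> max_homog_ideal n" using as linear_form_in_max_homog_ideal by auto
  ultimately show ?thesis unfolding depth_def by (intro SUP_upper) simp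
qed

subsection \<open>Grading\<close>

definition gr :: "(nat \<Rightarrow>\<^sub>0 int) \<Rightarrow> 'k mpoly set set" where
  "gr a = cl ` mpoly_grading n a"

lemma face_ring_grading_eq: "face_ring_grading n (complex_of \<F>) = gr"
  by (rule ext) (simp add: face_ring_grading_def quot_grading_def gr_def stanley_reisner_ideal_eq_nonfaces I_def)

lemma mpoly_grading_subset: "p \<in> mpoly_grading n a \<Longrightarrow> p \<in> polys_in {1..n}"
  by (simp add: mpoly_grading_def)

lemma gr_subset: "gr a \<subseteq> carrier Q"
  using mpoly_grading_subset by (auto simp: gr_def carrier_Q_poly)

lemma face_coeff_gr:
  assumes "Y \<in> gr a" "is_face t" "multidegree t \<noteq> a"
  shows "face_coeff Y t = 0"
proof -
  obtain p where p: "p \<in> mpoly_grading n a" "Y = cl p" using assms(1) by (auto simp: gr_def)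
  then have "t \<notin> Poly_Mapping.keys p" using assms(3) by (auto simp: mpoly_grading_def)
  then show ?thesis using p mpoly_grading_subset[OF p(1)] assms(2) by (simp add: face_coeff_cl in_keys_iff)
qed

lemma subgroup_gr: "subgroup (gr a) (add_monoid Q)"
proof -
  interpret Q: Module.module "mpoly_ring n" Q by (rule module_Q)
  have 1: "\<ominus>\<^bsub>Q\<^esub> Y \<in> gr a" if Y: "Y \<in> gr a" for Y
  proof -
    obtain p where p: "p \<in> mpoly_grading n a" "Y = cl p" using Y by (auto simp: gr_def)
    then have ps: "p \<in> polys_in {1..n}" "- p \<in> polys_in {1..n}" using mpoly_grading_subset[OF p(1)] polys_in_uminus[of p] by auto
    then have "cl (- p) \<oplus>\<^bsub>Q\<^esub> Y = \<zero>\<^bsub>Q\<^esub>"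
      using add_Q[of "- p" p] cl_zero by (simp add: p(2) mpoly_module_simps zero_Q)
    then have "\<ominus>\<^bsub>Q\<^esub> Y = cl (- p)"
      using ps p(2) by (intro Q.minus_equality) (auto simp: carrier_Q_poly)
    moreover have "- p \<in> mpoly_grading n a"
      using p(1) ps by (auto simp: mpoly_grading_def in_keys_iff)
    ultimately show ?thesis by (simp add: gr_def)
  qed
  have 2: "Y \<oplus>\<^bsub>Q\<^esub> Z \<in> gr a" if YZ: "Y \<in> gr a" "Z \<in> gr a" for Y Z
  proof -
    obtain p q where p: "p \<in> mpoly_grading n a" "Y = cl p" "q \<in> mpoly_grading n a" "Z = cl q"
      using YZ by (auto simp: gr_def)
    then have "Y \<oplus>\<^bsub>Q\<^esub> Z = cl (p + q)"
      using add_Q[of p q] mpoly_grading_subset[OF p(1)] mpoly_grading_subset[OF p(3)]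
      by (simp add: mpoly_module_simps)
    moreover have "p + q \<in> mpoly_grading n a"
      using p keys_add[of p q] polys_in_add[of p "{1..n}" q] by (auto simp: mpoly_grading_def)
    ultimately show ?thesis by (simp add: gr_def)
  qed
  have "cl 0 \<in> gr a" by (auto simp: gr_def mpoly_grading_def)
  then have "gr a \<noteq> {}" by blast
  then show ?thesis
    using gr_subset 1 2 by (intro Q.add.subgroupI) (simp_all add: a_inv_def)
qed

lemma is_face_multidegree: "is_face t \<Longrightarrow> multidegree t \<in> multidegrees n"
  using is_face_keys[of t] by (auto simp: multidegrees_def keys_multidegree)

lemma internal_direct_sum_gr: "internal_direct_sum Q (multidegrees n) gr"
  unfolding internal_direct_sum_def
proof (intro conjI ballI subgroup_gr)
  interpret Q: Module.module "mpoly_ring n" Q by (rule module_Q)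
  fix Y assume Y: "Y \<in> carrier Q"
  let ?P = "\<lambda>f. f \<in> (\<Pi>\<^sub>E a\<in>multidegrees n. gr a) \<and> finite {a \<in> multidegrees n. f a \<noteq> \<zero>\<^bsub>Q\<^esub>} \<and>
      Y = (\<Oplus>\<^bsub>Q\<^esub>a\<in>{a \<in> multidegrees n. f a \<noteq> \<zero>\<^bsub>Q\<^esub>}. f a)"
  \<comment> \<open>The coefficient at \<open>t\<close> sees only the summand in the degree of
    \<open>t\<close>. This gives both existence and uniqueness of the decomposition.\<close>
  have coeff: "face_coeff (\<Oplus>\<^bsub>Q\<^esub>a\<in>A. f a) t = face_coeff (f (multidegree t)) t"
    if f: "f \<in> (\<Pi>\<^sub>E a\<in>multidegrees n. gr a)" and A: "A = {a \<in> multidegrees n. f a \<noteq> \<zero>\<^bsub>Q\<^esub>}" "finite A"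
      and t: "is_face t" for f t A
  proof -
    have fa: "f a \<in> gr a" if "a \<in> multidegrees n" for a using f that by auto
    have "face_coeff (\<Oplus>\<^bsub>Q\<^esub>a\<in>A. f a) t = (\<Sum>a\<in>A. face_coeff (f a) t)"
      using fa gr_subset A(1) t by (intro face_coeff_finsum) auto
    also have "\<dots> = (\<Sum>a\<in>A. if a = multidegree t then face_coeff (f a) t else 0)"
    proof (rule sum.cong[OF refl])
      fix a assume "a \<in> A"
      then show "face_coeff (f a) t = (if a = multidegree t then face_coeff (f a) t else 0)"
        using face_coeff_gr[OF fa t, of a] A(1) by auto
    qed
    also have "\<dots> = (if multidegree t \<in> A then face_coeff (f (multidegree t)) t else 0)"
      using A(2) by simp
    also have "\<dots> = face_coeff (f (multidegree t)) t"
      using is_face_multidegree[OF t] face_coeff_zero[OF t] A(1) by auto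
    finally show ?thesis .
  qed
  obtain p where p: "p \<in> polys_in {1..n}" "Y = cl p" using Y by (auto simp: carrier_Q_poly)
  \<comment> \<open>The component of degree \<open>a\<close> is the class of the part of
    \<open>p\<close> in that degree.\<close>
  define f where "f = restrict (\<lambda>a. cl (proj (\<lambda>t. multidegree t = a) p)) (multidegrees n)"
  have projS: "proj (\<lambda>t. multidegree t = a) p \<in> polys_in {1..n}" for a
    using p(1) unfolding polys_in_conv_span by (rule monomial_span_mono[OF proj_in_span]) simp
  have f_PiE: "f \<in> (\<Pi>\<^sub>E a\<in>multidegrees n. gr a)"
  proof -
    have "proj (\<lambda>t. multidegree t = a) p \<in> mpoly_grading n a" for a
      using projS[of a] by (auto simp: mpoly_grading_def in_keys_iff lookup_proj split: if_splits)
    then show ?thesis by (auto simp: f_def gr_def)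
  qed
  have fin: "finite {a \<in> multidegrees n. f a \<noteq> \<zero>\<^bsub>Q\<^esub>}"
  proof (rule finite_subset)
    show "{a \<in> multidegrees n. f a \<noteq> \<zero>\<^bsub>Q\<^esub>} \<subseteq> multidegree ` Poly_Mapping.keys p"
    proof (rule subsetI, rule ccontr)
      fix a assume a: "a \<in> {a \<in> multidegrees n. f a \<noteq> \<zero>\<^bsub>Q\<^esub>}" "a \<notin> multidegree ` Poly_Mapping.keys p"
      then have "proj (\<lambda>t. multidegree t = a) p = 0"
        by (intro poly_mapping_eqI) (auto simp: lookup_proj in_keys_iff)
      then show False using a(1) cl_zero by (auto simp: f_def zero_Q mpoly_module_simps split: if_splits)
    qed
  qed simp
  have "Y = (\<Oplus>\<^bsub>Q\<^esub>a\<in>{a \<in> multidegrees n. f a \<noteq> \<zero>\<^bsub>Q\<^esub>}. f a)"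
  proof (rule face_coeff_ext[OF Y])
    show "(\<Oplus>\<^bsub>Q\<^esub>a\<in>{a \<in> multidegrees n. f a \<noteq> \<zero>\<^bsub>Q\<^esub>}. f a) \<in> carrier Q"
      using f_PiE gr_subset by (intro Q.finsum_closed) auto
    fix t assume t: "is_face t"
    show "face_coeff Y t = face_coeff (\<Oplus>\<^bsub>Q\<^esub>a\<in>{a \<in> multidegrees n. f a \<noteq> \<zero>\<^bsub>Q\<^esub>}. f a) t"
      using coeff[OF f_PiE refl fin t] is_face_multidegree[OF t] p projS t
      by (simp add: f_def face_coeff_cl lookup_proj)
  qed
  then have ex: "?P f" using f_PiE fin by blast
  show "\<exists>!f. ?P f"
  proof (rule ex1I[of ?P f])
    show "?P f" by (rule ex)
    fix g assume g: "?P g"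
    have eq: "face_coeff (g a) t = face_coeff (f a) t" if a: "a \<in> multidegrees n" and t: "is_face t" for a t
    proof (cases "multidegree t = a")
      case True
      have "face_coeff (g a) t = face_coeff Y t"
        using coeff[of g, OF _ refl _ t] g True by (metis (no_types, lifting))
      moreover have "face_coeff (f a) t = face_coeff Y t"
        using coeff[of f, OF _ refl _ t] ex True by (metis (no_types, lifting))
      ultimately show ?thesis by simp
    next
      case False
      have "g a \<in> gr a" "f a \<in> gr a" using g f_PiE a by auto
      then show ?thesis using face_coeff_gr t False by simp
    qed
    show "g = f"
    proof (rule PiE_ext[of g "multidegrees n" gr f])
      fix a assume a: "a \<in> multidegrees n"
      have "g a \<in> carrier Q" "f a \<in> carrier Q" using g f_PiE a gr_subset by auto
      then show "g a = f a" using eq[OF a] by (rule face_coeff_ext)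
    qed (use g f_PiE in auto)
  qed
qed

lemma graded_module_Q: "graded_module n Q gr"
  unfolding graded_module_def
proof (intro conjI ballI module_Q internal_direct_sum_gr)
  fix a b Y and p :: "'k mpoly" assume p: "p \<in> mpoly_grading n a" and Y: "Y \<in> gr b"
  obtain q where q: "q \<in> mpoly_grading n b" "Y = cl q" using Y by (auto simp: gr_def)
  note S = mpoly_grading_subset[OF p] mpoly_grading_subset[OF q(1)]
  have "multidegree t = a + b" if t: "t \<in> Poly_Mapping.keys (p * q)" for t
  proof -
    obtain s s' where "t = s + s'" "s \<in> Poly_Mapping.keys p" "s' \<in> Poly_Mapping.keys q"
      using t keys_mult[of p q] by blast
    then show ?thesis using p q(1) by (simp add: mpoly_grading_def multidegree_add)
  qed
  then have "p * q \<in> mpoly_grading n (a + b)"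
    using S by (simp add: mpoly_grading_def polys_in_mult)
  moreover have "p \<odot>\<^bsub>Q\<^esub> Y = cl (p * q)"
    using S smult_Q[of p q] q(2) by (simp add: mpoly_module_simps mpoly_ring_simps)
  ultimately show "p \<odot>\<^bsub>Q\<^esub> Y \<in> gr (a + b)" by (simp add: gr_def)
qed

lemma finitely_generated_Q: "finitely_generated n Q"
  unfolding finitely_generated_def
proof (intro exI[of _ "{cl 1}"] conjI ballI)
  interpret Q: Module.module "mpoly_ring n" Q by (rule module_Q)
  show "{cl 1} \<subseteq> carrier Q" by (simp add: carrier_Q_poly)
  fix Y assume "Y \<in> carrier Q"
  then obtain p where p: "p \<in> polys_in {1..n}" "Y = cl p" by (auto simp: carrier_Q_poly)
  have "p \<odot>\<^bsub>Q\<^esub> cl 1 = Y" using smult_Q[of p 1] p by (simp add: mpoly_module_simps mpoly_ring_simps)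
  moreover have "Y \<in> carrier Q" by fact
  ultimately have "(\<Oplus>\<^bsub>Q\<^esub>b\<in>{cl 1}. p \<odot>\<^bsub>Q\<^esub> b) = Y"
    by (subst Q.finsum_insert) auto
  then show "\<exists>c\<in>{cl 1} \<rightarrow> carrier (mpoly_ring n). Y = (\<Oplus>\<^bsub>Q\<^esub>b\<in>{cl 1}. c b \<odot>\<^bsub>Q\<^esub> b)"
    using p(1) by (intro bexI[of _ "\<lambda>_. p"]) (auto simp: mpoly_ring_simps)
qed simp

subsection \<open>Stanley depth\<close>

text \<open>A divisor \<open>a\<close> of a squarefree monomial is squarefree, so it divides every
  squarefree monomial whose support contains that of \<open>a\<close>.\<close>

lemma indicator_monomial_split:
  assumes F: "indicator_monomial F = a + s" "finite F" and \<sigma>: "finite \<sigma>" "Poly_Mapping.keys a \<subseteq> \<sigma>"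
  shows "\<exists>s. indicator_monomial \<sigma> = a + s \<and> Poly_Mapping.keys s \<subseteq> \<sigma>"
proof (intro exI conjI)
  have "Poly_Mapping.lookup a v \<le> 1" for v
    using arg_cong[OF F(1), of "\<lambda>m. Poly_Mapping.lookup m v"] F(2)
    by (simp add: lookup_indicator_monomial lookup_add split: if_splits)
  moreover have "Poly_Mapping.lookup a v = 0" if "v \<notin> \<sigma>" for v
    using that \<sigma>(2) by (auto simp: in_keys_iff)
  ultimately show "indicator_monomial \<sigma> = a + (indicator_monomial \<sigma> - a)"
    using \<sigma>(1) by (intro poly_mapping_eqI) (simp add: lookup_add lookup_minus lookup_indicator_monomial)
  show "Poly_Mapping.keys (indicator_monomial \<sigma> - a) \<subseteq> \<sigma>"
    using \<sigma>(1) by (auto simp: in_keys_iff lookup_minus lookup_indicator_monomial split: if_splits)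
qed

text \<open>A homogeneous element is the class of a scalar times one monomial. Freeness forbids the
  product of the variables in \<open>X i\<close> to kill it, so the support of that monomial
  together with \<open>X i\<close> is a face.\<close>

lemma stanley_summand:
  assumes dec: "stanley_decomposition n Q gr r X z" and i: "i < r"
  shows "\<exists>t c. z i = cl (Poly_Mapping.single t c) \<and> c \<noteq> 0 \<and> (\<exists>F\<in>\<F>. Poly_Mapping.keys t \<union> X i \<subseteq> F)"
proof -
  have X: "X i \<subseteq> {1..n}" "finite (X i)" and inj: "inj_on (\<lambda>p. p \<odot>\<^bsub>Q\<^esub> z i) (polys_in (X i))"
    using dec i finite_subset[of "X i" "{1..n}"] by (auto simp: stanley_decomposition_def)
  obtain a where "z i \<in> gr a" using dec i by (auto simp: stanley_decomposition_def)
  then obtain p where p: "p \<in> mpoly_grading n a" "z i = cl p" by (auto simp: gr_def)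
  note pS = mpoly_grading_subset[OF p(1)]
  \<comment> \<open>The product of all variables in \<open>X i\<close> is the element on which
    freeness is tested.\<close>
  define m where "m = Poly_Mapping.single (indicator_monomial (X i)) (1 :: 'k)"
  have keys: "Poly_Mapping.keys (indicator_monomial (X i)) = X i" using X(2) by (rule keys_indicator_monomial)
  have m: "m \<in> polys_in (X i)" "m \<noteq> 0"
  proof -
    show "m \<in> polys_in (X i)" by (simp add: m_def keys)
    show "m \<noteq> 0"
    proof
      assume "m = 0"
      then have "Poly_Mapping.lookup m (indicator_monomial (X i)) = 0" by simp
      then show False by (simp add: m_def)
    qed
  qed
  have mS: "m \<in> polys_in {1..n}" using m(1) polys_in_mono[OF X(1)] by blast
  have "m \<odot>\<^bsub>Q\<^esub> z i \<noteq> 0 \<odot>\<^bsub>Q\<^esub> z i"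
    using inj_onD[OF inj _ m(1) polys_in_zero] m(2) by blast
  then have "cl (m * p) \<noteq> cl (0 * p)"
    using smult_Q[of m p] smult_Q[of 0 p] mS pS by (simp add: p(2) mpoly_module_simps mpoly_ring_simps)
  then obtain u where u: "is_face u" "Poly_Mapping.lookup (m * p) u \<noteq> 0"
    using cl_eq_iff_lookup[of "m * p" 0] mS pS by (auto simp: polys_in_mult)
  then have "u \<in> Poly_Mapping.keys (m * p)" by (simp add: in_keys_iff)
  then obtain s where s: "u = indicator_monomial (X i) + s" "s \<in> Poly_Mapping.keys p"
    using keys_mult[of m p] by (auto simp: m_def)
  \<comment> \<open>A degree determines its monomial, so a homogeneous polynomial has at most one
    term.\<close>
  have "p = Poly_Mapping.single s (Poly_Mapping.lookup p s)"
  proof (rule poly_mapping_eqI)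
    fix t
    have "t = s" if "t \<in> Poly_Mapping.keys p"
      using that s(2) p(1) multidegree_inj[of t s] by (simp add: mpoly_grading_def)
    then show "Poly_Mapping.lookup p t = Poly_Mapping.lookup (Poly_Mapping.single s (Poly_Mapping.lookup p s)) t"
      by (auto simp: lookup_single when_def in_keys_iff)
  qed
  then have "z i = cl (Poly_Mapping.single s (Poly_Mapping.lookup p s))" using p(2) by simp
  moreover have "Poly_Mapping.lookup p s \<noteq> 0" using s(2) by (simp add: in_keys_iff)
  moreover have "\<exists>F\<in>\<F>. Poly_Mapping.keys s \<union> X i \<subseteq> F"
    using u(1) unfolding s(1) is_face_def keys_plus_nat keys by auto
  ultimately show ?thesis by blast
qed

text \<open>Restricting the decomposition to squarefree degrees partitions the complex into intervals.\<close>

lemma stanley_decomposition_partition: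
  assumes dec: "stanley_decomposition n Q gr r X z"
    and card: "\<And>F. F \<in> \<F> \<Longrightarrow> card F = d" and large: "\<And>i. i < r \<Longrightarrow> d \<le> card (X i)"
  shows "\<exists>\<rho>. \<forall>\<sigma>. (\<exists>F\<in>\<F>. \<sigma> \<subseteq> F) \<longrightarrow> (\<exists>!F. F \<in> \<F> \<and> \<rho> F \<subseteq> \<sigma> \<and> \<sigma> \<subseteq> F)"
proof -
  interpret Q: Module.module "mpoly_ring n" Q by (rule module_Q)
  have finF: "finite F" if "F \<in> \<F>" for F using facets_sub[OF that] finite_subset by blast
  have X: "X i \<subseteq> {1..n}" if "i < r" for i
    using dec that by (auto simp: stanley_decomposition_def)
  define t where "t i = (SOME t. \<exists>c. z i = cl (Poly_Mapping.single t c) \<and> c \<noteq> 0 \<and> (\<exists>F\<in>\<F>. Poly_Mapping.keys t \<union> X i \<subseteq> F))" for i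
  define c where "c i = (SOME c. z i = cl (Poly_Mapping.single (t i) c) \<and> c \<noteq> 0 \<and> (\<exists>F\<in>\<F>. Poly_Mapping.keys (t i) \<union> X i \<subseteq> F))" for i
  have tc: "z i = cl (Poly_Mapping.single (t i) (c i))" "c i \<noteq> 0"
    "\<exists>F\<in>\<F>. Poly_Mapping.keys (t i) \<union> X i \<subseteq> F" if "i < r" for i
    using someI_ex[OF someI_ex[OF stanley_summand[OF dec that]], folded t_def, folded c_def] by simp_all
  have XF: "X i \<in> \<F>" "Poly_Mapping.keys (t i) \<subseteq> X i" if i: "i < r" for i
  proof -
    obtain F where F: "F \<in> \<F>" "Poly_Mapping.keys (t i) \<union> X i \<subseteq> F" using tc(3)[OF i] by blast
    \<comment> \<open>\<open>X i\<close> has at least as many elements as the facet that contains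
      it.\<close>
    then have "X i = F"
      using finF[OF F(1)] card[OF F(1)] large[OF i] by (intro card_seteq) simp_all
    then show "X i \<in> \<F>" "Poly_Mapping.keys (t i) \<subseteq> X i" using F by auto
  qed
  have tS: "Poly_Mapping.single (t i) a \<in> polys_in {1..n}" if "i < r" for i and a :: 'k
    using XF(2)[OF that] X[OF that] by (intro polys_in_single) blast
  define N where "N i = (\<lambda>p. p \<odot>\<^bsub>Q\<^esub> z i) ` polys_in (X i)" for i
  have N_eq: "N i = (\<lambda>p. cl (p * Poly_Mapping.single (t i) (c i))) ` polys_in (X i)" if i: "i < r" for i
    unfolding N_def
  proof (rule image_cong[OF refl])
    fix p :: "'k mpoly" assume "p \<in> polys_in (X i)"
    then have "p \<in> polys_in {1..n}" using polys_in_mono[OF X[OF i]] by blast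
    then show "p \<odot>\<^bsub>Q\<^esub> z i = cl (p * Poly_Mapping.single (t i) (c i))"
      using smult_Q[of p] tS[OF i] tc(1)[OF i] by (simp add: mpoly_module_simps mpoly_ring_simps)
  qed
  define decomp where "decomp Y f \<longleftrightarrow> f \<in> (\<Pi>\<^sub>E i\<in>{..<r}. N i) \<and> finite {i\<in>{..<r}. f i \<noteq> \<zero>\<^bsub>Q\<^esub>} \<and>
        Y = (\<Oplus>\<^bsub>Q\<^esub>i\<in>{i\<in>{..<r}. f i \<noteq> \<zero>\<^bsub>Q\<^esub>}. f i)" for Y f
  have ids: "\<exists>!f. decomp Y f" if "Y \<in> carrier Q" for Y
  proof -
    have "internal_direct_sum Q {..<r} N"
      using dec unfolding stanley_decomposition_def N_def[abs_def] by (elim conjE)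
    then show ?thesis using that unfolding internal_direct_sum_def decomp_def by (elim conjE) (rule bspec)
  qed
  have N_sub: "N i \<subseteq> carrier Q" if "i < r" for i
  proof -
    have "p * Poly_Mapping.single (t i) (c i) \<in> polys_in {1..n}" if "p \<in> polys_in (X i)" for p
      using that tS[OF \<open>i < r\<close>] polys_in_mono[OF X[OF \<open>i < r\<close>]] by (intro polys_in_mult) blast+
    then show ?thesis unfolding N_eq[OF that] carrier_Q_poly by (intro image_subsetI imageI)
  qed
  have zero_N: "\<zero>\<^bsub>Q\<^esub> \<in> N i" if "i < r" for i
    unfolding N_eq[OF that] using cl_zero by (intro image_eqI[of _ _ 0]) (simp_all add: zero_Q mpoly_module_simps)
  \<comment> \<open>The class of the monomial \<open>u\<close> is a sum over the decomposition, so
    some summand has a nonzero coefficient at \<open>u\<close>; there \<open>u\<close> is a multiple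
    of \<open>t i\<close> by variables in \<open>X i\<close>.\<close>
  have exists: "\<exists>i<r. \<exists>s. u = t i + s \<and> Poly_Mapping.keys s \<subseteq> X i" if u: "is_face u" for u
  proof -
    have uS: "Poly_Mapping.single u 1 \<in> polys_in {1..n}" using is_face_keys[OF u] by simp
    define Y where "Y = cl (Poly_Mapping.single u 1)"
    have Y: "Y \<in> carrier Q" using uS by (auto simp: Y_def carrier_Q_poly)
    from ids[OF Y] obtain f where f: "f \<in> (\<Pi>\<^sub>E i\<in>{..<r}. N i)"
      "Y = (\<Oplus>\<^bsub>Q\<^esub>i\<in>{i\<in>{..<r}. f i \<noteq> \<zero>\<^bsub>Q\<^esub>}. f i)" 
      unfolding decomp_def by (elim ex1E conjE)
    have fN: "f i \<in> N i" if "i < r" for i using f(1) that by auto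
    have "(\<Sum>i\<in>{i\<in>{..<r}. f i \<noteq> \<zero>\<^bsub>Q\<^esub>}. face_coeff (f i) u) = face_coeff Y u"
      using fN N_sub u by (subst f(2), intro face_coeff_finsum[symmetric]) auto
    also have "\<dots> = 1" by (simp add: Y_def face_coeff_cl[OF uS u])
    finally have "(\<Sum>i\<in>{i\<in>{..<r}. f i \<noteq> \<zero>\<^bsub>Q\<^esub>}. face_coeff (f i) u) \<noteq> 0" by simp
    then obtain i where "i \<in> {i\<in>{..<r}. f i \<noteq> \<zero>\<^bsub>Q\<^esub>}" "face_coeff (f i) u \<noteq> 0"
      by (rule sum.not_neutral_contains_not_neutral)
    then have i: "i < r" "face_coeff (f i) u \<noteq> 0" by simp_all
    obtain p where p: "p \<in> polys_in (X i)" "f i = cl (p * Poly_Mapping.single (t i) (c i))"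
      using fN[OF i(1)] N_eq[OF i(1)] by blast
    have "p * Poly_Mapping.single (t i) (c i) \<in> polys_in {1..n}"
      using p(1) polys_in_mono[OF X[OF i(1)]] tS[OF i(1)] by (intro polys_in_mult) auto
    from face_coeff_cl[OF this u] have "u \<in> Poly_Mapping.keys (p * Poly_Mapping.single (t i) (c i))"
      using i(2) p(2) by (simp add: in_keys_iff)
    then obtain s where "u = s + t i" "s \<in> Poly_Mapping.keys p"
      using keys_mult[of p "Poly_Mapping.single (t i) (c i)"] tc(2)[OF i(1)] by auto
    then show ?thesis using i(1) p(1)
      by (intro exI[of _ i] conjI exI[of _ s]) (auto simp: add.commute polys_in_def)
  qed
  \<comment> \<open>Otherwise the class of \<open>u\<close> would lie in two summands and have two
    decompositions, each with a single nonzero component.\<close>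
  have unique: "i = j" if u: "is_face u" and i: "i < r" "u = t i + s" "Poly_Mapping.keys s \<subseteq> X i"
    and j: "j < r" "u = t j + s'" "Poly_Mapping.keys s' \<subseteq> X j" for u i j s s'
  proof (rule ccontr)
    assume "i \<noteq> j"
    have uS: "Poly_Mapping.single u 1 \<in> polys_in {1..n}" using is_face_keys[OF u] by simp
    define Y where "Y = cl (Poly_Mapping.single u 1)"
    have Y: "Y \<in> carrier Q" using uS by (auto simp: Y_def carrier_Q_poly)
    have "face_coeff Y u = 1" by (simp add: Y_def face_coeff_cl[OF uS u])
    then have Y0: "Y \<noteq> \<zero>\<^bsub>Q\<^esub>" using face_coeff_zero[OF u] by auto
    have YN: "Y \<in> N k" if "k < r" "u = t k + w" "Poly_Mapping.keys w \<subseteq> X k" for k w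
    proof -
      \<comment> \<open>The factor \<open>1 / c k\<close> cancels the scalar in the
        generator.\<close>
      have "Y = cl (Poly_Mapping.single w (1 / c k) * Poly_Mapping.single (t k) (c k))"
        using tc(2)[OF that(1)] that(2) by (simp add: Y_def mult_single add.commute)
      then show ?thesis unfolding N_eq[OF that(1)] using that(3) by (intro image_eqI) auto
    qed
    define h where "h k = restrict (\<lambda>l. if l = k then Y else \<zero>\<^bsub>Q\<^esub>) {..<r}" for k
    have h: "decomp Y (h k)" if k: "k < r" "Y \<in> N k" for k
    proof -
      have "{i\<in>{..<r}. h k i \<noteq> \<zero>\<^bsub>Q\<^esub>} = {k}" using k Y0 by (auto simp: h_def)
      moreover have "(\<Oplus>\<^bsub>Q\<^esub>i\<in>{k}. h k i) = Y"
        using k Y by (subst Q.finsum_insert) (simp_all add: h_def)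
      moreover have "h k \<in> (\<Pi>\<^sub>E i\<in>{..<r}. N i)"
        using k zero_N by (auto simp: h_def)
      ultimately show ?thesis by (simp add: decomp_def)
    qed
    obtain f where f: "\<forall>g. decomp Y g \<longrightarrow> g = f"
      using ids[OF Y] by (elim ex1E)
    have "h i = f" "h j = f"
      using spec[OF f, of "h i"] spec[OF f, of "h j"] h[OF i(1) YN[OF i]] h[OF j(1) YN[OF j]] by simp_all
    then have "h i i = h j i" by metis
    then show False using i(1) \<open>i \<noteq> j\<close> Y0 by (simp add: h_def)
  qed
  have ind_face: "is_face (indicator_monomial \<sigma>)" "finite \<sigma>" if "F \<in> \<F>" "\<sigma> \<subseteq> F" for F \<sigma>
  proof -
    show "finite \<sigma>" using finF that finite_subset by blast
    then show "is_face (indicator_monomial \<sigma>)" using that by (auto simp: is_face_def keys_indicator_monomial)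
  qed
  have ex_\<iota>: "\<exists>i. i < r \<and> X i = F \<and> (\<exists>s. indicator_monomial F = t i + s \<and> Poly_Mapping.keys s \<subseteq> X i)" if F: "F \<in> \<F>" for F
  proof -
    obtain i s where i: "i < r" "indicator_monomial F = t i + s" "Poly_Mapping.keys s \<subseteq> X i"
      using exists[OF ind_face(1)[OF F subset_refl]] by blast
    have "Poly_Mapping.keys (indicator_monomial F) \<subseteq> X i"
      unfolding i(2) keys_plus_nat using i(3) XF(2)[OF i(1)] by simp
    then have "F \<subseteq> X i" using finF[OF F] by (simp add: keys_indicator_monomial)
    then have "F = X i"
      using card[OF F] card[OF XF(1)[OF i(1)]] finF[OF XF(1)[OF i(1)]] by (simp add: card_subset_eq)
    then show ?thesis using i by blast
  qed
  \<comment> \<open>Several summands can share the set \<open>F\<close>, for instance with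
    generators that are not squarefree. The selected one is the summand containing the squarefree
    monomial of \<open>F\<close>.\<close>
  define \<iota> where "\<iota> F = (SOME i. i < r \<and> X i = F \<and>
    (\<exists>s. indicator_monomial F = t i + s \<and> Poly_Mapping.keys s \<subseteq> X i))" for F
  have \<iota>: "\<iota> F < r" "X (\<iota> F) = F"
    "\<exists>s. indicator_monomial F = t (\<iota> F) + s \<and> Poly_Mapping.keys s \<subseteq> X (\<iota> F)" if "F \<in> \<F>" for F
    using someI_ex[OF ex_\<iota>[OF that], folded \<iota>_def] by blast+
  have "\<exists>!F. F \<in> \<F> \<and> Poly_Mapping.keys (t (\<iota> F)) \<subseteq> \<sigma> \<and> \<sigma> \<subseteq> F" if G: "G \<in> \<F>" "\<sigma> \<subseteq> G" for \<sigma> G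
  proof -
    note face = ind_face[OF G]
    obtain i s where i: "i < r" "indicator_monomial \<sigma> = t i + s" "Poly_Mapping.keys s \<subseteq> X i"
      using exists[OF face(1)] by blast
    have keys_\<sigma>: "\<sigma> = Poly_Mapping.keys (t i) \<union> Poly_Mapping.keys s"
      using arg_cong[OF i(2), of Poly_Mapping.keys] face(2) by (simp add: keys_plus_nat keys_indicator_monomial)
    note F = XF(1)[OF i(1)]
    \<comment> \<open>\<open>t i\<close> divides the monomial of \<sigma>, hence also that of the
      facet \<open>X i\<close>, so the summand \<open>i\<close> is the selected one.\<close>
    have "\<iota> (X i) = i"
    proof -
      obtain s' where "indicator_monomial (X i) = t i + s'" "Poly_Mapping.keys s' \<subseteq> X i"
        using indicator_monomial_split[OF i(2) face(2) finF[OF F] XF(2)[OF i(1)]] by blast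
      moreover obtain s'' where "indicator_monomial (X i) = t (\<iota> (X i)) + s''" "Poly_Mapping.keys s'' \<subseteq> X (\<iota> (X i))"
        using \<iota>(3)[OF F] by blast
      ultimately show ?thesis
        using unique[OF ind_face(1)[OF F subset_refl] \<iota>(1)[OF F] _ _ i(1)] by blast
    qed
    then have ex: "X i \<in> \<F> \<and> Poly_Mapping.keys (t (\<iota> (X i))) \<subseteq> \<sigma> \<and> \<sigma> \<subseteq> X i"
      using F keys_\<sigma> i(3) XF(2)[OF i(1)] by auto
    show ?thesis
    proof (rule ex1I[of _ "X i"])
      show "X i \<in> \<F> \<and> Poly_Mapping.keys (t (\<iota> (X i))) \<subseteq> \<sigma> \<and> \<sigma> \<subseteq> X i" by (rule ex)
      fix F' assume F': "F' \<in> \<F> \<and> Poly_Mapping.keys (t (\<iota> F')) \<subseteq> \<sigma> \<and> \<sigma> \<subseteq> F'"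
      then obtain s' where s': "indicator_monomial F' = t (\<iota> F') + s'" using \<iota>(3) by blast
      \<comment> \<open>Conversely, an interval containing \<sigma> comes from a selected summand,
        and this summand contains the monomial of \<sigma>.\<close>
      obtain s'' where s'': "indicator_monomial \<sigma> = t (\<iota> F') + s''" "Poly_Mapping.keys s'' \<subseteq> \<sigma>"
        using indicator_monomial_split[OF s' finF face(2)] F' by blast
      have "Poly_Mapping.keys s'' \<subseteq> X (\<iota> F')" using s''(2) F' \<iota>(2) by auto
      then have "\<iota> F' = i" using unique[OF face(1) _ s''(1) _ i] \<iota>(1) F' by blast
      then show "F' = X i" using \<iota>(2) F' by blast
    qed
  qed
  then show ?thesis
    by (intro exI[of _ "\<lambda>F. Poly_Mapping.keys (t (\<iota> F))"] allI impI) (elim bexE)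
qed

text \<open>A decomposition with all sets larger than \<open>d\<close> would yield a partition;
  \<open>np\<close> provides for every choice of lower ends a face where it fails.\<close>

lemma sdepth_less:
  assumes card: "\<And>F. F \<in> \<F> \<Longrightarrow> card F = Suc d"
    and np: "\<And>\<rho>. \<exists>\<sigma>. (\<exists>F\<in>\<F>. \<sigma> \<subseteq> F) \<and> \<not> (\<exists>!F. F \<in> \<F> \<and> \<rho> F \<subseteq> \<sigma> \<and> \<sigma> \<subseteq> F)"
  shows "sdepth n Q gr \<le> enat d"
proof -
  have "(INF i\<in>{..<r}. enat (card (X i))) \<le> enat d" if dec: "stanley_decomposition n Q gr r X z" for r X z
  proof -
    \<comment> \<open>The existence of an index also excludes the empty decomposition, whose infimum
      would be \<infinity>.\<close>
    have "\<exists>i<r. \<not> Suc d \<le> card (X i)"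
    proof (rule ccontr)
      assume "\<not> ?thesis"
      then have large: "Suc d \<le> card (X i)" if "i < r" for i using that by blast
      have "\<exists>\<rho>. \<forall>\<sigma>. (\<exists>F\<in>\<F>. \<sigma> \<subseteq> F) \<longrightarrow> (\<exists>!F. F \<in> \<F> \<and> \<rho> F \<subseteq> \<sigma> \<and> \<sigma> \<subseteq> F)"
        by (rule stanley_decomposition_partition[OF dec card large])
      then obtain \<rho> where \<rho>: "\<forall>\<sigma>. (\<exists>F\<in>\<F>. \<sigma> \<subseteq> F) \<longrightarrow> (\<exists>!F. F \<in> \<F> \<and> \<rho> F \<subseteq> \<sigma> \<and> \<sigma> \<subseteq> F)" ..
      obtain \<sigma> where "\<exists>F\<in>\<F>. \<sigma> \<subseteq> F" "\<not> (\<exists>!F. F \<in> \<F> \<and> \<rho> F \<subseteq> \<sigma> \<and> \<sigma> \<subseteq> F)"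
        using np[of \<rho>] by (elim exE conjE)
      then show False using spec[OF \<rho>, of \<sigma>] by (elim impE notE)
    qed
    then obtain i where "i < r" "\<not> Suc d \<le> card (X i)" by blast
    then have "(INF i\<in>{..<r}. enat (card (X i))) \<le> enat (card (X i))" "card (X i) \<le> d"
      by (auto intro: INF_lower)
    then show ?thesis by (meson enat_ord_simps(1) order_trans)
  qed
  then show ?thesis unfolding sdepth_def by (intro SUP_least) auto
qed

end

section \<open>The glued complex\<close>

lemma vertices_complex_of: "vertices (complex_of \<F>) = \<Union>\<F>"
  by (auto simp: vertices_def complex_of_def)

lemma vertices_A_complex: "vertices A_complex = A_vertices"
  unfolding A_complex_facets vertices_complex_of A_facets_list A_vertices_def by auto

lemma vertices_X_complex: "vertices X_complex = {0,1,2,3,4,5,6,7,8,9}"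
  unfolding X_complex_facets vertices_complex_of X_facets_list by auto

lemma vertices_glue: "vertices (glue N X A) = (\<Union>j<N. copy_vertex A j ` vertices X)"
  by (auto simp: glue_def vertices_def)

lemma relabel_glue_complex_of:
  "relabel lab (glue N (complex_of \<F>) A) = complex_of (\<Union>j<N. (`) (\<lambda>v. lab (copy_vertex A j v)) ` \<F>)"
proof -
  have *: "(`) lab ` (`) (copy_vertex A j) ` complex_of \<F> = (\<Union>F\<in>\<F>. Pow ((\<lambda>v. lab (copy_vertex A j v)) ` F))" for j
    unfolding complex_of_def image_UN image_Pow_surj[OF refl] by (simp add: image_image)
  show ?thesis
    unfolding relabel_def glue_def image_UN * unfolding complex_of_def UN_UN_flatten by simp
qed

lemma vertices_C3: "vertices C3 = Inl ` A_vertices \<union> Inr ` ({..<3} \<times> {1,5,9})"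
proof -
  have "{0,1,2,3,4,5,6,7,8,9} = A_vertices \<union> {1,5,9}" unfolding A_vertices_def by auto
  moreover have "copy_vertex A_complex j ` A_vertices = Inl ` A_vertices" for j
    by (intro image_cong) (auto simp: copy_vertex_def vertices_A_complex)
  moreover have "copy_vertex A_complex j ` {1,5,9} = Inr ` ({j} \<times> {1,5,9})" for j
    by (auto simp: copy_vertex_def vertices_A_complex A_vertices_def)
  ultimately have "vertices C3 = (\<Union>j<3. Inl ` A_vertices \<union> Inr ` ({j} \<times> {1,5,9}))"
    unfolding C3_def vertices_glue vertices_X_complex by (simp only: image_Un)
  also have "\<dots> = (\<Union>j<(3::nat). Inl ` A_vertices) \<union> Inr ` (\<Union>j<3. {j} \<times> {1,5,9})"
    unfolding UN_Un_distrib image_UN ..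
  also have "(\<Union>j<(3::nat). Inl ` A_vertices :: (nat + nat \<times> nat) set) = Inl ` A_vertices"
    by (rule UN_constant_eq[of 0]) simp_all
  also have "(\<Union>j<(3::nat). {j} \<times> {1,5,9}) = {..<3} \<times> {1,5,9::nat}" by blast
  finally show ?thesis .
qed

text \<open>The 7 vertices of \<open>A\<close> are shared, and each of the three copies adds its own
  1, 5 and 9.\<close>

lemma card_vertices_C3: "finite (vertices C3)" "card (vertices C3) = 16"
proof -
  have fin: "finite A_vertices" "card A_vertices = 7" by (simp_all add: A_vertices_def)
  then show "finite (vertices C3)" by (simp add: vertices_C3)
  have "card (vertices C3) = card (Inl ` A_vertices :: (nat + nat \<times> nat) set)
      + card (Inr ` ({..<3} \<times> {1,5,9}) :: (nat + nat \<times> nat) set)"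
    unfolding vertices_C3 using fin by (intro card_Un_disjoint) auto
  also have "\<dots> = 16" using fin by (simp add: card_image)
  finally show "card (vertices C3) = 16" .
qed

lemma three_copies_labeling:
  assumes lab: "bij_betw lab (vertices C3) {1..16}"
  shows "three_copies (\<lambda>j v. lab (copy_vertex A_complex j v)) {1..16}"
proof
  show "finite {1..16::nat}" by simp
  have in_C3: "copy_vertex A_complex j v \<in> vertices C3" if "j < 3" "v \<le> 9" for j v
  proof -
    have "v \<in> {0,1,2,3,4,5,6,7,8,9}" using that(2) by auto
    then show ?thesis
      unfolding C3_def vertices_glue vertices_X_complex using that(1) by (intro UN_I[of j] imageI) simp_all
  qed
  show "lab (copy_vertex A_complex j v) \<in> {1..16}" if "j < 3" "v \<le> 9" for j v
    using bij_betw_apply[OF lab in_C3[OF that]] .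
  show "lab (copy_vertex A_complex i v) = lab (copy_vertex A_complex j w) \<longleftrightarrow> v = w \<and> (i = j \<or> v \<in> A_vertices)"
    if "i < 3" "j < 3" "v \<le> 9" "w \<le> 9" for i j v w
  proof -
    have "lab (copy_vertex A_complex i v) = lab (copy_vertex A_complex j w)
      \<longleftrightarrow> copy_vertex A_complex i v = copy_vertex A_complex j w"
      using inj_on_eq_iff[OF bij_betw_imp_inj_on[OF lab] in_C3[OF that(1,3)] in_C3[OF that(2,4)]] .
    also have "\<dots> \<longleftrightarrow> v = w \<and> (i = j \<or> v \<in> A_vertices)"
      by (simp add: copy_vertex_def vertices_A_complex) metis
    finally show ?thesis .
  qed
qed

lemma face_ring_C3:
  fixes lab :: "nat + nat \<times> nat \<Rightarrow> nat"
  assumes lab: "bij_betw lab (vertices C3) {1..16}"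
  defines "M \<equiv> face_ring 16 (relabel lab C3) :: ('k::field mpoly, 'k mpoly set) module"
    and "gr \<equiv> face_ring_grading 16 (relabel lab C3)"
  shows "sdepth 16 M gr \<le> 3" "4 \<le> depth 16 M" "graded_module 16 M gr" "finitely_generated 16 M"
proof -
  interpret tc: three_copies "\<lambda>j v. lab (copy_vertex A_complex j v)" "{1..16}"
    by (rule three_copies_labeling[OF lab])
  have relabel: "relabel lab C3 = complex_of tc.C3_facets"
    unfolding C3_def X_complex_facets relabel_glue_complex_of tc.C3_facets_def tc.facets_def ..
  interpret fr: face_ring_facets 16 tc.C3_facets "nonfaces {1..16} tc.C3_facets :: 'k mpoly set"
  proof unfold_locales
    show "F \<subseteq> {1..16}" if "F \<in> tc.C3_facets" for F using that by (rule tc.C3_facet_subset)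
    show "tc.C3_facets \<noteq> {}"
      by (simp add: tc.C3_facets_eq tc.facets_def X_facets_list)
  qed
  have M: "M = fr.Q" unfolding M_def relabel by (rule fr.face_ring_eq)
  have gr: "gr = fr.gr" unfolding gr_def relabel by (rule fr.face_ring_grading_eq)
  show "graded_module 16 M gr" "finitely_generated 16 M"
    unfolding M gr by (rule fr.graded_module_Q fr.finitely_generated_Q)+
  have np: "\<exists>\<sigma>. (\<exists>F\<in>tc.C3_facets. \<sigma> \<subseteq> F) \<and> \<not> (\<exists>!F. F \<in> tc.C3_facets \<and> \<rho> F \<subseteq> \<sigma> \<and> \<sigma> \<subseteq> F)" for \<rho>
  proof (rule ccontr)
    assume neg: "\<not> ?thesis"
    show False
    proof (rule tc.not_partitionable)
      fix \<sigma> assume \<sigma>: "\<exists>F\<in>tc.C3_facets. \<sigma> \<subseteq> F"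
      show "\<exists>!F. F \<in> tc.C3_facets \<and> \<rho> F \<subseteq> \<sigma> \<and> \<sigma> \<subseteq> F"
        by (rule ccontr) (rule notE[OF neg exI[of _ \<sigma>]], rule conjI[OF \<sigma>])
    qed
  qed
  have "sdepth 16 fr.Q fr.gr \<le> enat 3"
    using tc.card_C3_facet(2) by (intro fr.sdepth_less[OF _ np]) simp
  then show "sdepth 16 M gr \<le> 3" unfolding M gr by (simp add: numeral_eq_enat)
  have length: "length (tc.lsop :: 'k mpoly list) = 4" unfolding tc.lsop_def lsop_supports_def by simp
  have "enat (length (tc.lsop :: 'k mpoly list)) \<le> depth 16 fr.Q"
  proof (rule fr.length_le_depth)
    show "wreg (tc.lsop :: 'k mpoly list) (polys_in {1..16}) (nonfaces {1..16} tc.C3_facets)"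
      unfolding tc.C3_facets_eq by (rule tc.wreg_C3)
    show "set (tc.lsop :: 'k mpoly list) \<subseteq> range (linear_form {1..16})"
      unfolding tc.lsop_def by auto
  qed
  then show "4 \<le> depth 16 M" unfolding M length by (simp add: numeral_eq_enat)
qed

theorem mainTheorem6:
  shows "(\<forall>lab. bij_betw lab (vertices C3) {1..16} \<longrightarrow>
            sdepth 16 (face_ring 16 (relabel lab C3) :: ('k::field mpoly, 'k mpoly set) module)
              (face_ring_grading 16 (relabel lab C3))
            < depth 16 (face_ring 16 (relabel lab C3) :: ('k mpoly, 'k mpoly set) module))
         \<and> \<not> depth_conjecture TYPE('k) TYPE('k mpoly set) 16"
proof
  have less: "sdepth 16 (face_ring 16 (relabel lab C3) :: ('k mpoly, 'k mpoly set) module)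
              (face_ring_grading 16 (relabel lab C3))
            < depth 16 (face_ring 16 (relabel lab C3) :: ('k mpoly, 'k mpoly set) module)"
    if "bij_betw lab (vertices C3) {1..16}" for lab
  proof -
    have "(3 :: enat) < 4" by simp
    then show ?thesis
      using face_ring_C3(1,2)[OF that, where 'k = 'k] by (meson le_less_trans less_le_trans)
  qed
  then show "\<forall>lab. bij_betw lab (vertices C3) {1..16} \<longrightarrow>
            sdepth 16 (face_ring 16 (relabel lab C3) :: ('k mpoly, 'k mpoly set) module)
              (face_ring_grading 16 (relabel lab C3))
            < depth 16 (face_ring 16 (relabel lab C3) :: ('k mpoly, 'k mpoly set) module)"
    by blast
  \<comment> \<open>The inequality holds for every labeling; refuting the conjecture needs one to
    exist, and the count of 16 vertices provides it.\<close>
  obtain lab where lab: "bij_betw lab (vertices C3) {1..16::nat}"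
    using finite_same_card_bij[OF card_vertices_C3(1), of "{1..16::nat}"] card_vertices_C3(2) by auto
  show "\<not> depth_conjecture TYPE('k) TYPE('k mpoly set) 16"
  proof
    assume "depth_conjecture TYPE('k) TYPE('k mpoly set) 16"
    then have "depth 16 (face_ring 16 (relabel lab C3) :: ('k mpoly, 'k mpoly set) module)
      \<le> sdepth 16 (face_ring 16 (relabel lab C3) :: ('k mpoly, 'k mpoly set) module)
          (face_ring_grading 16 (relabel lab C3))"
      unfolding depth_conjecture_def using face_ring_C3(3,4)[OF lab, where 'k = 'k] by blast
    then show False using less[OF lab] by simp
  qed
qed

end
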